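(* Let $n\ge4$, $k\in\mathbb{Z}$, and $\mathbf{e}\in\mathbb{Z}_{\ge0}^n$ with $0\le|\mathbf{e}|\le n-3$, where $|\mathbf{e}|=\sum_i e_i$. Let $I\subset\{1,\dots,n\}$ with $2\le\#I\le n-2$, let $$\delta:=\sum_{i\in I}x_i-k(\#I-1),$$ and consider the wall $\delta=0$ in $\{\mathbf{x}:\sum_i x_i=k(n-2)\}$. Let $P_1^\delta$ be the polynomial expression for $\mathrm{H}^{\mathrm{trop}}_0(\mathbf{x},\mathbf{e})$ on the side $\delta>0$ of the wall and $P_2^\delta$ the polynomial expression on the side $\delta<0$ (in two chambers adjacent along the wall). Let $\mathbf{e}_I=(e_i)_{i\in I}$, $\mathbf{x}_I=(x_i)_{i\in I}$, and similarly for the complement $I^c$, and let $$r=n-2-|\mathbf{e}|,\qquad r_1=\#I-1-|\mathbf{e}_I|,\qquad r_2=\#I^c-1-|\mathbf{e}_{I^c}|.$$ Then $$P_1^\delta-P_2^\delta=\binom{r}{r_1,r_2}\cdot\delta\cdot\mathrm{H}_0(\mathbf{x}_I\cup\{-\delta\},\mathbf{e}_I)\cdot\mathrm{H}_0(\mathbf{x}_{I^c}\cup\{\delta\},\mathbf{e}_{I^c}).$$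
   Context: Chow groups have $\mathbb{Q}$-coefficients; $\psi_i$ are the cotangent line classes. **Conventions for the statement.** $\mathbf{x}_I\cup\{-\delta\}$ denotes the vector indexed by $I$ and one additional marking carrying the entry $-\delta$; the additional marking has Psi-exponent $0$; similarly for $I^c$. If $r_1\le0$ or $r_2\le 0$ the right-hand side is interpreted as $0$. Here $\binom{r}{r_1,r_2}=\frac{r!}{r_1!\,r_2!}$. The walls are the hyperplanes $\sum_{i\in J}x_i=k(\#J-1)$, $2\le\#J\le n-2$, in $\{\mathbf{x}\in\mathbb{R}^n:\sum x_i=k(n-2)\}$, and chambers are the connected components of the complement of their union. On each chamber $\mathrm{H}_0(\mathbf{x},\mathbf{e})=\mathrm{H}_0^{\mathrm{trop}}(\mathbf{x},\mathbf{e})$ is given by a polynomial in $\mathbf{x}$; the polynomial expression meant is the one given by the tropical sum below, which in genus $0$ makes sense for real $\mathbf{x}$ (allowing real expansion factors). The claimed identity is an identity of polynomials, the two factors $\mathrm{H}_0$ on the right being given by their polynomial expressions on the union of the two adjacent chambers. **Tropical count in genus 0.** An abstract rational tropical curve is a metric tree $\Gamma$ whose edges leading to leaves (ends, labeled $1,\dots,n$) have infinite length and whose other (bounded) edges have finite length; vertices are the points of valence different from $2$ (excluding the infinitely distant leaves). A metric line graph $T$ is a polyhedral subdivision of $\mathbb{R}$ up to translation, oriented from left to right. A $k$-leaky cover $\pi:\Gamma\to T$ of degree $\mathbf{x}$ is a map that is affine linear on edges with positive integer slopes $\omega(e)$ (expansion factors), such that at every vertex $d^l_v-d^r_v=k(\mathrm{val}(v)-2)$,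 where $d_v^l$ (resp. $d_v^r$) is the sum of the expansion factors of the flags at $v$ pointing left (resp. right), and such that end $i$ has expansion factor $|x_i|$ and points to the left if $x_i>0$ and to the right if $x_i<0$ (contracted if $x_i=0$); $\pi$ need not be surjective onto the unbounded rays of $T$. It is stable if the preimage of every vertex of $T$ contains a vertex of valence $>2$. With $I_v$ the set of ends adjacent to $v$, it satisfies the Psi-conditions $\mathbf{e}$ if $\mathrm{val}(v)=\sum_{i\in I_v}e_i+3$ for all vertices $v$. Fix $T$ with $n-2-|\mathbf{e}|$ vertices. Then $$\mathrm{H}^{\mathrm{trop}}_0(\mathbf{x},\mathbf{e})=\sum_\pi\frac1{|\mathrm{Aut}(\pi)|}\prod_e\omega(e)\prod_v\mathrm{mult}_v,\qquad \mathrm{mult}_v=\int_{\overline{\mathcal M}_{0,\mathrm{val}(v)}}\prod_{i\in I_v}\psi_i^{e_i}=\frac{(\mathrm{val}(v)-3)!}{\prod_{i\in I_v}e_i!},$$ summing over isomorphism classes of stable $k$-leaky covers $\pi:\Gamma\to T$ of degree $\mathbf{x}$ with $\Gamma$ rational, satisfying the Psi-conditions; products are over bounded edges and vertices of $\Gamma$. **$k$-leaky double Hurwitz descendants in genus 0.** For $m\ge3$ markings with degree $\mathbf{y}\in\mathbb{Z}^m$, $\sum y_i=k(m-2)$, and $\mathbf{e}\in\mathbb{Z}_{\ge0}^m$, $|\mathbf{e}|\le m-3$, let $c=m-3-|\mathbf{e}|$. Let $\mathsf{Ex}$ be the stack of expansions (chains of rational curves with marked points $0,\infty$ at opposite ends),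 which is the Artin fan of the cone stack of metric line graphs, and $T_c$ its closed codimension $c$ stratum (chains with at least $c$ nodes). Let $\overline{\mathcal M}^\sim_{0,\mathbf{y}}$ be the Marcus–Wise rubber space of stable genus $0$ log curves with a piecewise linear function $\alpha$ on the tropicalization, up to constants, having slope $-y_i$ in the outward direction along leg $i$ and totally ordered values at the vertices, with $(\omega^{\log})^{\otimes k}\cong\mathcal{O}(\alpha)$ up to a line bundle from the base (on a component, $\mathcal{O}(\alpha)$ is $\mathcal{O}(\sum_h-s_hq_h)$ with $s_h$ the outgoing slopes at special points $q_h$). Let $\mathsf{b}:\overline{\mathcal M}^\sim_{0,\mathbf{y}}\to\mathsf{Ex}$ be the map whose tropicalization records the subdivision of $\mathbb{R}$ at the images of the vertices. On a suitable log blowup $\widehat{\mathcal M}\to\overline{\mathcal M}_{0,m}$ there are an embedding $\iota:\overline{\mathcal M}^\sim_{0,\mathbf{y}}\to\widehat{\mathcal M}$ over $\overline{\mathcal M}_{0,m}$ and a map $\mathsf{t}:\widehat{\mathcal M}\to\mathsf{Ex}$ with $\mathsf{t}\circ\iota=\mathsf{b}$; the class $\iota_*[\overline{\mathcal M}^\sim_{0,\mathbf{y}}]^{\mathrm{vir}}$ defines the logarithmic double ramification cycle $\mathrm{logDR}_0(\mathbf{y})$ in the logarithmic Chow ring (the direct limit of Chow rings of smooth log blowups), and $\mathrm{Br}_0^c(\mathbf{y})=\mathsf{t}^*[T_c]$. Then $\mathrm{H}_0(\mathbf{y},\mathbf{e})=\int_{\overline{\mathcal M}_{0,m}}\mathrm{logDR}_0(\mathbf{y})\cdot\prod_i\psi_i^{e_i}\cdot\mathrm{Br}_0^c(\mathbf{y})$,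 and $\mathrm{H}_0(\mathbf{y},\mathbf{e})=\mathrm{H}_0^{\mathrm{trop}}(\mathbf{y},\mathbf{e})$. *)

theory Defs
  imports "HOL-Analysis.Analysis"
begin

section \<open>Rational tropical curves\<close>

text \<open>
  The combinatorial data of an abstract tropical curve whose ends are labelled by a set \<open>L\<close> of
  labels of type \<open>'a\<close>: vertices, bounded edges (as two-element sets of vertices, which suffices
  because only trees are considered), the vertex \<open>leg i\<close> to which the end \<open>i\<close> is attached, and the
  lengths of the bounded edges. Ends have infinite length and carry no further data. Values of
  the functions outside of \<open>L\<close>, \<open>verts\<close>, \<open>edges\<close> are irrelevant; they are disregarded by the
  notion of isomorphism below.
\<close>

record 'a curve =
  verts :: "nat set"
  edges :: "nat set set"
  leg :: "'a \<Rightarrow> nat"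
  len :: "nat set \<Rightarrow> real"

definition ends_at :: "'a set \<Rightarrow> ('a, 'b) curve_scheme \<Rightarrow> nat \<Rightarrow> 'a set" where
  "ends_at L G v = {i \<in> L. leg G i = v}"

definition val :: "'a set \<Rightarrow> ('a, 'b) curve_scheme \<Rightarrow> nat \<Rightarrow> nat" where
  "val L G v = card {d \<in> edges G. v \<in> d} + card (ends_at L G v)"

definition connected_graph :: "nat set \<Rightarrow> nat set set \<Rightarrow> bool" where
  "connected_graph V E \<longleftrightarrow> (\<forall>u\<in>V. \<forall>v\<in>V. (u, v) \<in> {(a, b). {a, b} \<in> E}\<^sup>*)"

definition has_cycle :: "nat set set \<Rightarrow> bool" where
  "has_cycle E \<longleftrightarrow>
     (\<exists>c. length c \<ge> 3 \<and> distinct c \<and>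
          (\<forall>i < length c. {c ! i, c ! (Suc i mod length c)} \<in> E))"

text \<open>
  The points of valence 1 are the infinitely distant leaves, which are not vertices, and points of
  valence 2 are not vertices either; hence every vertex has valence at least 3.
\<close>

definition rational_curve :: "'a set \<Rightarrow> ('a, 'b) curve_scheme \<Rightarrow> bool" where
  "rational_curve L G \<longleftrightarrow>
     finite (verts G) \<and> verts G \<noteq> {} \<and>
     edges G \<subseteq> {{u, v} | u v. u \<in> verts G \<and> v \<in> verts G \<and> u \<noteq> v} \<and>
     connected_graph (verts G) (edges G) \<and> \<not> has_cycle (edges G) \<and>
     (\<forall>i\<in>L. leg G i \<in> verts G) \<and>
     (\<forall>d\<in>edges G. len G d > 0) \<and>
     (\<forall>v\<in>verts G. val L G v \<ge> 3)"

section \<open>Leaky covers\<close>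

text \<open>
  A metric line graph is given by the finite set \<open>T\<close> of its vertices in the real line. A map to it
  is recorded by the positions \<open>pos v\<close> of the images of the vertices and by the expansion factors
  \<open>slope d\<close> of the bounded edges; the expansion factor of the end \<open>i\<close> is the absolute value of
  \<open>x i\<close>, and this end points to the left if \<open>x i > 0\<close> and to the right if \<open>x i < 0\<close>.
  Expansion factors are allowed to be real; for integral \<open>x\<close> they are automatically integral, by
  the leaky condition on a tree.
\<close>

record 'a cover = "'a curve" +
  slope :: "nat set \<Rightarrow> real"
  pos :: "nat \<Rightarrow> real"

definition left_sum :: "'a set \<Rightarrow> ('a \<Rightarrow> real) \<Rightarrow> 'a cover \<Rightarrow> nat \<Rightarrow> real" where
  "left_sum L x P v =
     (\<Sum>w | w \<in> verts P \<and> {v, w} \<in> edges P \<and> pos P w < pos P v. slope P {v, w}) +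
     (\<Sum>i | i \<in> ends_at L P v \<and> x i > 0. \<bar>x i\<bar>)"

definition right_sum :: "'a set \<Rightarrow> ('a \<Rightarrow> real) \<Rightarrow> 'a cover \<Rightarrow> nat \<Rightarrow> real" where
  "right_sum L x P v =
     (\<Sum>w | w \<in> verts P \<and> {v, w} \<in> edges P \<and> pos P w > pos P v. slope P {v, w}) +
     (\<Sum>i | i \<in> ends_at L P v \<and> x i < 0. \<bar>x i\<bar>)"

definition leaky_cover :: "real set \<Rightarrow> int \<Rightarrow> 'a set \<Rightarrow> ('a \<Rightarrow> real) \<Rightarrow> 'a cover \<Rightarrow> bool" where
  "leaky_cover T k L x P \<longleftrightarrow>
     rational_curve L P \<and>
     (\<forall>v\<in>verts P. pos P v \<in> T) \<and>
     (\<forall>d\<in>edges P. slope P d > 0) \<and>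
     (\<forall>u v. {u, v} \<in> edges P \<longrightarrow> \<bar>pos P u - pos P v\<bar> = slope P {u, v} * len P {u, v}) \<and>
     (\<forall>v\<in>verts P. left_sum L x P v - right_sum L x P v = of_int k * (real (val L P v) - 2))"

definition stable_cover :: "real set \<Rightarrow> 'a set \<Rightarrow> 'a cover \<Rightarrow> bool" where
  "stable_cover T L P \<longleftrightarrow> (\<forall>t\<in>T. \<exists>v\<in>verts P. pos P v = t \<and> val L P v > 2)"

definition psi_conditions :: "'a set \<Rightarrow> ('a \<Rightarrow> nat) \<Rightarrow> 'a cover \<Rightarrow> bool" where
  "psi_conditions L e P \<longleftrightarrow> (\<forall>v\<in>verts P. val L P v = (\<Sum>i\<in>ends_at L P v. e i) + 3)"

definition covers ::
    "real set \<Rightarrow> int \<Rightarrow> 'a set \<Rightarrow> ('a \<Rightarrow> real) \<Rightarrow> ('a \<Rightarrow> nat) \<Rightarrow> 'a cover set" where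
  "covers T k L x e =
     {P. leaky_cover T k L x P \<and> stable_cover T L P \<and> psi_conditions L e P}"

text \<open>
  The target, although only given up to translation, has no nontrivial automorphisms, so isomorphisms
  of covers are the isomorphisms of the sources over \<open>T\<close>. Since the sources are
  trees without multiple edges, they are determined by their effect on vertices.
\<close>

definition cover_iso :: "'a set \<Rightarrow> 'a cover \<Rightarrow> 'a cover \<Rightarrow> (nat \<Rightarrow> nat) \<Rightarrow> bool" where
  "cover_iso L P P' f \<longleftrightarrow>
     bij_betw f (verts P) (verts P') \<and>
     edges P' = (\<lambda>d. f ` d) ` edges P \<and>
     (\<forall>i\<in>L. leg P' i = f (leg P i)) \<and>
     (\<forall>d\<in>edges P. len P' (f ` d) = len P d \<and> slope P' (f ` d) = slope P d) \<and>
     (\<forall>v\<in>verts P. pos P' (f v) = pos P v)"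

definition iso_rel :: "'a set \<Rightarrow> 'a cover set \<Rightarrow> ('a cover \<times> 'a cover) set" where
  "iso_rel L \<P> = {(P, P'). P \<in> \<P> \<and> P' \<in> \<P> \<and> (\<exists>f. cover_iso L P P' f)}"

definition Aut :: "'a set \<Rightarrow> 'a cover \<Rightarrow> (nat \<Rightarrow> nat) set" where
  "Aut L P = {f. f permutes verts P \<and> cover_iso L P P f}"

section \<open>The tropical count\<close>

text \<open>
  The integral of the product of the powers \<open>\<psi>\<^sub>i ^ e i\<close> of cotangent line classes, \<open>i\<close> ranging
  over the ends at \<open>v\<close>, over the moduli space of stable rational curves with \<open>val L P v\<close> markings.
\<close>

definition vertex_mult :: "'a set \<Rightarrow> ('a \<Rightarrow> nat) \<Rightarrow> 'a cover \<Rightarrow> nat \<Rightarrow> real" where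
  "vertex_mult L e P v = fact (val L P v - 3) / (\<Prod>i\<in>ends_at L P v. fact (e i))"

definition cover_weight :: "'a set \<Rightarrow> ('a \<Rightarrow> nat) \<Rightarrow> 'a cover \<Rightarrow> real" where
  "cover_weight L e P =
     1 / real (card (Aut L P)) * (\<Prod>d\<in>edges P. slope P d) * (\<Prod>v\<in>verts P. vertex_mult L e P v)"

text \<open>
  The sum over isomorphism classes. The vertex set \<open>T\<close> of the target is to be taken with
  \<open>card L - 2 - (\<Sum>i\<in>L. e i)\<close> elements.
\<close>

definition H0_trop ::
    "real set \<Rightarrow> int \<Rightarrow> 'a set \<Rightarrow> ('a \<Rightarrow> real) \<Rightarrow> ('a \<Rightarrow> nat) \<Rightarrow> real" where
  "H0_trop T k L x e =
     (\<Sum>K \<in> covers T k L x e // iso_rel L (covers T k L x e). cover_weight L e (SOME P. P \<in> K))"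

section \<open>Walls and chambers\<close>

definition leaky_space :: "int \<Rightarrow> (real ^ 'n) set" where
  "leaky_space k = {x. (\<Sum>i\<in>UNIV. x $ i) = of_int k * (real CARD('n) - 2)}"

definition wall_form :: "int \<Rightarrow> 'n set \<Rightarrow> real ^ 'n \<Rightarrow> real" where
  "wall_form k J x = (\<Sum>i\<in>J. x $ i) - of_int k * (real (card J) - 1)"

definition wall :: "int \<Rightarrow> 'n set \<Rightarrow> (real ^ 'n) set" where
  "wall k J = {x \<in> leaky_space k. wall_form k J x = 0}"

definition chambers :: "int \<Rightarrow> (real ^ 'n) set set" where
  "chambers k =
     components (leaky_space k - (\<Union>J \<in> {J. 2 \<le> card J \<and> card J \<le> CARD('n) - 2}. wall k J))"

text \<open>
  Two chambers are adjacent along a wall if their closures share a piece of full dimension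
  of that wall.
\<close>

definition adjacent_along ::
    "(real ^ 'n) set \<Rightarrow> (real ^ 'n) set \<Rightarrow> (real ^ 'n) set \<Rightarrow> bool" where
  "adjacent_along W C D \<longleftrightarrow>
     (\<exists>p\<in>W. \<exists>\<epsilon>>0. W \<inter> ball p \<epsilon> \<subseteq> closure C \<inter> closure D)"

text \<open>
  For a union \<open>U\<close> of chambers, which is nonempty and open in \<open>leaky_space k\<close>, the values
  on \<open>leaky_space k\<close> of a polynomial expression are uniquely determined.
\<close>

definition polynomial_expression ::
    "(real ^ 'n) set \<Rightarrow> (real ^ 'n \<Rightarrow> real) \<Rightarrow> (real ^ 'n \<Rightarrow> real) \<Rightarrow> bool" where
  "polynomial_expression U f p \<longleftrightarrow> real_polynomial_function p \<and> (\<forall>x\<in>U. p x = f x)"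

end

theory Submission
  imports Defs
begin

text \<open>
  Why the wall-crossing formula holds. The Psi-conditions force a curve to have exactly as many vertices as
  \<open>T\<close> has points. Hence the vertices of a stable cover lie over different points, one over each
  point of \<open>T\<close>, and the cover has no automorphisms. So an isomorphism class of covers amounts to
  a tree on the vertex set \<open>T\<close> with ends labelled by \<open>L\<close>: the leaky condition
  determines the expansion factor of the edge from \<open>u\<close> to \<open>v\<close>, \<open>u < v\<close>,
  as the value of the wall form \<open>(\<Sum>i\<in>J. x i) - k * (card J - 1)\<close>, where \<open>J\<close>
  is the set of ends on the side of \<open>u\<close>, and conversely every labelled tree satisfying the
  Psi-conditions all of whose edges get positive values comes from a cover
  (\<open>H0_trop_eq_tree_sum\<close>). This turns the tropical count into a finite sum of products of linear
  forms, over those trees that are admitted by the signs of the wall forms. The signs are constant on a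
  chamber, so the sum is polynomial there.

  Two chambers that are adjacent along the wall of \<open>I\<close> lie on the same side of all walls except
  those of \<open>I\<close> and of its complement, which coincide (\<open>adjacent_sgn\<close>). Hence only
  the trees with an edge that separates \<open>I\<close> from its complement matter for the difference. Such
  an edge is unique, because the ends on one side of an edge determine the number of vertices there
  (\<open>edge_unique\<close>). On the side \<open>\<delta> > 0\<close> of the wall it has to run from the
  part with the ends \<open>I\<close> to the other part and contributes the factor \<open>\<delta>\<close>; on
  the side \<open>\<delta> < 0\<close> it has to run the other way and contributes \<open>- \<delta>\<close>.
  In the difference, both orders of its two vertices therefore occur with the factor \<open>\<delta>\<close>,
  and the positions of the two parts become independent of each other. Cutting the edge produces a labelled
  tree for \<open>I\<close> and one for the complement, each with one additional end, together with the subset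
  of \<open>T\<close> over which the first tree lies (\<open>wall_crossing_sum\<close>). As the count for
  either tree depends only on the number of its vertices, the sum over these subsets yields the binomial
  coefficient (\<open>sum_subsets_card\<close>). A polynomial on the hyperplane \<open>leaky_space k\<close>
  is determined by its values on a chamber, so the identity holds for all choices of polynomial expressions.
\<close>

section \<open>Trees by their cuts\<close>

text \<open>
  A set of vertices that is joined to its complement by the edge \<open>{u, v}\<close> only, with
  \<open>u\<close> inside. In a tree it is the component of \<open>u\<close> after removing the edge; this
  description needs no paths and is therefore easy to transport along bijections, to restrict and to glue.
\<close>
definition is_cut :: "'v set \<Rightarrow> 'v set set \<Rightarrow> 'v \<Rightarrow> 'v \<Rightarrow> 'v set \<Rightarrow> bool" where
  "is_cut V E u v A \<longleftrightarrow>
     A \<subseteq> V \<and> u \<in> A \<and> v \<notin> A \<and> (\<forall>a\<in>A. \<forall>b\<in>V - A. {a, b} \<in> E \<longrightarrow> a = u \<and> b = v)"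

text \<open>
  Connectedness is the absence of a separation of the vertices, and acyclicity is the requirement that every
  edge be a bridge. That this agrees with the definition by paths and cycles is shown in
  \<open>tree_iff_connected_acyclic\<close>.
\<close>
definition tree :: "'v set \<Rightarrow> 'v set set \<Rightarrow> bool" where
  "tree V E \<longleftrightarrow>
     finite V \<and> V \<noteq> {} \<and> E \<subseteq> {{u, v} | u v. u \<in> V \<and> v \<in> V \<and> u \<noteq> v} \<and>
     (\<forall>A. A \<subseteq> V \<and> A \<noteq> {} \<and> A \<noteq> V \<longrightarrow> (\<exists>a\<in>A. \<exists>b\<in>V - A. {a, b} \<in> E)) \<and>
     (\<forall>u v. {u, v} \<in> E \<longrightarrow> (\<exists>A. is_cut V E u v A))"

definition cut :: "'v set \<Rightarrow> 'v set set \<Rightarrow> 'v \<Rightarrow> 'v \<Rightarrow> 'v set" where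
  "cut V E u v = (THE A. is_cut V E u v A)"

definition nbrs :: "'v set \<Rightarrow> 'v set set \<Rightarrow> 'v \<Rightarrow> 'v set" where
  "nbrs V E v = {w \<in> V. {v, w} \<in> E}"

lemma is_cutD:
  assumes "is_cut V E u v A"
  shows "A \<subseteq> V" "u \<in> A" "v \<notin> A"
  using assms by (simp_all add: is_cut_def)

lemma is_cut_crossing:
  assumes "is_cut V E u v A" "a \<in> A" "b \<in> V" "b \<notin> A" "{a, b} \<in> E"
  shows "a = u" "b = v"
  using assms unfolding is_cut_def by blast+

lemma tree_finite: "tree V E \<Longrightarrow> finite V"
  and tree_nonempty: "tree V E \<Longrightarrow> V \<noteq> {}"
  by (auto simp: tree_def)

lemma tree_edgeD:
  assumes "tree V E" "{u, v} \<in> E"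
  shows "u \<in> V" "v \<in> V" "u \<noteq> v"
  using assms unfolding tree_def by (fastforce simp: doubleton_eq_iff)+

lemma tree_edgeE:
  assumes "tree V E" "d \<in> E"
  obtains u v where "u \<in> V" "v \<in> V" "u \<noteq> v" "d = {u, v}"
  using assms unfolding tree_def by blast

lemma tree_finite_edges: "tree V E \<Longrightarrow> finite E"
proof -
  assume t: "tree V E"
  have "E \<subseteq> Pow V" using t by (auto elim!: tree_edgeE[OF t])
  then show ?thesis using t by (meson finite_Pow_iff finite_subset tree_finite)
qed

lemma tree_crossing:
  assumes "tree V E" "A \<subseteq> V" "A \<noteq> {}" "A \<noteq> V"
  obtains a b where "a \<in> A" "b \<in> V - A" "{a, b} \<in> E"
  using assms unfolding tree_def by blast

text \<open>
  If two sets are both separated from their complements by the single edge \<open>{u, v}\<close>, no edge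
  leaves their difference, so that the difference is empty by connectedness.
\<close>
lemma is_cut_unique:
  assumes t: "tree V E" and A: "is_cut V E u v A" and B: "is_cut V E u v B"
  shows "A = B"
proof -
  have "A \<subseteq> B" if A: "is_cut V E u v A" and B: "is_cut V E u v B" for A B
  proof (rule ccontr)
    assume "\<not> A \<subseteq> B"
    moreover have "A - B \<subseteq> V" "u \<in> V" "u \<notin> A - B"
      using is_cutD[OF A] is_cutD[OF B] by blast+
    ultimately obtain a b where ab: "a \<in> A - B" "b \<in> V - (A - B)" "{a, b} \<in> E"
      using tree_crossing[OF t, of "A - B"] by blast
    then have ba: "{b, a} \<in> E" by (simp add: insert_commute)
    show False
    proof (cases "b \<in> A")
      case True
      then have "a = v" using is_cut_crossing[OF B _ _ _ ba] ab is_cutD(1)[OF A] by blast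
      with ab is_cutD(3)[OF A] show False by blast
    next
      case False
      then have "a = u" using is_cut_crossing[OF A _ _ _ ab(3)] ab by blast
      with ab is_cutD(2)[OF B] show False by blast
    qed
  qed
  with A B show ?thesis by blast
qed

lemma cut_eqI:
  assumes "tree V E" "is_cut V E u v A"
  shows "cut V E u v = A"
  unfolding cut_def using assms is_cut_unique by (metis the_equality)

lemma is_cut_cut:
  assumes "tree V E" "{u, v} \<in> E"
  shows "is_cut V E u v (cut V E u v)"
proof -
  obtain A where "is_cut V E u v A" using assms unfolding tree_def by blast
  with cut_eqI[OF assms(1) this] show ?thesis by simp
qed

lemma cut_subset: "tree V E \<Longrightarrow> {u, v} \<in> E \<Longrightarrow> cut V E u v \<subseteq> V"
  by (drule (1) is_cut_cut) (simp add: is_cut_def)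

lemma cut_swap:
  assumes t: "tree V E" and e: "{u, v} \<in> E"
  shows "cut V E v u = V - cut V E u v"
proof (rule cut_eqI[OF t])
  have "{a, b} = {b, a}" for a b :: 'a by auto
  then show "is_cut V E v u (V - cut V E u v)"
    using is_cut_cut[OF t e] tree_edgeD[OF t e] unfolding is_cut_def
    by (metis DiffD1 DiffD2 DiffI Diff_subset)
qed

text \<open>
  For connectedness, separate a part \<open>B\<close> not containing \<open>u\<close>: an edge leaving
  \<open>B\<close> in the whole tree cannot be the edge \<open>{u, v}\<close>, so it stays on this side.
\<close>
lemma tree_cut:
  assumes t: "tree V E" and e: "{u, v} \<in> E"
  shows "tree (cut V E u v) (E \<inter> Pow (cut V E u v))"
proof -
  let ?A = "cut V E u v"
  have c: "is_cut V E u v ?A" by (rule is_cut_cut[OF t e])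
  then have AV: "?A \<subseteq> V" and uA: "u \<in> ?A"
    and cr: "\<And>a b. a \<in> ?A \<Longrightarrow> b \<in> V \<Longrightarrow> b \<notin> ?A \<Longrightarrow> {a, b} \<in> E \<Longrightarrow> a = u \<and> b = v"
    by (auto simp: is_cut_def)
  have conn: "\<exists>a\<in>B. \<exists>b\<in>?A - B. {a, b} \<in> E" if B: "B \<subseteq> ?A" "B \<noteq> {}" "u \<notin> B" for B
  proof -
    have "B \<subseteq> V" "B \<noteq> V" using B AV uA by blast+
    then obtain a b where ab: "a \<in> B" "b \<in> V - B" "{a, b} \<in> E"
      using tree_crossing[OF t _ B(2)] by blast
    then have "b \<in> ?A" using cr[of a b] B by blast
    with ab show ?thesis by blast
  qed
  have conn': "\<exists>a\<in>B. \<exists>b\<in>?A - B. {a, b} \<in> E" if B: "B \<subseteq> ?A" "B \<noteq> {}" "B \<noteq> ?A" for B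
  proof (cases "u \<in> B")
    case True
    have "?A - B \<noteq> {}" using B by blast
    with conn[of "?A - B"] True obtain a b where "a \<in> ?A - B" "b \<in> B" "{a, b} \<in> E" by blast
    then show ?thesis by (metis insert_commute)
  qed (use conn B in blast)
  have br: "\<exists>C. is_cut ?A (E \<inter> Pow ?A) a b C" if "{a, b} \<in> E \<inter> Pow ?A" for a b
  proof -
    have "is_cut V E a b (cut V E a b)" using is_cut_cut[OF t] that by blast
    moreover have "a \<in> ?A" using that by blast
    ultimately have "is_cut ?A (E \<inter> Pow ?A) a b (cut V E a b \<inter> ?A)"
      using AV unfolding is_cut_def by blast
    then show ?thesis by blast
  qed
  show ?thesis unfolding tree_def
  proof (intro conjI allI impI)
    show "finite ?A" using AV tree_finite[OF t] finite_subset by blast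
    show "?A \<noteq> {}" using uA by blast
    show "E \<inter> Pow ?A \<subseteq> {{u, v} |u v. u \<in> ?A \<and> v \<in> ?A \<and> u \<noteq> v}"
      by (auto elim!: tree_edgeE[OF t])
  next
    fix B assume "B \<subseteq> ?A \<and> B \<noteq> {} \<and> B \<noteq> ?A"
    with conn'[of B] obtain a b where "a \<in> B" "b \<in> ?A - B" "{a, b} \<in> E" by blast
    with \<open>B \<subseteq> ?A \<and> _\<close> show "\<exists>a\<in>B. \<exists>b\<in>?A - B. {a, b} \<in> E \<inter> Pow ?A" by blast
  qed (use br in blast)
qed

lemma edges_split:
  assumes t: "tree V E" and e: "{u, v} \<in> E"
  shows "E = insert {u, v} (E \<inter> Pow (cut V E u v) \<union> E \<inter> Pow (cut V E v u))" (is "_ = ?R")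
proof
  show "?R \<subseteq> E" using e by blast
  show "E \<subseteq> ?R"
  proof
    fix d assume d: "d \<in> E"
    obtain a b where ab: "a \<in> V" "b \<in> V" "d = {a, b}" using tree_edgeE[OF t d] by metis
    have "is_cut V E u v (cut V E u v)" by (rule is_cut_cut[OF t e])
    moreover have "{b, a} \<in> E" using d ab by (simp add: insert_commute)
    ultimately show "d \<in> ?R" using d ab by (auto simp: cut_swap[OF t e] is_cut_def)
  qed
qed

lemma nbrs_cut:
  assumes t: "tree V E" and e: "{u, v} \<in> E" and a: "a \<in> cut V E u v"
  shows "nbrs V E a = nbrs (cut V E u v) (E \<inter> Pow (cut V E u v)) a \<union> (if a = u then {v} else {})"
  using is_cut_cut[OF t e] a e tree_edgeD[OF t e] unfolding nbrs_def is_cut_def by auto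

lemma nbrs_finite: "tree V E \<Longrightarrow> finite (nbrs V E v)"
  by (simp add: nbrs_def tree_finite)

lemma card_nbrs_cut:
  assumes t: "tree V E" and e: "{u, v} \<in> E" and a: "a \<in> cut V E u v"
  shows "card (nbrs V E a) =
    card (nbrs (cut V E u v) (E \<inter> Pow (cut V E u v)) a) + (if a = u then 1 else 0)"
proof -
  have "v \<notin> cut V E u v" using is_cut_cut[OF t e] by (simp add: is_cut_def)
  then have "v \<notin> nbrs (cut V E u v) (E \<inter> Pow (cut V E u v)) a" by (simp add: nbrs_def)
  then show ?thesis
    using nbrs_cut[OF assms] nbrs_finite[OF tree_cut[OF t e]] by (auto simp: card_insert_if)
qed

text \<open>
  The edge \<open>{u, v}\<close> is the only one that joins the side of \<open>u\<close> to the other side, so the tree on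
  that side misses exactly one of the incidences counted on the left.
\<close>
lemma sum_card_nbrs_cut:
  assumes t: "tree V E" and e: "{u, v} \<in> E"
  shows "(\<Sum>a\<in>cut V E u v. card (nbrs V E a)) =
    (\<Sum>a\<in>cut V E u v. card (nbrs (cut V E u v) (E \<inter> Pow (cut V E u v)) a)) + 1"
proof -
  let ?A = "cut V E u v"
  have u: "u \<in> ?A" using is_cut_cut[OF t e] by (simp add: is_cut_def)
  have fin: "finite ?A" using tree_finite[OF tree_cut[OF t e]] .
  have "(\<Sum>a\<in>?A. card (nbrs V E a)) =
     (\<Sum>a\<in>?A. card (nbrs ?A (E \<inter> Pow ?A) a) + (if a = u then 1 else 0))"
    using card_nbrs_cut[OF t e] by (rule sum.cong[OF refl])
  then show ?thesis using u fin by (simp add: sum.distrib)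
qed

text \<open>
  A tree has one edge less than vertices, and each edge is counted at both of its ends. Cutting
  an edge reduces the claim to the two sides of the edge.
\<close>
lemma tree_handshake: "tree V E \<Longrightarrow> (\<Sum>v\<in>V. card (nbrs V E v)) + 2 = 2 * card V"
proof (induction "card V" arbitrary: V E rule: less_induct)
  case less
  note t = \<open>tree V E\<close>
  obtain u0 where u0: "u0 \<in> V" using tree_nonempty[OF t] by blast
  show ?case
  proof (cases "V = {u0}")
    case True
    then have "nbrs V E u0 = {}" using tree_edgeD(3)[OF t, of u0 u0] by (auto simp: nbrs_def)
    with True show ?thesis by simp
  next
    case False
    then obtain u v where e: "{u, v} \<in> E" using tree_crossing[OF t, of "{u0}"] u0 by blast
    then have e': "{v, u} \<in> E" by (simp add: insert_commute)
    let ?A = "cut V E u v" and ?B = "cut V E v u"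
    have c: "is_cut V E u v ?A" "is_cut V E v u ?B" using is_cut_cut[OF t] e e' by auto
    have B: "?B = V - ?A" by (rule cut_swap[OF t e])
    have fV: "finite V" by (rule tree_finite[OF t])
    have AV: "?A \<subseteq> V" and u: "u \<in> ?A" and v: "v \<in> ?B" using c by (auto simp: is_cut_def)
    have cd: "card V = card ?A + card ?B"
      using B AV fV by (metis card_Diff_subset card_mono finite_subset le_add_diff_inverse)
    have pos: "card ?A > 0" "card ?B > 0"
      using u v AV B fV by (metis card_gt_0_iff empty_iff finite_subset Diff_subset)+
    have "(\<Sum>a\<in>V. card (nbrs V E a)) = (\<Sum>a\<in>?A. card (nbrs V E a)) + (\<Sum>a\<in>?B. card (nbrs V E a))"
      using B AV fV by (metis sum.subset_diff add.commute)
    moreover have small: "card ?A < card V" "card ?B < card V" using cd pos by auto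
    ultimately show ?thesis
      using less.hyps[OF small(1) tree_cut[OF t e]] less.hyps[OF small(2) tree_cut[OF t e']]
        sum_card_nbrs_cut[OF t e] sum_card_nbrs_cut[OF t e'] cd by linarith
  qed
qed

lemma cut_degree_sum:
  assumes t: "tree V E" and e: "{u, v} \<in> E"
  shows "(\<Sum>a\<in>cut V E u v. card (nbrs V E a)) + 1 = 2 * card (cut V E u v)"
  using sum_card_nbrs_cut[OF t e] tree_handshake[OF tree_cut[OF t e]] by simp

text \<open>
  The branches at \<open>v\<close> are disjoint because no edge leaves the intersection of two of them, and
  they exhaust the other vertices because no edge leaves their union together with \<open>v\<close>.
\<close>
lemma branches_partition:
  assumes t: "tree V E" and v: "v \<in> V"
  shows "V - {v} = (\<Union>w\<in>nbrs V E v. cut V E w v)"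
    and "\<lbrakk>w \<in> nbrs V E v; w' \<in> nbrs V E v; w \<noteq> w'\<rbrakk> \<Longrightarrow> cut V E w v \<inter> cut V E w' v = {}"
proof -
  have c: "is_cut V E w v (cut V E w v)" if "w \<in> nbrs V E v" for w
    using is_cut_cut[OF t, of w v] that by (simp add: nbrs_def insert_commute)
  let ?U = "\<Union>w\<in>nbrs V E v. cut V E w v"
  have sub: "?U \<subseteq> V - {v}" using c by (fastforce simp: is_cut_def)
  have "insert v ?U = V"
  proof (rule ccontr)
    assume "insert v ?U \<noteq> V"
    then obtain a b where ab: "a \<in> insert v ?U" "b \<in> V - insert v ?U" "{a, b} \<in> E"
      using tree_crossing[OF t, of "insert v ?U"] sub v by blast
    show False
    proof (cases "a = v")
      case True
      then have "b \<in> nbrs V E v" using ab by (simp add: nbrs_def)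
      then have "b \<in> ?U" using c[of b] by (auto simp: is_cut_def)
      with ab show False by blast
    next
      case False
      then obtain w where "w \<in> nbrs V E v" "a \<in> cut V E w v" using ab by blast
      with c[of w] ab show False by (auto simp: is_cut_def)
    qed
  qed
  with sub show "V - {v} = ?U" by blast
  assume w: "w \<in> nbrs V E v" "w' \<in> nbrs V E v" "w \<noteq> w'"
  show "cut V E w v \<inter> cut V E w' v = {}"
  proof (rule ccontr)
    assume ne: "cut V E w v \<inter> cut V E w' v \<noteq> {}"
    have "cut V E w v \<inter> cut V E w' v \<subseteq> V" "v \<notin> cut V E w v \<inter> cut V E w' v"
      using c[OF w(1)] by (auto simp: is_cut_def)
    then obtain a b where ab: "a \<in> cut V E w v" "a \<in> cut V E w' v"
      "b \<in> V" "b \<notin> cut V E w v \<inter> cut V E w' v" "{a, b} \<in> E"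
      using tree_crossing[OF t _ ne] v by blast
    then have "a = w \<and> b = v \<or> a = w' \<and> b = v"
      using c[OF w(1)] c[OF w(2)] by (auto simp: is_cut_def)
    then show False using ab w c[OF w(1)] c[OF w(2)]
      by (auto simp: is_cut_def)
  qed
qed

text \<open>
  After joining \<open>A\<close> and \<open>B\<close> by the edge \<open>{a, b}\<close>, the side of an edge
  of \<open>A\<close> swallows all of \<open>B\<close> if it contains the attaching point \<open>a\<close>,
  and is unchanged otherwise.
\<close>
lemma is_cut_join:
  assumes c: "is_cut A E u v C" and v: "v \<in> A" and a: "a \<in> A" and b: "b \<in> B"
    and dj: "A \<inter> B = {}"
    and edge: "\<And>x y. {x, y} \<in> E' \<Longrightarrow> x = a \<and> y = b \<or> x = b \<and> y = a \<or>
      {x, y} \<in> E \<and> x \<in> A \<and> y \<in> A \<or> {x, y} \<in> F \<and> x \<in> B \<and> y \<in> B"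
  shows "is_cut (A \<union> B) E' u v (C \<union> (if a \<in> C then B else {}))"
  unfolding is_cut_def
proof (intro conjI ballI impI)
  let ?C = "C \<union> (if a \<in> C then B else {})"
  show "?C \<subseteq> A \<union> B" "u \<in> ?C" "v \<notin> ?C" using is_cutD[OF c] v dj by auto
  fix x y assume xy: "x \<in> ?C" "y \<in> A \<union> B - ?C" "{x, y} \<in> E'"
  have "\<not> (x = a \<and> y = b)" "\<not> (x = b \<and> y = a)" "\<not> (x \<in> B \<and> y \<in> B)"
    using xy a b dj is_cutD(1)[OF c] by (auto split: if_splits)
  then have "{x, y} \<in> E" "x \<in> A" "y \<in> A" using edge[OF xy(3)] by blast+
  moreover then have "x \<in> C" "y \<notin> C" using xy dj by (auto split: if_splits)
  ultimately show "x = u" "y = v" using is_cut_crossing[OF c, of x y] by blast+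
qed

lemma tree_join:
  assumes A: "tree A E" and B: "tree B F" and dj: "A \<inter> B = {}" and a: "a \<in> A" and b: "b \<in> B"
  shows "tree (A \<union> B) (insert {a, b} (E \<union> F))"
    and "is_cut (A \<union> B) (insert {a, b} (E \<union> F)) a b A"
    and "{u, v} \<in> E \<Longrightarrow> is_cut (A \<union> B) (insert {a, b} (E \<union> F)) u v
           (cut A E u v \<union> (if a \<in> cut A E u v then B else {}))"
proof -
  let ?V = "A \<union> B"
  have E: "{u, v} \<in> E \<Longrightarrow> u \<in> A \<and> v \<in> A \<and> u \<noteq> v" for u v using tree_edgeD[OF A] by blast
  have F: "{u, v} \<in> F \<Longrightarrow> u \<in> B \<and> v \<in> B \<and> u \<noteq> v" for u v using tree_edgeD[OF B] by blast
  have edge: "{x, y} \<in> insert {a, b} (E \<union> F) \<Longrightarrow>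
      x = a \<and> y = b \<or> x = b \<and> y = a \<or> {x, y} \<in> E \<and> x \<in> A \<and> y \<in> A \<or>
      {x, y} \<in> F \<and> x \<in> B \<and> y \<in> B" for x y
    using E[of x y] F[of x y] by (auto simp: doubleton_eq_iff)
  show cE: "is_cut ?V (insert {a, b} (E \<union> F)) u v
           (cut A E u v \<union> (if a \<in> cut A E u v then B else {}))" if uv: "{u, v} \<in> E"
      for u v
    by (rule is_cut_join[OF is_cut_cut[OF A uv] _ a b dj edge]) (use E[OF uv] in blast)
  have cF: "is_cut ?V (insert {a, b} (E \<union> F)) u v
           (cut B F u v \<union> (if b \<in> cut B F u v then A else {}))" if uv: "{u, v} \<in> F" for u v
  proof -
    have "v \<in> B" "B \<inter> A = {}" using F[OF uv] dj by blast+
    moreover have "x = b \<and> y = a \<or> x = a \<and> y = b \<or> {x, y} \<in> F \<and> x \<in> B \<and> y \<in> B \<or>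
        {x, y} \<in> E \<and> x \<in> A \<and> y \<in> A" if "{x, y} \<in> insert {a, b} (E \<union> F)" for x y
      using edge[OF that] by argo
    ultimately show ?thesis
      using is_cut_join[OF is_cut_cut[OF B uv] _ b a] by (metis Un_commute)
  qed
  show c: "is_cut ?V (insert {a, b} (E \<union> F)) a b A"
    using edge dj a b unfolding is_cut_def by blast
  have c': "is_cut ?V (insert {a, b} (E \<union> F)) b a B"
    using edge dj a b unfolding is_cut_def by blast
  have conn: "\<exists>s\<in>S. \<exists>t\<in>?V - S. {s, t} \<in> insert {a, b} (E \<union> F)"
    if S: "S \<subseteq> ?V" "S \<noteq> {}" "S \<noteq> ?V" for S
  proof -
    have 1: ?thesis if h: "S \<inter> A \<noteq> {}" "S \<inter> A \<noteq> A"
    proof -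
      obtain s t where "s \<in> S \<inter> A" "t \<in> A - (S \<inter> A)" "{s, t} \<in> E"
        using tree_crossing[OF A _ h] by blast
      then show ?thesis by blast
    qed
    have 2: ?thesis if h: "S \<inter> B \<noteq> {}" "S \<inter> B \<noteq> B"
    proof -
      obtain s t where "s \<in> S \<inter> B" "t \<in> B - (S \<inter> B)" "{s, t} \<in> F"
        using tree_crossing[OF B _ h] by blast
      then show ?thesis by blast
    qed
    have 3: ?thesis if "S = A" using that a b dj by blast
    have 4: ?thesis if "S = B"
    proof -
      have "b \<in> S" "a \<in> ?V - S" "{b, a} \<in> insert {a, b} (E \<union> F)" using that a b dj by auto
      then show ?thesis by blast
    qed
    have "S \<inter> A \<noteq> {} \<and> S \<inter> A \<noteq> A \<or> S \<inter> B \<noteq> {} \<and> S \<inter> B \<noteq> B \<or> S = A \<or> S = B"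
      using S dj by blast
    then show ?thesis using 1 2 3 4 by blast
  qed
  show "tree ?V (insert {a, b} (E \<union> F))" unfolding tree_def
  proof (intro conjI allI impI)
    show "finite ?V" using A B by (simp add: tree_finite)
    show "?V \<noteq> {}" using a by blast
    have "a \<noteq> b" using a b dj by blast
    then show "insert {a, b} (E \<union> F) \<subseteq> {{u, v} |u v. u \<in> ?V \<and> v \<in> ?V \<and> u \<noteq> v}"
      using a b by (auto elim!: tree_edgeE[OF A] tree_edgeE[OF B])
  next
    fix u v assume "{u, v} \<in> insert {a, b} (E \<union> F)"
    then consider "u = a" "v = b" | "u = b" "v = a" | "{u, v} \<in> E" | "{u, v} \<in> F"
      by (auto simp: doubleton_eq_iff)
    then show "\<exists>S. is_cut ?V (insert {a, b} (E \<union> F)) u v S"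
      by cases (use c c' cE cF in blast)+
  qed (use conn in blast)
qed

lemma nbrs_join:
  assumes A: "tree A E" and B: "tree B F" and dj: "A \<inter> B = {}" and a: "a \<in> A" and b: "b \<in> B"
    and v: "v \<in> A"
  shows "card (nbrs (A \<union> B) (insert {a, b} (E \<union> F)) v) = card (nbrs A E v) + (if v = a then 1 else 0)"
proof -
  have "nbrs (A \<union> B) (insert {a, b} (E \<union> F)) v = nbrs A E v \<union> (if v = a then {b} else {})"
    unfolding nbrs_def using tree_edgeD[OF A] tree_edgeD[OF B] dj a b v
    by (auto simp: doubleton_eq_iff)
  moreover have "b \<notin> nbrs A E v" using b dj by (auto simp: nbrs_def)
  ultimately show ?thesis using nbrs_finite[OF A] by auto
qed

lemma image_edge_iff:
  assumes "inj_on f V" "\<And>d. d \<in> E \<Longrightarrow> d \<subseteq> V" "u \<in> V" "v \<in> V"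
  shows "{f u, f v} \<in> (`) f ` E \<longleftrightarrow> {u, v} \<in> E"
proof
  assume "{f u, f v} \<in> (`) f ` E"
  then obtain d where d: "d \<in> E" "f ` {u, v} = f ` d" by auto
  then have "{u, v} = d" using assms inj_on_image_eq_iff[of f V "{u, v}" d] by auto
  with d show "{u, v} \<in> E" by simp
next
  assume "{u, v} \<in> E"
  then have "f ` {u, v} \<in> (`) f ` E" by (rule imageI)
  then show "{f u, f v} \<in> (`) f ` E" by simp
qed

lemma tree_image:
  assumes t: "tree V E" and f: "inj_on f V"
  shows "tree (f ` V) ((`) f ` E)"
    and "{u, v} \<in> E \<Longrightarrow> cut (f ` V) ((`) f ` E) (f u) (f v) = f ` cut V E u v"
    and "v \<in> V \<Longrightarrow> nbrs (f ` V) ((`) f ` E) (f v) = f ` nbrs V E v"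
proof -
  have sub: "d \<subseteq> V" if "d \<in> E" for d using that by (auto elim!: tree_edgeE[OF t])
  note iff = image_edge_iff[OF f, of E, OF sub]
  show "v \<in> V \<Longrightarrow> nbrs (f ` V) ((`) f ` E) (f v) = f ` nbrs V E v" for v
    unfolding nbrs_def using iff by auto
  have cut: "is_cut (f ` V) ((`) f ` E) (f u) (f v) (f ` cut V E u v)" if "{u, v} \<in> E" for u v
  proof -
    have c: "is_cut V E u v (cut V E u v)" by (rule is_cut_cut[OF t that])
    have "f v \<notin> f ` cut V E u v"
      using c f tree_edgeD[OF t that] unfolding is_cut_def inj_on_def by blast
    moreover have "f a = f u \<and> f b = f v"
      if "a \<in> cut V E u v" "b \<in> V" "b \<notin> cut V E u v" "{f a, f b} \<in> (`) f ` E" for a b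
      using is_cut_crossing[OF c that(1-3)] that iff[of a b] is_cutD(1)[OF c] by blast
    ultimately show ?thesis using is_cutD[OF c] unfolding is_cut_def by blast
  qed
  have conn: "\<exists>a\<in>A. \<exists>b\<in>f ` V - A. {a, b} \<in> (`) f ` E"
    if A: "A \<subseteq> f ` V" "A \<noteq> {}" "A \<noteq> f ` V" for A
  proof -
    let ?A = "{v \<in> V. f v \<in> A}"
    have "?A \<subseteq> V" "?A \<noteq> {}" "?A \<noteq> V" using A by auto
    then obtain a b where ab: "a \<in> ?A" "b \<in> V - ?A" "{a, b} \<in> E" by (rule tree_crossing[OF t])
    then have "{f a, f b} \<in> (`) f ` E" using iff by auto
    with ab show ?thesis by blast
  qed
  show t': "tree (f ` V) ((`) f ` E)" unfolding tree_def
  proof (intro conjI allI impI)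
    show "finite (f ` V)" "f ` V \<noteq> {}" using tree_finite[OF t] tree_nonempty[OF t] by auto
    show "(`) f ` E \<subseteq> {{u, v} |u v. u \<in> f ` V \<and> v \<in> f ` V \<and> u \<noteq> v}"
    proof
      fix d assume "d \<in> (`) f ` E"
      then obtain d' where "d' \<in> E" "d = f ` d'" by blast
      then obtain u v where "u \<in> V" "v \<in> V" "u \<noteq> v" "d = {f u, f v}"
        using tree_edgeE[OF t] by (metis image_empty image_insert)
      moreover have "f u \<noteq> f v" using calculation f by (auto dest: inj_onD)
      ultimately show "d \<in> {{u, v} |u v. u \<in> f ` V \<and> v \<in> f ` V \<and> u \<noteq> v}" by blast
    qed
  next
    fix u v assume "{u, v} \<in> (`) f ` E"
    then obtain d where d: "d \<in> E" "{u, v} = f ` d" by blast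
    then obtain a b where ab: "d = {a, b}" using tree_edgeE[OF t] by metis
    then have "(u = f a \<and> v = f b) \<or> (u = f b \<and> v = f a)" using d by (auto simp: doubleton_eq_iff)
    moreover have "{b, a} \<in> E" using d ab by (simp add: insert_commute)
    ultimately show "\<exists>A. is_cut (f ` V) ((`) f ` E) u v A" using cut d ab by blast
  next
    fix A assume "A \<subseteq> f ` V \<and> A \<noteq> {} \<and> A \<noteq> f ` V"
    then show "\<exists>a\<in>A. \<exists>b\<in>f ` V - A. {a, b} \<in> (`) f ` E" using conn[of A] by simp
  qed
  show "cut (f ` V) ((`) f ` E) (f u) (f v) = f ` cut V E u v" if "{u, v} \<in> E"
    by (rule cut_eqI[OF t' cut[OF that]])
qed

section \<open>The leaky flow on a tree with labelled ends\<close>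

text \<open>
  The wall form of \<open>J\<close>, for labels of an arbitrary type. It is the expansion factor forced upon
  an edge that has the ends \<open>J\<close> on its left and the others on its right.
\<close>
definition leaky_flow :: "int \<Rightarrow> ('a \<Rightarrow> real) \<Rightarrow> 'a set \<Rightarrow> real" where
  "leaky_flow k x J = (\<Sum>i\<in>J. x i) - of_int k * (real (card J) - 1)"

definition legs_in :: "'a set \<Rightarrow> ('a \<Rightarrow> 'v) \<Rightarrow> 'v set \<Rightarrow> 'a set" where
  "legs_in L l A = {i \<in> L. l i \<in> A}"

definition legs_at :: "'a set \<Rightarrow> ('a \<Rightarrow> 'v) \<Rightarrow> 'v \<Rightarrow> 'a set" where
  "legs_at L l v = {i \<in> L. l i = v}"

text \<open>
  The combinatorial types of curves satisfying the Psi-conditions. Labellings are extensional, so that a type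
  is represented by exactly one element.
\<close>
definition labelled_trees ::
    "'v set \<Rightarrow> 'a set \<Rightarrow> ('a \<Rightarrow> nat) \<Rightarrow> ('v set set \<times> ('a \<Rightarrow> 'v)) set" where
  "labelled_trees V L e = {(E, l). tree V E \<and> l \<in> L \<rightarrow>\<^sub>E V \<and>
     (\<forall>v\<in>V. card (nbrs V E v) + card (legs_at L l v) = (\<Sum>i\<in>legs_at L l v. e i) + 3)}"

definition branch_flow ::
    "'v set \<Rightarrow> 'a set \<Rightarrow> int \<Rightarrow> ('a \<Rightarrow> real) \<Rightarrow> 'v set set \<Rightarrow> ('a \<Rightarrow> 'v) \<Rightarrow> 'v \<Rightarrow> 'v \<Rightarrow> real" where
  "branch_flow V L k x E l u v = leaky_flow k x (legs_in L l (cut V E u v))"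

text \<open>
  Exchanging the two sides of an edge changes the sign of the flow. This is where the total degree \<open>k *
  (n - 2)\<close> enters.
\<close>
lemma leaky_flow_complement:
  assumes L: "finite L" and J: "J \<subseteq> L" and s: "(\<Sum>i\<in>L. x i) = of_int k * (real (card L) - 2)"
  shows "leaky_flow k x (L - J) = - leaky_flow k x J"
proof -
  have "card J \<le> card L" using L J by (simp add: card_mono)
  then have "real (card (L - J)) = real (card L) - real (card J)"
    using L J by (simp add: card_Diff_subset finite_subset of_nat_diff)
  moreover have "sum x (L - J) = sum x L - sum x J" using L J by (simp add: sum_diff)
  ultimately have "leaky_flow k x (L - J) = sum x L - sum x J - of_int k * (real (card L) - real (card J) - 1)"
    by (simp only: leaky_flow_def)
  then show ?thesis by (simp add: s leaky_flow_def algebra_simps)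
qed

lemma legs_in_diff:
  assumes "l \<in> L \<rightarrow> V" shows "legs_in L l (V - A) = L - legs_in L l A"
  using assms by (auto simp: legs_in_def)

lemma branch_flow_swap:
  assumes t: "tree V E" and e: "{u, v} \<in> E" and l: "l \<in> L \<rightarrow> V" and L: "finite L"
    and s: "(\<Sum>i\<in>L. x i) = of_int k * (real (card L) - 2)"
  shows "branch_flow V L k x E l v u = - branch_flow V L k x E l u v"
  unfolding branch_flow_def cut_swap[OF t e] legs_in_diff[OF l]
  by (rule leaky_flow_complement[OF L _ s]) (auto simp: legs_in_def)

lemma sum_legs:
  assumes L: "finite L" and A: "finite A"
  shows "(\<Sum>a\<in>A. \<Sum>i\<in>legs_at L l a. g i) = (\<Sum>i\<in>legs_in L l A. g i)"
proof -
  have "(\<Sum>a\<in>A. \<Sum>i | i \<in> legs_in L l A \<and> l i = a. g i) = (\<Sum>i\<in>legs_in L l A. g i)"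
    by (rule sum.group) (use L A in \<open>auto simp: legs_in_def\<close>)
  moreover have "{i \<in> legs_in L l A. l i = a} = legs_at L l a" if "a \<in> A" for a
    using that by (auto simp: legs_in_def legs_at_def)
  ultimately show ?thesis by simp
qed

lemma card_legs:
  assumes L: "finite L" and A: "finite A"
  shows "(\<Sum>a\<in>A. card (legs_at L l a)) = card (legs_in L l A)"
  using sum_legs[OF assms, where g = "\<lambda>_. 1::nat"] by simp

lemma legs_in_all: "l \<in> L \<rightarrow> V \<Longrightarrow> legs_in L l V = L"
  by (auto simp: legs_in_def)

lemma sum_branches:
  fixes g :: "'a \<Rightarrow> real"
  assumes t: "tree V E" and l: "l \<in> L \<rightarrow> V" and L: "finite L" and v: "v \<in> V"
  shows "(\<Sum>w\<in>nbrs V E v. \<Sum>i\<in>legs_in L l (cut V E w v). g i) + (\<Sum>i\<in>legs_at L l v. g i) = (\<Sum>i\<in>L. g i)"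
proof -
  let ?J = "\<lambda>w. legs_in L l (cut V E w v)"
  note p = branches_partition[OF t v]
  have "(\<Sum>w\<in>nbrs V E v. \<Sum>i\<in>?J w. g i) = (\<Sum>i\<in>(\<Union>w\<in>nbrs V E v. ?J w). g i)"
  proof (rule sum.UNION_disjoint[symmetric])
    show "\<forall>i\<in>nbrs V E v. \<forall>j\<in>nbrs V E v. i \<noteq> j \<longrightarrow> ?J i \<inter> ?J j = {}"
      using p(2) by (fastforce simp: legs_in_def)
  qed (use L nbrs_finite[OF t] in \<open>auto simp: legs_in_def\<close>)
  also have "(\<Union>w\<in>nbrs V E v. ?J w) = legs_in L l (\<Union>w\<in>nbrs V E v. cut V E w v)"
    by (auto simp: legs_in_def)
  also have "\<dots> = L - legs_at L l v"
    unfolding p(1)[symmetric] using l by (auto simp: legs_in_def legs_at_def)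
  also have "(\<Sum>i\<in>L - legs_at L l v. g i) + (\<Sum>i\<in>legs_at L l v. g i) = (\<Sum>i\<in>L. g i)"
    by (rule sum.subset_diff[symmetric]) (use L in \<open>auto simp: legs_at_def\<close>)
  finally show ?thesis .
qed

text \<open>
  The ends of the branches at \<open>v\<close>, together with the ends at \<open>v\<close> itself, are all the
  ends; so the leaky condition at \<open>v\<close> reduces to the total degree condition.
\<close>
lemma branch_flow_balanced:
  assumes t: "tree V E" and l: "l \<in> L \<rightarrow> V" and L: "finite L" and v: "v \<in> V"
    and s: "(\<Sum>i\<in>L. x i) = of_int k * (real (card L) - 2)"
  shows "(\<Sum>w\<in>nbrs V E v. branch_flow V L k x E l w v) + (\<Sum>i\<in>legs_at L l v. x i) =
    of_int k * (real (card (nbrs V E v)) + real (card (legs_at L l v)) - 2)"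
proof -
  let ?J = "\<lambda>w. legs_in L l (cut V E w v)" and ?N = "nbrs V E v"
  have flow: "(\<Sum>w\<in>?N. branch_flow V L k x E l w v) =
      (\<Sum>w\<in>?N. \<Sum>i\<in>?J w. x i) - of_int k * ((\<Sum>w\<in>?N. \<Sum>i\<in>?J w. 1) - real (card ?N))"
    by (simp add: branch_flow_def leaky_flow_def sum_subtractf flip: sum_distrib_left)
  have xs: "(\<Sum>w\<in>?N. \<Sum>i\<in>?J w. x i) = (\<Sum>i\<in>L. x i) - (\<Sum>i\<in>legs_at L l v. x i)"
    using sum_branches[OF t l L v, of x] by simp
  have ones: "(\<Sum>w\<in>?N. \<Sum>i\<in>?J w. 1) = real (card L) - real (card (legs_at L l v))"
    using sum_branches[OF t l L v, of "\<lambda>_. 1"] by simp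
  show ?thesis unfolding flow xs ones s by (simp add: algebra_simps)
qed

text \<open>
  Adding up the leaky conditions over the vertices on the side of \<open>u\<close>, all inner edges cancel and
  only the flow through \<open>{u, v}\<close> and the ends on this side remain. The sum of the valences is
  known by \<open>cut_degree_sum\<close>.
\<close>
lemma balanced_unique:
  assumes t: "tree V E" and l: "l \<in> L \<rightarrow> V" and L: "finite L"
    and anti: "\<And>u v. {u, v} \<in> E \<Longrightarrow> \<phi> v u = - \<phi> u v"
    and bal: "\<And>v. v \<in> V \<Longrightarrow> (\<Sum>w\<in>nbrs V E v. \<phi> w v) + (\<Sum>i\<in>legs_at L l v. x i) =
       of_int k * (real (card (nbrs V E v)) + real (card (legs_at L l v)) - 2)"
    and e: "{u, v} \<in> E"
  shows "\<phi> u v = branch_flow V L k x E l u v"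
proof -
  let ?A = "cut V E u v" let ?F = "E \<inter> Pow ?A" let ?J = "legs_in L l ?A"
  have tA: "tree ?A ?F" by (rule tree_cut[OF t e])
  have fA: "finite ?A" by (rule tree_finite[OF tA])
  have c: "is_cut V E u v ?A" by (rule is_cut_cut[OF t e])
  note cD = is_cutD[OF c]
  \<comment> \<open>The flow along the inner edges, extended by zero to all pairs, so that its antisymmetry cancels the sum.\<close>
  define g where "g a w = (if {a, w} \<in> E then \<phi> w a else 0)" for a w
  have g: "g w a = - g a w" for a w
    using anti[of a w] by (simp add: g_def insert_commute)
  have "(\<Sum>a\<in>?A. \<Sum>w\<in>nbrs ?A ?F a. \<phi> w a) = (\<Sum>a\<in>?A. \<Sum>w\<in>?A. g a w)" (is "?S = _")
  proof (rule sum.cong[OF refl])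
    fix a assume a: "a \<in> ?A"
    have "nbrs ?A ?F a = {w \<in> ?A. {a, w} \<in> E}" using a by (auto simp: nbrs_def)
    then show "(\<Sum>w\<in>nbrs ?A ?F a. \<phi> w a) = (\<Sum>w\<in>?A. g a w)"
      by (simp only: g_def sum.inter_filter[OF fA])
  qed
  moreover have "(\<Sum>a\<in>?A. \<Sum>w\<in>?A. g a w) = - (\<Sum>a\<in>?A. \<Sum>w\<in>?A. g a w)"
  proof -
    have "(\<Sum>a\<in>?A. \<Sum>w\<in>?A. g a w) = (\<Sum>w\<in>?A. \<Sum>a\<in>?A. g a w)" by (rule sum.swap)
    also have "\<dots> = (\<Sum>w\<in>?A. \<Sum>a\<in>?A. - g w a)"
      by (rule sum.cong[OF refl], rule sum.cong[OF refl], rule g)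
    also have "\<dots> = - (\<Sum>a\<in>?A. \<Sum>w\<in>?A. g a w)" by (simp only: sum_negf)
    finally show ?thesis .
  qed
  ultimately have S0: "?S = 0" by simp
  have "(\<Sum>a\<in>?A. \<Sum>w\<in>nbrs V E a. \<phi> w a) =
      (\<Sum>a\<in>?A. (\<Sum>w\<in>nbrs ?A ?F a. \<phi> w a) + (if a = u then \<phi> v a else 0))"
  proof (rule sum.cong[OF refl])
    fix a assume a: "a \<in> ?A"
    have "v \<notin> nbrs ?A ?F a" using cD by (simp add: nbrs_def)
    then show "(\<Sum>w\<in>nbrs V E a. \<phi> w a) = (\<Sum>w\<in>nbrs ?A ?F a. \<phi> w a) + (if a = u then \<phi> v a else 0)"
      using nbrs_cut[OF t e a] nbrs_finite[OF tA] by auto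
  qed
  also have "\<dots> = ?S + \<phi> v u" using cD fA by (simp add: sum.distrib)
  finally have 1: "(\<Sum>a\<in>?A. \<Sum>w\<in>nbrs V E a. \<phi> w a) = - \<phi> u v" using S0 anti[OF e] by simp
  have "(\<Sum>a\<in>?A. (\<Sum>w\<in>nbrs V E a. \<phi> w a) + (\<Sum>i\<in>legs_at L l a. x i)) =
      (\<Sum>a\<in>?A. of_int k * (real (card (nbrs V E a)) + real (card (legs_at L l a)) - 2))"
    using bal cD(1) by (intro sum.cong) auto
  then have eq: "- \<phi> u v + (\<Sum>i\<in>?J. x i) =
      of_int k * (real (\<Sum>a\<in>?A. card (nbrs V E a)) + real (\<Sum>a\<in>?A. card (legs_at L l a)) - 2 * real (card ?A))"
    using 1 by (simp add: sum.distrib sum_legs[OF L fA] sum_subtractf flip: sum_distrib_left)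
  have "real (\<Sum>a\<in>?A. card (nbrs V E a)) = 2 * real (card ?A) - 1"
    using cut_degree_sum[OF t e] by linarith
  from eq[unfolded this card_legs[OF L fA]] show ?thesis
    by (simp add: branch_flow_def leaky_flow_def algebra_simps)
qed

lemma labelled_treesD:
  assumes "(E, l) \<in> labelled_trees V L e"
  shows "tree V E" "l \<in> L \<rightarrow>\<^sub>E V" "l \<in> L \<rightarrow> V"
    "v \<in> V \<Longrightarrow> card (nbrs V E v) + card (legs_at L l v) = (\<Sum>i\<in>legs_at L l v. e i) + 3"
  using assms by (auto simp: labelled_trees_def)

lemma finite_labelled_trees: "finite L \<Longrightarrow> finite V \<Longrightarrow> finite (labelled_trees V L e)"
proof (rule finite_subset)
  show "labelled_trees V L e \<subseteq> Pow (Pow V) \<times> (L \<rightarrow>\<^sub>E V)"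
  proof (rule subsetI)
    fix t assume "t \<in> labelled_trees V L e"
    then obtain E l where t: "t = (E, l)" "tree V E" "l \<in> L \<rightarrow>\<^sub>E V"
      unfolding labelled_trees_def by blast
    moreover have "E \<subseteq> Pow V" by (auto elim!: tree_edgeE[OF t(2)])
    ultimately show "t \<in> Pow (Pow V) \<times> (L \<rightarrow>\<^sub>E V)" by simp
  qed
qed (simp add: finite_PiE)

text \<open>
  Comparison of the sum of the valences prescribed by the Psi-conditions with the sum computed by
  \<open>tree_handshake\<close>.
\<close>
lemma labelled_trees_card:
  assumes t: "(E, l) \<in> labelled_trees V L e" and L: "finite L"
  shows "int (card V) = int (card L) - 2 - int (\<Sum>i\<in>L. e i)"
proof -
  note D = labelled_treesD[OF t]
  have fV: "finite V" by (rule tree_finite[OF D(1)])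
  have "(\<Sum>v\<in>V. card (nbrs V E v) + card (legs_at L l v)) = (\<Sum>v\<in>V. (\<Sum>i\<in>legs_at L l v. e i) + 3)"
    using D(4) by (rule sum.cong[OF refl])
  then have "(\<Sum>v\<in>V. card (nbrs V E v)) + card L = (\<Sum>i\<in>L. e i) + 3 * card V"
    by (simp only: sum.distrib card_legs[OF L fV] sum_legs[OF L fV] legs_in_all[OF D(3)]) simp
  then show ?thesis using tree_handshake[OF D(1)] by linarith
qed

lemma labelled_trees_nonempty: "(E, l) \<in> labelled_trees V L e \<Longrightarrow> V \<noteq> {}"
  using labelled_treesD(1) tree_nonempty by blast

definition half_labels :: "'a set \<Rightarrow> 'a option set" where
  "half_labels I = insert None (Some ` I)"

text \<open>
  The part \<open>A\<close> of a tree that is cut at an edge with vertex \<open>a\<close> in \<open>A\<close>;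
  the cut edge is replaced by an end with the new label \<open>None\<close> at \<open>a\<close>.
\<close>
definition half :: "'v set \<Rightarrow> 'v \<Rightarrow> 'a set \<Rightarrow> 'v set set \<times> ('a \<Rightarrow> 'v) \<Rightarrow> 'v set set \<times> ('a option \<Rightarrow> 'v)"
  where "half A a I t = (fst t \<inter> Pow A, restrict (case_option a (snd t)) (half_labels I))"

text \<open>
  The inverse of cutting: the two ends \<open>None\<close> are joined to form an edge.
\<close>
definition glue :: "'a set \<Rightarrow> 'a set \<Rightarrow> 'v set set \<times> ('a option \<Rightarrow> 'v) \<Rightarrow>
    'v set set \<times> ('a option \<Rightarrow> 'v) \<Rightarrow> 'v set set \<times> ('a \<Rightarrow> 'v)" where
  "glue I J t1 t2 =
     (insert {snd t1 None, snd t2 None} (fst t1 \<union> fst t2),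
      \<lambda>i\<in>I \<union> J. if i \<in> I then snd t1 (Some i) else snd t2 (Some i))"

lemma finite_half_labels: "finite I \<Longrightarrow> finite (half_labels I)"
  by (simp add: half_labels_def)

lemma card_half_labels: "finite I \<Longrightarrow> card (half_labels I) = card I + 1"
  by (simp add: half_labels_def card_image card_insert_if image_iff)

lemma sum_half_labels: "finite I \<Longrightarrow> (\<Sum>j\<in>half_labels I. f j) = f None + (\<Sum>i\<in>I. f (Some i))"
  by (simp add: half_labels_def sum.reindex image_iff)

lemma half_labelled_tree:
  assumes t: "(E, l) \<in> labelled_trees V L e" and e: "{u, v} \<in> E"
    and L: "finite L"
  shows "half (cut V E u v) u (legs_in L l (cut V E u v)) (E, l)
    \<in> labelled_trees (cut V E u v) (half_labels (legs_in L l (cut V E u v))) (case_option 0 e)"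
proof -
  let ?A = "cut V E u v" let ?F = "E \<inter> Pow ?A" let ?I = "legs_in L l ?A"
  let ?l = "restrict (case_option u l) (half_labels ?I)"
  note D = labelled_treesD[OF t]
  note cD = is_cutD[OF is_cut_cut[OF D(1) e]]
  have at: "legs_at (half_labels ?I) ?l a = (if a = u then {None} else {}) \<union> Some ` legs_at L l a"
    if "a \<in> ?A" for a
    using that by (auto simp: legs_at_def half_labels_def legs_in_def)
  have fin: "finite (legs_at L l a)" for a using L by (simp add: legs_at_def)
  have "card (nbrs ?A ?F a) + card (legs_at (half_labels ?I) ?l a) =
      (\<Sum>i\<in>legs_at (half_labels ?I) ?l a. case_option 0 e i) + 3" if a: "a \<in> ?A" for a
  proof -
    have "a \<in> V" using a cD by blast
    note D(4)[OF this]
    moreover have "card (legs_at (half_labels ?I) ?l a) = (if a = u then 1 else 0) + card (legs_at L l a)"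
      unfolding at[OF a] using fin[of a] by (auto simp: card_insert_if card_image image_iff)
    moreover have "(\<Sum>i\<in>legs_at (half_labels ?I) ?l a. case_option 0 e i) = (\<Sum>i\<in>legs_at L l a. e i)"
      unfolding at[OF a] using fin[of a] by (auto simp: sum.reindex image_iff)
    ultimately show ?thesis using card_nbrs_cut[OF D(1) e a] by auto
  qed
  moreover have "?l \<in> half_labels ?I \<rightarrow>\<^sub>E ?A"
    using cD by (auto simp: half_labels_def legs_in_def)
  ultimately show ?thesis
    using tree_cut[OF D(1) e] by (simp add: labelled_trees_def half_def)
qed

text \<open>
  The half tree is itself a labelled tree, whose additional end carries no Psi-class, so
  \<open>labelled_trees_card\<close> applies to it.
\<close>
lemma card_cut:
  assumes t: "(E, l) \<in> labelled_trees V L e" and e: "{u, v} \<in> E" and L: "finite L"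
  shows "int (card (cut V E u v)) =
    int (card (legs_in L l (cut V E u v))) - 1 - int (\<Sum>i\<in>legs_in L l (cut V E u v). e i)"
proof -
  have fin: "finite (legs_in L l (cut V E u v))" using L by (simp add: legs_in_def)
  show ?thesis
    using labelled_trees_card[OF half_labelled_tree[OF t e L, unfolded half_def]] fin
    by (simp add: card_half_labels finite_half_labels sum_half_labels)
qed

lemma card_legs_in_cut:
  assumes t: "(E, l) \<in> labelled_trees V L e" and e: "{u, v} \<in> E" and L: "finite L"
  shows "2 \<le> card (legs_in L l (cut V E u v))" "2 \<le> card (L - legs_in L l (cut V E u v))"
proof -
  have 2: "2 \<le> card (legs_in L l (cut V E u v))" if e: "{u, v} \<in> E" for u v
  proof -
    note tD = labelled_treesD(1)[OF t]
    have "u \<in> cut V E u v" "finite (cut V E u v)"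
      using is_cutD[OF is_cut_cut[OF tD e]] tree_finite[OF tree_cut[OF tD e]] by auto
    then have "card (cut V E u v) \<ge> 1" by (metis One_nat_def Suc_leI card_gt_0_iff empty_iff)
    then show ?thesis using card_cut[OF t e L] by linarith
  qed
  show "2 \<le> card (legs_in L l (cut V E u v))" by (rule 2[OF e])
  have "{v, u} \<in> E" using e by (simp add: insert_commute)
  from 2[OF this] show "2 \<le> card (L - legs_in L l (cut V E u v))"
    using labelled_treesD[OF t] e by (simp add: cut_swap legs_in_diff)
qed

text \<open>
  Every side of an edge carries ends. So if two different edges had the same ends on one side, one of these
  two sides would contain the other. They have equally many vertices by \<open>card_cut\<close>, so they would
  coincide, but the side determines the edge.
\<close>
lemma edge_unique:
  assumes t: "(E, l) \<in> labelled_trees V L e" and L: "finite L"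
    and e: "{u, v} \<in> E" and e': "{u', v'} \<in> E"
    and eq: "legs_in L l (cut V E u v) = legs_in L l (cut V E u' v')"
  shows "u = u' \<and> v = v'"
proof -
  let ?A = "cut V E u v" and ?A' = "cut V E u' v'" and ?B = "cut V E v u"
  note D = labelled_treesD[OF t]
  have ev: "{v, u} \<in> E" using e by (simp add: insert_commute)
  have c: "is_cut V E u v ?A" and c': "is_cut V E u' v' ?A'" using is_cut_cut[OF D(1)] e e' by auto
  have B: "?B = V - ?A" by (rule cut_swap[OF D(1) e])
  have card: "card ?A = card ?A'" using card_cut[OF t e L] card_cut[OF t e' L] eq by simp
  have fV: "finite V" by (rule tree_finite[OF D(1)])
  have fin: "finite ?A" "finite ?A'" using is_cutD(1)[OF c] is_cutD(1)[OF c'] fV finite_subset by auto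
  note two = card_legs_in_cut[OF t e L]
  obtain i where i: "i \<in> L" "l i \<in> ?A" "l i \<in> ?A'"
    using two(1) eq by (auto simp: legs_in_def set_eq_iff) (metis (no_types, lifting) card.empty empty_Collect_eq not_numeral_le_zero)
  obtain j where j: "j \<in> L" "l j \<in> ?B" "l j \<notin> ?A'"
  proof -
    have "L - legs_in L l ?A \<noteq> {}" using two(2) by (metis card.empty not_numeral_le_zero)
    then obtain j where "j \<in> L" "l j \<notin> ?A" "l j \<notin> ?A'" using eq by (auto simp: legs_in_def)
    then show ?thesis using that B D(3) by (auto simp: Pi_iff)
  qed
  have sub: "?A = ?A'"
  proof (rule ccontr)
    assume ne: "?A \<noteq> ?A'"
    have u': "u' \<in> V" "v' \<in> V" "u' \<in> ?A'" "v' \<notin> ?A'"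
      using tree_edgeD[OF D(1) e'] is_cutD[OF c'] by auto
    \<comment> \<open>A part of the tree whose own edges do not include \<open>{u', v'}\<close> lies on one side of that edge.\<close>
    have connected: "S \<subseteq> ?A' \<or> S \<inter> ?A' = {}"
      if S: "tree S F" "F \<subseteq> E" "S \<subseteq> V" "\<not> (u' \<in> S \<and> v' \<in> S)" for S F
    proof (rule ccontr)
      assume "\<not> ?thesis"
      then obtain a b where ab: "a \<in> S \<inter> ?A'" "b \<in> S - (S \<inter> ?A')" "{a, b} \<in> F"
        using tree_crossing[OF S(1), of "S \<inter> ?A'"] by blast
      then have "a = u' \<and> b = v'" using is_cut_crossing[OF c', of a b] S by blast
      with ab S show False by blast
    qed
    have "?A \<inter> ?A' \<noteq> {}" using i by blast
    moreover have "\<not> ?A \<subseteq> ?A'" using ne card fin by (metis card_subset_eq)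
    ultimately have uA: "u' \<in> ?A" "v' \<in> ?A"
      using connected[OF tree_cut[OF D(1) e] _ is_cutD(1)[OF c]] by blast+
    have "?B \<subseteq> V" "\<not> (u' \<in> ?B \<and> v' \<in> ?B)" using B uA by auto
    then have "?B \<inter> ?A' = {}" using connected[OF tree_cut[OF D(1) ev]] j by blast
    then have "?A' \<subseteq> ?A" using B is_cutD(1)[OF c'] by blast
    then show False using ne card fin by (metis card_subset_eq)
  qed
  have "u' \<in> ?A" "v' \<in> V" "v' \<notin> ?A"
    using is_cutD[OF c'] tree_edgeD[OF D(1) e'] sub by auto
  then show ?thesis using is_cut_crossing[OF c _ _ _ e'] by blast
qed

section \<open>Weights and gluing\<close>

definition edge_flow :: "'v::linorder set \<Rightarrow> 'a set \<Rightarrow> int \<Rightarrow> ('a \<Rightarrow> real) \<Rightarrow>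
    'v set set \<times> ('a \<Rightarrow> 'v) \<Rightarrow> 'v set \<Rightarrow> real" where
  "edge_flow V L k x t d = branch_flow V L k x (fst t) (snd t) (Min d) (Max d)"

definition vertex_weight :: "'a set \<Rightarrow> ('a \<Rightarrow> nat) \<Rightarrow> ('a \<Rightarrow> 'v) \<Rightarrow> 'v \<Rightarrow> real" where
  "vertex_weight L e l v = fact (\<Sum>i\<in>legs_at L l v. e i) / (\<Prod>i\<in>legs_at L l v. fact (e i))"

definition tree_weight :: "'v::linorder set \<Rightarrow> 'a set \<Rightarrow> int \<Rightarrow> ('a \<Rightarrow> real) \<Rightarrow> ('a \<Rightarrow> nat) \<Rightarrow>
    'v set set \<times> ('a \<Rightarrow> 'v) \<Rightarrow> real" where
  "tree_weight V L k x e t =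
     (\<Prod>d\<in>fst t. edge_flow V L k x t d) * (\<Prod>v\<in>V. vertex_weight L e (snd t) v)"

text \<open>
  The sign condition on the degree \<open>x\<close> under which the tree is the combinatorial type of a cover.
\<close>
definition rightward :: "'v::linorder set \<Rightarrow> 'a set \<Rightarrow> int \<Rightarrow> ('a \<Rightarrow> real) \<Rightarrow>
    'v set set \<times> ('a \<Rightarrow> 'v) \<Rightarrow> bool" where
  "rightward V L k x t \<longleftrightarrow> (\<forall>d\<in>fst t. edge_flow V L k x t d > 0)"

text \<open>
  The signs are tested at \<open>x0\<close> while the weights are taken at \<open>x\<close>: for
  \<open>x0\<close> in a chamber, this is the polynomial in \<open>x\<close> that gives the count on that
  chamber.
\<close>
definition tree_sum :: "'v::linorder set \<Rightarrow> 'a set \<Rightarrow> int \<Rightarrow> ('a \<Rightarrow> real) \<Rightarrow> ('a \<Rightarrow> real) \<Rightarrow>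
    ('a \<Rightarrow> nat) \<Rightarrow> real" where
  "tree_sum V L k x0 x e =
     (\<Sum>t\<in>labelled_trees V L e. of_bool (rightward V L k x0 t) * tree_weight V L k x e t)"

lemma edge_MinMax:
  fixes V :: "'v::linorder set"
  assumes t: "tree V E" and d: "d \<in> E"
  shows "{Min d, Max d} = d" "Min d < Max d" "{Min d, Max d} \<in> E"
proof -
  obtain u v where uv: "u \<in> V" "v \<in> V" "u \<noteq> v" "d = {u, v}" by (rule tree_edgeE[OF t d])
  then show 1: "{Min d, Max d} = d" "Min d < Max d" by (auto simp: min_def max_def)
  show "{Min d, Max d} \<in> E" using 1 d by simp
qed

locale gluing =
  fixes A B :: "'v set" and I J :: "'a set" and e :: "'a \<Rightarrow> nat"
    and E1 E2 :: "'v set set" and l1 l2 :: "'a option \<Rightarrow> 'v"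
  assumes fin: "finite I" "finite J" and disj: "I \<inter> J = {}" "A \<inter> B = {}"
    and t1: "(E1, l1) \<in> labelled_trees A (half_labels I) (case_option 0 e)"
    and t2: "(E2, l2) \<in> labelled_trees B (half_labels J) (case_option 0 e)"
begin

definition "a = l1 None"
definition "b = l2 None"
definition "E = insert {a, b} (E1 \<union> E2)"
definition "l = (\<lambda>i\<in>I \<union> J. if i \<in> I then l1 (Some i) else l2 (Some i))"

lemma glue_eq: "glue I J (E1, l1) (E2, l2) = (E, l)"
  unfolding glue_def E_def l_def a_def b_def fst_conv snd_conv by (rule refl)

lemma swap: "gluing B A J I e E2 E1 l2 l1"
  using fin disj t1 t2 unfolding gluing_def by (simp add: Int_commute)

lemma E_swap: "gluing.E E2 E1 l2 l1 = E" and l_swap: "gluing.l J I l2 l1 = l"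
  unfolding gluing.E_def[OF swap] E_def gluing.a_def[OF swap] gluing.b_def[OF swap] a_def b_def
    gluing.l_def[OF swap] l_def using disj by (auto intro!: restrict_ext simp: insert_commute Un_commute)

lemma tree1: "tree A E1" and tree2: "tree B E2"
  using labelled_treesD(1)[OF t1] labelled_treesD(1)[OF t2] by simp_all

lemma a_in_A: "a \<in> A" and b_in_B: "b \<in> B"
  using labelled_treesD(3)[OF t1] labelled_treesD(3)[OF t2]
  by (auto simp: a_def b_def half_labels_def)

lemma l_I: "i \<in> I \<Longrightarrow> l i = l1 (Some i)" "i \<in> I \<Longrightarrow> l i \<in> A"
  using labelled_treesD(3)[OF t1] by (auto simp: l_def half_labels_def)

lemma l_J: "i \<in> J \<Longrightarrow> l i = l2 (Some i)" "i \<in> J \<Longrightarrow> l i \<in> B"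
  using labelled_treesD(3)[OF t2] disj by (auto simp: l_def half_labels_def)

lemma glued_tree: "tree (A \<union> B) E"
  unfolding E_def by (rule tree_join[OF tree1 tree2 disj(2) a_in_A b_in_B])

lemma legs_at_A: "v \<in> A \<Longrightarrow> legs_at (I \<union> J) l v = {i \<in> I. l1 (Some i) = v}"
  using l_I l_J disj by (auto simp: legs_at_def)

lemma legs_at_half: "legs_at (half_labels I) l1 v =
    (if v = a then {None} else {}) \<union> Some ` {i \<in> I. l1 (Some i) = v}"
  by (auto simp: legs_at_def half_labels_def a_def)

lemma sum_legs_at_A:
  assumes "v \<in> A"
  shows "(\<Sum>j\<in>legs_at (half_labels I) l1 v. case_option 0 e j) = (\<Sum>i\<in>legs_at (I \<union> J) l v. e i)"
    and "card (legs_at (half_labels I) l1 v) = card (legs_at (I \<union> J) l v) + (if v = a then 1 else 0)"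
    and "(\<Prod>j\<in>legs_at (half_labels I) l1 v. fact (case_option 0 e j)) =
         (\<Prod>i\<in>legs_at (I \<union> J) l v. fact (e i) :: real)"
  using fin by (auto simp: legs_at_A[OF assms] legs_at_half sum.reindex prod.reindex
      card_insert_if card_image image_iff)

lemma valence_A:
  assumes v: "v \<in> A"
  shows "card (nbrs (A \<union> B) E v) + card (legs_at (I \<union> J) l v) =
    (\<Sum>i\<in>legs_at (I \<union> J) l v. e i) + 3"
  using labelled_treesD(4)[OF t1 v] sum_legs_at_A[OF v]
    nbrs_join[OF tree1 tree2 disj(2) a_in_A b_in_B v, folded E_def] by auto

lemma vertex_weight_A:
  assumes v: "v \<in> A"
  shows "vertex_weight (I \<union> J) e l v = vertex_weight (half_labels I) (case_option 0 e) l1 v"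
  by (simp only: vertex_weight_def sum_legs_at_A[OF v])

lemma cut_ab: "cut (A \<union> B) E a b = A"
  by (rule cut_eqI[OF glued_tree tree_join(2)[OF tree1 tree2 disj(2) a_in_A b_in_B, folded E_def]])

lemma legs_in_A: "legs_in (I \<union> J) l A = I"
  using l_I l_J disj by (auto simp: legs_in_def)

text \<open>
  The degree \<open>leaky_flow k x J\<close> of the new end accounts for all the ends \<open>J\<close> that
  the side of an edge acquires together with the tree \<open>B\<close>.
\<close>
lemma branch_flow_A:
  assumes uv: "{u, v} \<in> E1"
  shows "branch_flow (A \<union> B) (I \<union> J) k x E l u v =
    branch_flow A (half_labels I) k (case_option (leaky_flow k x J) x) E1 l1 u v"
proof -
  let ?C = "cut A E1 u v" let ?K = "{i \<in> I. l1 (Some i) \<in> ?C}"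
  have cut: "cut (A \<union> B) E u v = ?C \<union> (if a \<in> ?C then B else {})"
    by (rule cut_eqI[OF glued_tree tree_join(3)[OF tree1 tree2 disj(2) a_in_A b_in_B uv, folded E_def]])
  have CA: "?C \<subseteq> A" by (rule cut_subset[OF tree1 uv])
  have 1: "legs_in (I \<union> J) l (cut (A \<union> B) E u v) = ?K \<union> (if a \<in> ?C then J else {})"
  proof -
    have "l i = l1 (Some i) \<and> l1 (Some i) \<notin> B" if "i \<in> I" for i
      using l_I[OF that] disj(2) by auto
    moreover have "l i \<in> B \<and> l i \<notin> ?C \<and> i \<notin> I" if "i \<in> J" for i
      using l_J(2)[OF that] that disj CA by blast
    ultimately show ?thesis unfolding cut legs_in_def by auto
  qed
  have 2: "legs_in (half_labels I) l1 ?C = (if a \<in> ?C then {None} else {}) \<union> Some ` ?K"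
    by (auto simp: legs_in_def half_labels_def a_def)
  have fK: "finite ?K" and KJ: "?K \<inter> J = {}" using fin disj by auto
  have K: "card (Some ` ?K) = card ?K" "sum f (Some ` ?K) = sum (f \<circ> Some) ?K"
    "None \<notin> Some ` ?K" for f :: "'a option \<Rightarrow> real"
    by (auto simp: card_image sum.reindex)
  show ?thesis
  proof (cases "a \<in> ?C")
    case True
    then show ?thesis unfolding branch_flow_def 1 2 leaky_flow_def
      using fK fin KJ K by (simp add: card_Un_disjoint sum.union_disjoint o_def algebra_simps)
  next
    case False
    then show ?thesis unfolding branch_flow_def 1 2 leaky_flow_def using K by (simp add: o_def)
  qed
qed

lemma half_A: "half A a I (E, l) = (E1, l1)"
proof -
  have "\<not> {a, b} \<subseteq> A" using b_in_B disj(2) by blast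
  moreover have "d \<subseteq> A" if "d \<in> E1" for d by (rule tree_edgeE[OF tree1 that]) blast
  moreover have "\<not> d \<subseteq> A" if "d \<in> E2" for d
    by (rule tree_edgeE[OF tree2 that]) (use disj(2) in blast)
  ultimately have "E \<inter> Pow A = E1" unfolding E_def Pow_def by auto
  moreover have "restrict (case_option a l) (half_labels I) = l1"
  proof
    fix j show "restrict (case_option a l) (half_labels I) j = l1 j"
      using labelled_treesD(2)[OF t1]
      by (cases j) (auto simp: half_labels_def a_def l_I PiE_def extensional_def)
  qed
  ultimately show ?thesis by (simp add: half_def)
qed

interpretation sw: gluing B A J I e E2 E1 l2 l1 by (rule swap)

lemma sw_eqs: "sw.E = E" "sw.l = l" "sw.a = b" "sw.b = a" "B \<union> A = A \<union> B" "J \<union> I = I \<union> J"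
  by (auto simp: E_swap l_swap sw.a_def sw.b_def a_def b_def)

lemmas valence_B = sw.valence_A[unfolded sw_eqs]
  and vertex_weight_B = sw.vertex_weight_A[unfolded sw_eqs]
  and branch_flow_B = sw.branch_flow_A[unfolded sw_eqs]
  and half_B = sw.half_A[unfolded sw_eqs]
  and cut_ba = sw.cut_ab[unfolded sw_eqs]
  and legs_in_B = sw.legs_in_A[unfolded sw_eqs]

lemma labelled_tree: "(E, l) \<in> labelled_trees (A \<union> B) (I \<union> J) e"
proof -
  have ext: "l \<in> I \<union> J \<rightarrow>\<^sub>E A \<union> B"
  proof (rule PiE_I)
    show "l i \<in> A \<union> B" if "i \<in> I \<union> J" for i using that l_I(2)[of i] l_J(2)[of i] by blast
    show "l i = undefined" if "i \<notin> I \<union> J" for i using that by (simp add: l_def)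
  qed
  have val: "\<forall>v\<in>A \<union> B. card (nbrs (A \<union> B) E v) + card (legs_at (I \<union> J) l v) =
      (\<Sum>i\<in>legs_at (I \<union> J) l v. e i) + 3"
    by (rule ballI, erule UnE, erule valence_A, erule valence_B)
  show ?thesis
    unfolding labelled_trees_def mem_Collect_eq case_prod_conv
    by (rule conjI[OF glued_tree conjI[OF ext val]])
qed

lemma ab: "{a, b} \<in> E" "a \<noteq> b" "{a, b} \<notin> E1" "{a, b} \<notin> E2" "E1 \<inter> E2 = {}"
proof -
  show "{a, b} \<in> E" by (simp add: E_def)
  have bA: "b \<notin> A" using b_in_B disj(2) by (auto simp: disjoint_iff)
  have aB: "a \<notin> B" using a_in_A disj(2) by (auto simp: disjoint_iff)
  show "a \<noteq> b" using aB b_in_B by metis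
  show "{a, b} \<notin> E1" using tree_edgeD(2)[OF tree1, of a b] bA by metis
  show "{a, b} \<notin> E2" using tree_edgeD(1)[OF tree2, of a b] aB by metis
  show "E1 \<inter> E2 = {}"
  proof (rule ccontr)
    assume "E1 \<inter> E2 \<noteq> {}"
    then obtain d where d: "d \<in> E1" "d \<in> E2" by blast
    obtain u v where "u \<in> A" "d = {u, v}" by (rule tree_edgeE[OF tree1 d(1)])
    with tree_edgeD(1)[OF tree2, of u v] d(2) disj(2) show False by blast
  qed
qed

end

text \<open>
  The flow through an edge refers to the order of the vertices, so from here on they have a linearly ordered
  type.
\<close>
context
  fixes A B :: "'v::linorder set" and I J :: "'a set" and e :: "'a \<Rightarrow> nat"
    and E1 E2 :: "'v set set" and l1 l2 :: "'a option \<Rightarrow> 'v"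
  assumes g: "gluing A B I J e E1 E2 l1 l2"
begin

interpretation gluing A B I J e E1 E2 l1 l2 by (rule g)

lemma edge_flow_glue:
  shows "d \<in> E1 \<Longrightarrow> edge_flow (A \<union> B) (I \<union> J) k x (E, l) d =
      edge_flow A (half_labels I) k (case_option (leaky_flow k x J) x) (E1, l1) d"
    and "d \<in> E2 \<Longrightarrow> edge_flow (A \<union> B) (I \<union> J) k x (E, l) d =
      edge_flow B (half_labels J) k (case_option (leaky_flow k x I) x) (E2, l2) d"
  using branch_flow_A branch_flow_B edge_MinMax(3)[OF tree1] edge_MinMax(3)[OF tree2]
  by (simp_all add: edge_flow_def)

text \<open>
  The flow through the new edge is oriented by the order of its two vertices.
\<close>
lemma edge_flow_ab:
  "edge_flow (A \<union> B) (I \<union> J) k x (E, l) {a, b} = (if a < b then leaky_flow k x I else leaky_flow k x J)"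
proof (cases "a < b")
  case True
  then have "Min {a, b} = a" "Max {a, b} = b" by auto
  with True show ?thesis by (simp add: edge_flow_def branch_flow_def cut_ab legs_in_A)
next
  case False
  then have "b < a" using ab(2) by simp
  then have "Min {a, b} = b" "Max {a, b} = a" by auto
  with False show ?thesis by (simp add: edge_flow_def branch_flow_def cut_ba legs_in_B)
qed

lemma rightward_glue:
  "rightward (A \<union> B) (I \<union> J) k x (E, l) \<longleftrightarrow>
     (if a < b then leaky_flow k x I else leaky_flow k x J) > 0 \<and>
     rightward A (half_labels I) k (case_option (leaky_flow k x J) x) (E1, l1) \<and>
     rightward B (half_labels J) k (case_option (leaky_flow k x I) x) (E2, l2)"
proof -
  have "rightward (A \<union> B) (I \<union> J) k x (E, l) \<longleftrightarrow>
      (\<forall>d\<in>insert {a, b} (E1 \<union> E2). edge_flow (A \<union> B) (I \<union> J) k x (E, l) d > 0)"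
    by (simp add: rightward_def E_def)
  also have "\<dots> \<longleftrightarrow> edge_flow (A \<union> B) (I \<union> J) k x (E, l) {a, b} > 0 \<and>
      (\<forall>d\<in>E1. edge_flow (A \<union> B) (I \<union> J) k x (E, l) d > 0) \<and>
      (\<forall>d\<in>E2. edge_flow (A \<union> B) (I \<union> J) k x (E, l) d > 0)"
    by blast
  also have "\<dots> \<longleftrightarrow> (if a < b then leaky_flow k x I else leaky_flow k x J) > 0 \<and>
     rightward A (half_labels I) k (case_option (leaky_flow k x J) x) (E1, l1) \<and>
     rightward B (half_labels J) k (case_option (leaky_flow k x I) x) (E2, l2)"
    by (simp only: edge_flow_ab edge_flow_glue rightward_def fst_conv cong: ball_cong)
  finally show ?thesis .
qed

lemma tree_weight_glue:
  "tree_weight (A \<union> B) (I \<union> J) k x e (E, l) =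
     (if a < b then leaky_flow k x I else leaky_flow k x J) *
     tree_weight A (half_labels I) k (case_option (leaky_flow k x J) x) (case_option 0 e) (E1, l1) *
     tree_weight B (half_labels J) k (case_option (leaky_flow k x I) x) (case_option 0 e) (E2, l2)"
proof -
  let ?f = "edge_flow (A \<union> B) (I \<union> J) k x (E, l)"
  have "prod ?f E = prod ?f (insert {a, b} (E1 \<union> E2))" by (simp add: E_def)
  also have "\<dots> = ?f {a, b} * (prod ?f E1 * prod ?f E2)"
    using ab tree_finite_edges[OF tree1] tree_finite_edges[OF tree2]
    by (simp add: prod.union_disjoint)
  finally have 1: "prod ?f E = (if a < b then leaky_flow k x I else leaky_flow k x J) *
     (prod (edge_flow A (half_labels I) k (case_option (leaky_flow k x J) x) (E1, l1)) E1 *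
      prod (edge_flow B (half_labels J) k (case_option (leaky_flow k x I) x) (E2, l2)) E2)"
    by (simp add: edge_flow_ab edge_flow_glue)
  have "prod (vertex_weight (I \<union> J) e l) (A \<union> B) =
      prod (vertex_weight (I \<union> J) e l) A * prod (vertex_weight (I \<union> J) e l) B"
    using disj(2) tree_finite[OF tree1] tree_finite[OF tree2] by (simp add: prod.union_disjoint)
  then show ?thesis
    by (simp add: tree_weight_def 1 vertex_weight_A vertex_weight_B)
qed

end

lemma glue_half:
  assumes t: "(E, l) \<in> labelled_trees V L e" and L: "finite L" and uv: "{u, v} \<in> E"
    and I: "legs_in L l (cut V E u v) = I"
  shows "glue I (L - I) (half (cut V E u v) u I (E, l)) (half (cut V E v u) v (L - I) (E, l)) = (E, l)"
    and "half (cut V E u v) u I (E, l)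
      \<in> labelled_trees (cut V E u v) (half_labels I) (case_option 0 e)"
    and "half (cut V E v u) v (L - I) (E, l)
      \<in> labelled_trees (V - cut V E u v) (half_labels (L - I)) (case_option 0 e)"
proof -
  note D = labelled_treesD[OF t]
  have vu: "{v, u} \<in> E" using uv by (simp add: insert_commute)
  have IL: "I \<subseteq> L" using I by (auto simp: legs_in_def)
  have J: "legs_in L l (cut V E v u) = L - I"
    by (simp add: cut_swap[OF D(1) uv] legs_in_diff[OF D(3)] I)
  show "half (cut V E u v) u I (E, l)
      \<in> labelled_trees (cut V E u v) (half_labels I) (case_option 0 e)"
    using half_labelled_tree[OF t uv L] by (simp add: I)
  show "half (cut V E v u) v (L - I) (E, l)
      \<in> labelled_trees (V - cut V E u v) (half_labels (L - I)) (case_option 0 e)"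
    using half_labelled_tree[OF t vu L] unfolding J unfolding cut_swap[OF D(1) uv] .
  have "insert {u, v} (E \<inter> Pow (cut V E u v) \<union> E \<inter> Pow (cut V E v u)) = E"
    using edges_split[OF D(1) uv] by simp
  moreover have "l i = undefined" if "i \<notin> L" for i by (rule PiE_arb[OF D(2) that])
  ultimately show "glue I (L - I) (half (cut V E u v) u I (E, l)) (half (cut V E v u) v (L - I) (E, l)) = (E, l)"
    using IL by (auto simp: glue_def half_def half_labels_def image_iff fun_eq_iff restrict_def)
qed

section \<open>Independence of the vertex set\<close>

definition relabel :: "('v \<Rightarrow> 'w) \<Rightarrow> 'a set \<Rightarrow> 'v set set \<times> ('a \<Rightarrow> 'v) \<Rightarrow> 'w set set \<times> ('a \<Rightarrow> 'w)" where
  "relabel f L t = ((`) f ` fst t, restrict (f \<circ> snd t) L)"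

lemma legs_at_relabel:
  assumes f: "inj_on f V" and l: "l \<in> L \<rightarrow> V" and v: "v \<in> V"
  shows "legs_at L (restrict (f \<circ> l) L) (f v) = legs_at L l v"
  using l v by (auto simp: legs_at_def inj_on_eq_iff[OF f] Pi_iff)

lemma legs_in_relabel:
  assumes f: "inj_on f V" and l: "l \<in> L \<rightarrow> V" and A: "A \<subseteq> V"
  shows "legs_in L (restrict (f \<circ> l) L) (f ` A) = legs_in L l A"
  using l A by (auto simp: legs_in_def Pi_iff inj_on_image_mem_iff[OF f])

lemma relabel_labelled_tree:
  assumes t: "t \<in> labelled_trees V L e" and f: "inj_on f V"
  shows "relabel f L t \<in> labelled_trees (f ` V) L e"
proof -
  obtain E l where El: "t = (E, l)" by (cases t)
  note D = labelled_treesD[OF t[unfolded El]]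
  have "card (nbrs (f ` V) ((`) f ` E) (f v)) + card (legs_at L (restrict (f \<circ> l) L) (f v)) =
    (\<Sum>i\<in>legs_at L (restrict (f \<circ> l) L) (f v). e i) + 3" if v: "v \<in> V" for v
  proof -
    have "inj_on f (nbrs V E v)" using f by (rule inj_on_subset) (auto simp: nbrs_def)
    then show ?thesis
      using D(4)[OF v] by (simp add: tree_image(3)[OF D(1) f v] legs_at_relabel[OF f D(3) v] card_image)
  qed
  moreover have "restrict (f \<circ> l) L \<in> L \<rightarrow>\<^sub>E f ` V" using D(3) by (auto simp: Pi_iff)
  ultimately show ?thesis
    using tree_image(1)[OF D(1) f] by (simp add: El labelled_trees_def relabel_def)
qed

lemma relabel_relabel:
  assumes t: "t \<in> labelled_trees V L e" and g: "\<And>v. v \<in> V \<Longrightarrow> g (f v) = v"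
  shows "relabel g L (relabel f L t) = t"
proof -
  obtain E l where El: "t = (E, l)" by (cases t)
  note D = labelled_treesD[OF t[unfolded El]]
  have "g ` f ` d = d" if "d \<in> E" for d
    by (rule tree_edgeE[OF D(1) that]) (simp add: g)
  then have "(`) g ` (`) f ` E = E" by (simp add: image_image)
  moreover have "restrict (g \<circ> restrict (f \<circ> l) L) L = l"
  proof
    show "restrict (g \<circ> restrict (f \<circ> l) L) L i = l i" for i
      using D(2) g by (cases "i \<in> L") (auto simp: PiE_def extensional_def)
  qed
  ultimately show ?thesis by (simp add: relabel_def El)
qed

lemma relabel_bij:
  assumes f: "inj_on f V"
  shows "bij_betw (relabel f L) (labelled_trees V L e) (labelled_trees (f ` V) L e)"
proof (rule bij_betw_byWitness[where f' = "relabel (the_inv_into V f) L"])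
  show "\<forall>t\<in>labelled_trees V L e. relabel (the_inv_into V f) L (relabel f L t) = t"
    using relabel_relabel[of _ V L e "the_inv_into V f" f] the_inv_into_f_f[OF f] by blast
  show "\<forall>t\<in>labelled_trees (f ` V) L e. relabel f L (relabel (the_inv_into V f) L t) = t"
    using relabel_relabel[of _ "f ` V" L e f "the_inv_into V f"] f_the_inv_into_f[OF f] by blast
  show "relabel f L ` labelled_trees V L e \<subseteq> labelled_trees (f ` V) L e"
    using relabel_labelled_tree[OF _ f] by blast
  have "inj_on (the_inv_into V f) (f ` V)" "the_inv_into V f ` f ` V = V"
    using inj_on_the_inv_into[OF f] the_inv_into_onto[OF f] by auto
  then show "relabel (the_inv_into V f) L ` labelled_trees (f ` V) L e \<subseteq> labelled_trees V L e"
    using relabel_labelled_tree[of _ "f ` V" L e "the_inv_into V f"] by auto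
qed

lemma branch_flow_relabel:
  assumes t: "(E, l) \<in> labelled_trees V L e" and f: "inj_on f V" and e: "{u, v} \<in> E"
  shows "branch_flow (f ` V) L k x ((`) f ` E) (restrict (f \<circ> l) L) (f u) (f v) =
    branch_flow V L k x E l u v"
proof -
  note D = labelled_treesD[OF t]
  show ?thesis
    unfolding branch_flow_def tree_image(2)[OF D(1) f e]
      legs_in_relabel[OF f D(3) cut_subset[OF D(1) e]] ..
qed

lemma edge_flow_relabel:
  fixes f :: "'v::linorder \<Rightarrow> 'w::linorder"
  assumes t: "t \<in> labelled_trees V L e" and f: "strict_mono_on V f" and d: "d \<in> fst t"
  shows "edge_flow (f ` V) L k x (relabel f L t) (f ` d) = edge_flow V L k x t d"
proof -
  obtain E l where El: "t = (E, l)" by (cases t)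
  note D = labelled_treesD[OF t[unfolded El]]
  have dE: "d \<in> E" using d El by simp
  note mm = edge_MinMax[OF D(1) dE]
  have "Min d \<in> V" "Max d \<in> V" using tree_edgeD[OF D(1) mm(3)] by auto
  then have "f (Min d) < f (Max d)" using f mm(2) by (auto simp: strict_mono_on_def)
  moreover have "f ` d = {f (Min d), f (Max d)}" using mm(1) by (metis image_empty image_insert)
  ultimately have "Min (f ` d) = f (Min d)" "Max (f ` d) = f (Max d)" by auto
  then show ?thesis
    using branch_flow_relabel[OF t[unfolded El] strict_mono_on_imp_inj_on[OF f] mm(3)]
    by (simp add: edge_flow_def El relabel_def)
qed

lemma prod_edges_relabel:
  assumes t: "t \<in> labelled_trees V L e" and f: "inj_on f V"
  shows "(\<Prod>d\<in>fst (relabel f L t). h d) = (\<Prod>d\<in>fst t. h (f ` d))"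
proof -
  obtain E l where El: "t = (E, l)" by (cases t)
  note D = labelled_treesD[OF t[unfolded El]]
  have "E \<subseteq> Pow V" by (auto elim!: tree_edgeE[OF D(1)])
  then have "inj_on ((`) f) E" using inj_on_image_Pow[OF f] inj_on_subset by blast
  then show ?thesis by (simp add: relabel_def El prod.reindex)
qed

lemma prod_vertices_relabel:
  assumes t: "t \<in> labelled_trees V L e" and f: "inj_on f V"
  shows "(\<Prod>v\<in>f ` V. vertex_weight L e (snd (relabel f L t)) v) = (\<Prod>v\<in>V. vertex_weight L e (snd t) v)"
proof -
  obtain E l where El: "t = (E, l)" by (cases t)
  note D = labelled_treesD[OF t[unfolded El]]
  show ?thesis
    by (simp add: relabel_def El prod.reindex[OF f] vertex_weight_def legs_at_relabel[OF f D(3)])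
qed

lemma tree_sum_relabel:
  fixes f :: "'v::linorder \<Rightarrow> 'w::linorder"
  assumes f: "strict_mono_on V f"
  shows "tree_sum (f ` V) L k x0 x e = tree_sum V L k x0 x e"
proof -
  have inj: "inj_on f V" by (rule strict_mono_on_imp_inj_on[OF f])
  have "rightward (f ` V) L k x0 (relabel f L t) = rightward V L k x0 t"
    if t: "t \<in> labelled_trees V L e" for t
    using edge_flow_relabel[OF t f] by (auto simp: rightward_def relabel_def)
  moreover have "tree_weight (f ` V) L k x e (relabel f L t) = tree_weight V L k x e t"
    if t: "t \<in> labelled_trees V L e" for t
    using prod_vertices_relabel[OF t inj]
    by (simp add: tree_weight_def prod_edges_relabel[OF t inj] edge_flow_relabel[OF t f])
  ultimately show ?thesis
    unfolding tree_sum_def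
    by (subst sum.reindex_bij_betw[OF relabel_bij[OF inj], symmetric]) simp
qed

lemma ex_order_enumeration:
  fixes V :: "'v::linorder set"
  assumes "finite V"
  shows "\<exists>f. bij_betw f {..<card V} V \<and> strict_mono_on {..<card V} f"
proof -
  let ?f = "\<lambda>i. sorted_list_of_set V ! i"
  have "bij_betw ?f {..<card V} V"
    using assms by (intro bij_betw_nth) simp_all
  moreover have "strict_mono_on {..<card V} ?f"
    using assms by (auto simp: strict_mono_on_def intro!: sorted_wrt_nth_less[OF strict_sorted_list_of_set])
  ultimately show ?thesis by blast
qed

lemma tree_sum_card_cong:
  fixes V :: "'v::linorder set" and W :: "'w::linorder set"
  assumes V: "finite V" "finite W" "card V = card W"
  shows "tree_sum V L k x0 x e = tree_sum W L k x0 x e"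
proof -
  obtain f where f: "bij_betw f {..<card V} V" "strict_mono_on {..<card V} f"
    using ex_order_enumeration[OF V(1)] by blast
  obtain g where g: "bij_betw g {..<card W} W" "strict_mono_on {..<card W} g"
    using ex_order_enumeration[OF V(2)] by blast
  show ?thesis
    using tree_sum_relabel[OF f(2)] tree_sum_relabel[OF g(2)] V(3)
      bij_betw_imp_surj_on[OF f(1)] bij_betw_imp_surj_on[OF g(1)] by metis
qed

section \<open>Wall-crossing for sums over trees\<close>

text \<open>
  By \<open>card_legs_in_cut\<close> every edge flow is one of the forms that define the walls.
\<close>
lemma edge_flow_eq_leaky_flow:
  assumes t: "t \<in> labelled_trees V L e" and L: "finite L" and d: "d \<in> fst t"
  obtains K where "K \<subseteq> L" "2 \<le> card K" "2 \<le> card (L - K)"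
    "\<And>k x. edge_flow V L k x t d = leaky_flow k x K"
    "K = legs_in L (snd t) (cut V (fst t) (Min d) (Max d))"
proof -
  obtain E l where El: "t = (E, l)" by (cases t)
  note D = labelled_treesD[OF t[unfolded El]]
  have dE: "d \<in> E" using d El by simp
  note card = card_legs_in_cut[OF t[unfolded El] edge_MinMax(3)[OF D(1) dE] L]
  show ?thesis
    by (rule that[of "legs_in L l (cut V E (Min d) (Max d))"])
      (use card in \<open>auto simp: El edge_flow_def branch_flow_def legs_in_def\<close>)
qed

text \<open>
  The degrees \<open>x\<close> and \<open>y\<close> are not separated by any wall, except possibly by those of
  the sets in \<open>\<W>\<close>.
\<close>
definition same_side :: "'a set \<Rightarrow> int \<Rightarrow> ('a \<Rightarrow> real) \<Rightarrow> ('a \<Rightarrow> real) \<Rightarrow> 'a set set \<Rightarrow> bool" where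
  "same_side L k x y \<W> \<longleftrightarrow> (\<forall>K. K \<subseteq> L \<and> 2 \<le> card K \<and> 2 \<le> card (L - K) \<and> K \<notin> \<W> \<longrightarrow>
     sgn (leaky_flow k x K) = sgn (leaky_flow k y K))"

lemma sgn_eq_pos: "sgn a = sgn (b::real) \<Longrightarrow> a > 0 \<longleftrightarrow> b > 0"
  by (auto simp: sgn_if split: if_splits)

lemma rightward_same_side:
  assumes t: "t \<in> labelled_trees V L e" and L: "finite L" and s: "same_side L k x y \<W>"
    and W: "\<And>d. d \<in> fst t \<Longrightarrow> legs_in L (snd t) (cut V (fst t) (Min d) (Max d)) \<notin> \<W>"
  shows "rightward V L k x t = rightward V L k y t"
proof -
  have "edge_flow V L k x t d > 0 \<longleftrightarrow> edge_flow V L k y t d > 0" if d: "d \<in> fst t" for d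
  proof -
    obtain K where K: "K \<subseteq> L" "2 \<le> card K" "2 \<le> card (L - K)"
      "\<And>k x. edge_flow V L k x t d = leaky_flow k x K"
      "K = legs_in L (snd t) (cut V (fst t) (Min d) (Max d))"
      by (rule edge_flow_eq_leaky_flow[OF t L d]) blast
    then have "sgn (leaky_flow k x K) = sgn (leaky_flow k y K)" using s W[OF d] by (simp add: same_side_def)
    then show ?thesis unfolding K(4) by (rule sgn_eq_pos)
  qed
  then show ?thesis by (simp add: rightward_def)
qed

lemma half_total:
  assumes L: "finite L" "I \<subseteq> L" and x: "(\<Sum>i\<in>L. x i) = of_int k * (real (card L) - 2)"
  shows "(\<Sum>j\<in>half_labels I. case_option (leaky_flow k x (L - I)) x j) =
      of_int k * (real (card (half_labels I)) - 2)"
proof -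
  have fI: "finite I" using L finite_subset by blast
  show ?thesis
    using leaky_flow_complement[OF L x]
    by (simp add: sum_half_labels[OF fI] card_half_labels[OF fI] leaky_flow_def algebra_simps)
qed

text \<open>
  The walls for the half tree are walls for the whole tree: a side without the new end is a proper subset of
  \<open>I\<close>, and a side with the new end is the complement of one without.
\<close>
lemma same_side_half:
  assumes L: "finite L" "I \<subseteq> L" and ne: "L - I \<noteq> {}" and s: "same_side L k x y {I, L - I}"
    and x: "(\<Sum>i\<in>L. x i) = of_int k * (real (card L) - 2)"
    and y: "(\<Sum>i\<in>L. y i) = of_int k * (real (card L) - 2)"
  shows "same_side (half_labels I) k (case_option (leaky_flow k x (L - I)) x) (case_option (leaky_flow k y (L - I)) y) {}"
proof -
  have fI: "finite I" using L finite_subset by blast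
  note total = half_total[OF L]
  have main: "sgn (leaky_flow k (case_option (leaky_flow k x (L - I)) x) M) =
      sgn (leaky_flow k (case_option (leaky_flow k y (L - I)) y) M)"
    if M: "M \<subseteq> half_labels I" "2 \<le> card M" "2 \<le> card (half_labels I - M)" "None \<notin> M" for M
  proof -
    let ?K = "{i. Some i \<in> M}"
    have MK: "M = Some ` ?K" using M(4) by (auto simp: image_iff) (metis not_None_eq)
    have KI: "?K \<subseteq> I" using M(1) by (auto simp: half_labels_def)
    have w: "leaky_flow k (case_option c z) M = leaky_flow k z ?K" for c z
      by (subst MK) (simp add: leaky_flow_def sum.reindex card_image)
    have cK: "2 \<le> card ?K" using M(2) MK by (metis card_image inj_Some inj_on_subset subset_UNIV)
    have "card (half_labels I - M) = card (half_labels I) - card M"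
      using M(1) finite_half_labels[OF fI] by (meson card_Diff_subset finite_subset)
    then have "card M + 2 \<le> card I + 1" using M(3) card_half_labels[OF fI] by linarith
    moreover have "card M = card ?K" by (subst MK) (simp add: card_image)
    ultimately have lt: "card ?K < card I" by linarith
    have "?K \<noteq> I" using lt by blast
    moreover have "?K \<noteq> L - I" using KI cK by (metis Diff_disjoint Int_absorb1 card.empty not_numeral_le_zero)
    moreover have "2 \<le> card (L - ?K)"
    proof -
      obtain j where j: "j \<in> L - I" using ne by blast
      obtain i where i: "i \<in> I - ?K" using \<open>?K \<noteq> I\<close> KI by blast
      have "card {i, j} \<le> card (L - ?K)" using i j KI L by (intro card_mono) auto
      moreover have "i \<noteq> j" using i j by blast
      ultimately show ?thesis by simp
    qed
    moreover have "?K \<subseteq> L" using KI L(2) by blast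
    ultimately have "sgn (leaky_flow k x ?K) = sgn (leaky_flow k y ?K)"
      using s cK unfolding same_side_def by blast
    then show ?thesis unfolding w .
  qed
  have "sgn (leaky_flow k (case_option (leaky_flow k x (L - I)) x) M) =
      sgn (leaky_flow k (case_option (leaky_flow k y (L - I)) y) M)"
    if M: "M \<subseteq> half_labels I" "2 \<le> card M" "2 \<le> card (half_labels I - M)" for M
  proof (cases "None \<in> M")
    case True
    let ?N = "half_labels I - M"
    have NM: "half_labels I - ?N = M" using M(1) by blast
    have "sgn (leaky_flow k (case_option (leaky_flow k x (L - I)) x) ?N) =
        sgn (leaky_flow k (case_option (leaky_flow k y (L - I)) y) ?N)"
      by (rule main) (use M True NM in auto)
    then show ?thesis
      using leaky_flow_complement[OF finite_half_labels[OF fI] M(1) total[OF x]]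
        leaky_flow_complement[OF finite_half_labels[OF fI] M(1) total[OF y]]
      by (simp add: sgn_minus)
  qed (use main M in blast)
  then show ?thesis by (simp add: same_side_def)
qed

text \<open>
  The facts of the locale \<open>gluing\<close>, in the form needed for summing over all subsets
  \<open>A\<close> of a fixed vertex set.
\<close>
lemma glue_trees:
  fixes V :: "'v::linorder set"
  assumes fin: "finite I" "finite J" and L: "I \<inter> J = {}" "I \<union> J = L" and A: "A \<subseteq> V"
    and t1: "t1 \<in> labelled_trees A (half_labels I) (case_option 0 e)"
    and t2: "t2 \<in> labelled_trees (V - A) (half_labels J) (case_option 0 e)"
    and t: "t = glue I J t1 t2" and a: "a = snd t1 None" and b: "b = snd t2 None"
  shows "t \<in> labelled_trees V L e"
    and "{a, b} \<in> fst t" and "cut V (fst t) a b = A" and "legs_in L (snd t) A = I"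
    and "half A a I t = t1" and "half (V - A) b J t = t2"
    and "rightward V L k x t \<longleftrightarrow>
     (if a < b then leaky_flow k x I else leaky_flow k x J) > 0 \<and>
     rightward A (half_labels I) k (case_option (leaky_flow k x J) x) t1 \<and>
     rightward (V - A) (half_labels J) k (case_option (leaky_flow k x I) x) t2"
    and "tree_weight V L k x e t =
     (if a < b then leaky_flow k x I else leaky_flow k x J) *
     tree_weight A (half_labels I) k (case_option (leaky_flow k x J) x) (case_option 0 e) t1 *
     tree_weight (V - A) (half_labels J) k (case_option (leaky_flow k x I) x) (case_option 0 e) t2"
proof -
  obtain E1 l1 E2 l2 where El: "t1 = (E1, l1)" "t2 = (E2, l2)" by (cases t1, cases t2)
  have g: "gluing A (V - A) I J e E1 E2 l1 l2"
    using fin L t1 t2 unfolding El gluing_def by simp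
  interpret gluing A "V - A" I J e E1 E2 l1 l2 by (rule g)
  have tE: "t = (gluing.E E1 E2 l1 l2, gluing.l I J l1 l2)" using glue_eq t El by simp
  have ab: "a = gluing.a l1" "b = gluing.b l2" using El \<open>a = snd t1 None\<close> \<open>b = snd t2 None\<close>
    by (simp_all add: a_def b_def)
  have AV: "A \<union> (V - A) = V" using A by blast
  show "t \<in> labelled_trees V L e"
    unfolding tE by (rule labelled_tree[unfolded AV L(2)])
  show "{a, b} \<in> fst t" unfolding tE ab fst_conv by (rule gluing.ab(1)[OF g])
  show "cut V (fst t) a b = A" unfolding tE ab fst_conv by (rule cut_ab[unfolded AV])
  show "legs_in L (snd t) A = I" unfolding tE ab snd_conv by (rule legs_in_A[unfolded L(2)])
  show "half A a I t = t1" unfolding tE ab El(1) by (rule half_A)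
  show "half (V - A) b J t = t2" unfolding tE ab El(2) by (rule half_B)
  show "rightward V L k x t \<longleftrightarrow>
     (if a < b then leaky_flow k x I else leaky_flow k x J) > 0 \<and>
     rightward A (half_labels I) k (case_option (leaky_flow k x J) x) t1 \<and>
     rightward (V - A) (half_labels J) k (case_option (leaky_flow k x I) x) t2"
    unfolding tE ab El by (rule rightward_glue[OF g, unfolded AV L(2)])
  show "tree_weight V L k x e t =
     (if a < b then leaky_flow k x I else leaky_flow k x J) *
     tree_weight A (half_labels I) k (case_option (leaky_flow k x J) x) (case_option 0 e) t1 *
     tree_weight (V - A) (half_labels J) k (case_option (leaky_flow k x I) x) (case_option 0 e) t2"
    unfolding tE ab El by (rule tree_weight_glue[OF g, unfolded AV L(2)])
qed

text \<open>
  Here \<open>x1\<close> and \<open>x2\<close> are degrees on the two sides of the wall of \<open>I\<close>. A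
  tree contributes to the difference only if it is admitted at exactly one of them, which requires an edge
  separating \<open>I\<close> from its complement. These trees are parametrised by gluing.
\<close>
lemma wall_crossing_sum:
  fixes V :: "'v::linorder set"
  assumes V: "finite V" and L: "finite L" "I \<subseteq> L" and ne: "I \<noteq> {}" "L - I \<noteq> {}"
    and x: "(\<Sum>i\<in>L. x i) = of_int k * (real (card L) - 2)"
    and x1: "(\<Sum>i\<in>L. x1 i) = of_int k * (real (card L) - 2)"
    and x2: "(\<Sum>i\<in>L. x2 i) = of_int k * (real (card L) - 2)"
    and side: "same_side L k x1 x2 {I, L - I}"
    and pos: "leaky_flow k x1 I > 0" and neg: "leaky_flow k x2 I < 0"
  shows "tree_sum V L k x1 x e - tree_sum V L k x2 x e =
    leaky_flow k x I * (\<Sum>A\<in>Pow V.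
      tree_sum A (half_labels I) k (case_option (leaky_flow k x1 (L - I)) x1)
        (case_option (leaky_flow k x (L - I)) x) (case_option 0 e) *
      tree_sum (V - A) (half_labels (L - I)) k (case_option (leaky_flow k x1 I) x1)
        (case_option (leaky_flow k x I) x) (case_option 0 e))"
proof -
  define J where "J = L - I"
  have IJ: "I \<union> J = L" "I \<inter> J = {}" "L - J = I" "J \<subseteq> L" using L by (auto simp: J_def)
  have fin: "finite I" "finite J" using L finite_subset IJ by auto
  define S where "S = labelled_trees V L e"
  define D where "D t = (of_bool (rightward V L k x1 t) - of_bool (rightward V L k x2 t) :: real)" for t
  define w where "w = tree_weight V L k x e"
  define T1 where "T1 A = labelled_trees A (half_labels I) (case_option 0 e)" for A :: "'v set"
  define T2 where "T2 A = labelled_trees A (half_labels J) (case_option 0 e)" for A :: "'v set"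
  define Z where "Z = (SIGMA A:Pow V. T1 A \<times> T2 (V - A))"
  define gl where "gl z = glue I J (fst (snd z)) (snd (snd z))"
    for z :: "'v set \<times> ('v set set \<times> ('a option \<Rightarrow> 'v)) \<times> ('v set set \<times> ('a option \<Rightarrow> 'v))"
  define W1 where "W1 A t = of_bool (rightward A (half_labels I) k (case_option (leaky_flow k x1 J) x1) t) *
    tree_weight A (half_labels I) k (case_option (leaky_flow k x J) x) (case_option 0 e) t"
    for A :: "'v set" and t
  define W2 where "W2 A t = of_bool (rightward A (half_labels J) k (case_option (leaky_flow k x1 I) x1) t) *
    tree_weight A (half_labels J) k (case_option (leaky_flow k x I) x) (case_option 0 e) t"
    for A :: "'v set" and t
  have wJ: "leaky_flow k y J = - leaky_flow k y I" if "(\<Sum>i\<in>L. y i) = of_int k * (real (card L) - 2)" for y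
    unfolding J_def by (rule leaky_flow_complement[OF L that])
  have finS: "finite S" unfolding S_def by (rule finite_labelled_trees[OF L(1) V])
  have Z: "(A, t1, t2) \<in> Z \<longleftrightarrow> A \<subseteq> V \<and> t1 \<in> T1 A \<and> t2 \<in> T2 (V - A)" for A t1 t2
    by (auto simp: Z_def)
  have gl: "gl (A, t1, t2) = glue I J t1 t2" for A t1 t2 by (simp add: gl_def)
  note glued = glue_trees[OF fin IJ(2,1), where V = V and e = e, folded T1_def T2_def S_def,
      OF _ _ _ refl refl refl]
  \<comment> \<open>The two halves are recovered by cutting the only edge that separates \<open>I\<close> from its complement.\<close>
  have inj: "inj_on gl Z"
  proof (rule inj_onI)
    fix z z' assume zz: "z \<in> Z" "z' \<in> Z" "gl z = gl z'"
    obtain A t1 t2 where z: "z = (A, t1, t2)" by (metis prod_cases3)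
    obtain A' t1' t2' where z': "z' = (A', t1', t2')" by (metis prod_cases3)
    obtain E l where El: "glue I J t1 t2 = (E, l)" by (cases "glue I J t1 t2")
    have El': "glue I J t1' t2' = (E, l)" using El zz(3) z z' by (simp add: gl)
    have A: "A \<subseteq> V" "t1 \<in> T1 A" "t2 \<in> T2 (V - A)" using zz z Z by auto
    have A': "A' \<subseteq> V" "t1' \<in> T1 A'" "t2' \<in> T2 (V - A')" using zz z' Z by auto
    note p = glued[OF A, unfolded El fst_conv snd_conv]
    note p' = glued[OF A', unfolded El' fst_conv snd_conv]
    have "snd t1 None = snd t1' None \<and> snd t2 None = snd t2' None"
      by (rule edge_unique[OF p(1)[unfolded S_def] L(1) p(2) p'(2)])
        (simp only: p(3,4) p'(3,4))
    then have "A = A'" "t1 = t1'" "t2 = t2'" using p(3,5,6) p'(3,5,6) by metis+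
    then show "z = z'" using z z' by simp
  qed
  \<comment> \<open>A tree without such an edge is admitted at both of \<open>x1\<close> and \<open>x2\<close> or at neither.\<close>
  have outside: "D t * w t = 0" if t: "t \<in> S - gl ` Z" for t
  proof -
    obtain E l where El: "t = (E, l)" by (cases t)
    have tS: "(E, l) \<in> labelled_trees V L e" using t El by (simp add: S_def)
    note tD = labelled_treesD[OF tS]
    have no: False if uv: "{u, v} \<in> E" and I: "legs_in L l (cut V E u v) = I" for u v
    proof -
      note g = glue_half[OF tS L(1) uv I]
      have "(cut V E u v, half (cut V E u v) u I (E, l), half (cut V E v u) v (L - I) (E, l)) \<in> Z"
        using g(2,3) cut_subset[OF tD(1) uv] by (simp add: Z T1_def T2_def J_def)
      moreover have "gl (cut V E u v, half (cut V E u v) u I (E, l), half (cut V E v u) v (L - I) (E, l)) = t"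
        using g(1) by (simp add: gl El J_def)
      ultimately show False using t by (metis DiffD2 imageI)
    qed
    have "rightward V L k x1 t = rightward V L k x2 t"
    proof (rule rightward_same_side[OF _ L(1) side])
      show "t \<in> labelled_trees V L e" using tS El by simp
      fix d assume "d \<in> fst t"
      then have d: "{Min d, Max d} \<in> E" using edge_MinMax(3)[OF tD(1)] El by simp
      then have d': "{Max d, Min d} \<in> E" by (simp add: insert_commute)
      have "legs_in L l (cut V E (Min d) (Max d)) \<noteq> I" using no[OF d] by blast
      moreover have "legs_in L l (cut V E (Min d) (Max d)) \<noteq> L - I"
      proof
        assume "legs_in L l (cut V E (Min d) (Max d)) = L - I"
        then have "legs_in L l (cut V E (Max d) (Min d)) = I"
          using L(2) by (simp add: cut_swap[OF tD(1) d] legs_in_diff[OF tD(3)] double_diff)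
        with no[OF d'] show False .
      qed
      ultimately show "legs_in L (snd t) (cut V (fst t) (Min d) (Max d)) \<notin> {I, L - I}"
        by (simp add: El)
    qed
    then show ?thesis by (simp add: D_def)
  qed
  have side': "same_side L k x1 x2 {J, L - J}" using side IJ by (simp add: J_def insert_commute)
  have summand: "D (gl (A, t1, t2)) * w (gl (A, t1, t2)) = leaky_flow k x I * (W1 A t1 * W2 (V - A) t2)"
    if z: "(A, t1, t2) \<in> Z" for A t1 t2
  proof -
    have A: "A \<subseteq> V" "t1 \<in> T1 A" "t2 \<in> T2 (V - A)" using z Z by auto
    note t12 = A(2)[unfolded T1_def] A(3)[unfolded T2_def]
    have r1: "rightward A (half_labels I) k (case_option (leaky_flow k x2 J) x2) t1 =
        rightward A (half_labels I) k (case_option (leaky_flow k x1 J) x1) t1"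
      unfolding J_def
      by (rule rightward_same_side[OF t12(1) finite_half_labels[OF fin(1)]
            same_side_half[OF L ne(2) side x1 x2], symmetric]) simp
    have ne': "L - J \<noteq> {}" using ne IJ by simp
    have r2: "rightward (V - A) (half_labels J) k (case_option (leaky_flow k x2 I) x2) t2 =
        rightward (V - A) (half_labels J) k (case_option (leaky_flow k x1 I) x1) t2"
      using rightward_same_side[OF t12(2) finite_half_labels[OF fin(2)]
            same_side_half[OF L(1) IJ(4) ne' side' x1 x2]] by (simp add: IJ(3))
    \<comment> \<open>Exactly one of the two orders of the ends of the new edge is admitted at \<open>x1\<close>, and
      exactly the other one at \<open>x2\<close>; the sign of the edge factor in w makes up for the sign in \<open>D\<close>.\<close>
    show ?thesis
      unfolding D_def w_def gl glued(7,8)[OF A] r1 r2 W1_def W2_def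
      using pos neg wJ[OF x] wJ[OF x1] wJ[OF x2] by simp
  qed
  have "tree_sum V L k x1 x e - tree_sum V L k x2 x e = (\<Sum>t\<in>S. D t * w t)"
    by (simp add: tree_sum_def S_def D_def w_def left_diff_distrib sum_subtractf)
  also have "\<dots> = (\<Sum>t\<in>gl ` Z. D t * w t)"
  proof (rule sum.mono_neutral_right[OF finS])
    show "gl ` Z \<subseteq> S" using glued(1) Z by (auto simp: gl)
  qed (use outside in blast)
  also have "\<dots> = (\<Sum>z\<in>Z. D (gl z) * w (gl z))" by (simp add: sum.reindex[OF inj])
  also have "\<dots> = (\<Sum>(A, t1, t2)\<in>Z. leaky_flow k x I * (W1 A t1 * W2 (V - A) t2))"
    using summand by (intro sum.cong) auto
  also have "\<dots> = (\<Sum>A\<in>Pow V. \<Sum>(t1, t2)\<in>T1 A \<times> T2 (V - A). leaky_flow k x I * (W1 A t1 * W2 (V - A) t2))"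
    unfolding Z_def
  proof (rule sum.Sigma[symmetric])
    have "finite A" if "A \<in> Pow V" for A using that V finite_subset by blast
    then show "\<forall>A\<in>Pow V. finite (T1 A \<times> T2 (V - A))"
      using V fin by (simp add: T1_def T2_def finite_labelled_trees finite_half_labels)
  qed (use V in simp)
  also have "\<dots> = (\<Sum>A\<in>Pow V. leaky_flow k x I * ((\<Sum>t1\<in>T1 A. W1 A t1) * (\<Sum>t2\<in>T2 (V - A). W2 (V - A) t2)))"
    unfolding sum_product by (simp add: sum.cartesian_product[symmetric] sum_distrib_left)
  also have "\<dots> = leaky_flow k x I * (\<Sum>A\<in>Pow V.
      tree_sum A (half_labels I) k (case_option (leaky_flow k x1 J) x1)
        (case_option (leaky_flow k x J) x) (case_option 0 e) *
      tree_sum (V - A) (half_labels J) k (case_option (leaky_flow k x1 I) x1)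
        (case_option (leaky_flow k x I) x) (case_option 0 e))"
    by (simp add: sum_distrib_left tree_sum_def W1_def W2_def T1_def T2_def)
  finally show ?thesis by (simp add: J_def)
qed

text \<open>
  There are no labelled trees on a vertex set of the wrong size.
\<close>
lemma tree_sum_eq_0:
  assumes "finite L" "int (card V) \<noteq> int (card L) - 2 - int (\<Sum>i\<in>L. e i) \<or> V = {}"
  shows "tree_sum V L k x0 x e = 0"
proof -
  have "labelled_trees V L e = {}"
    using labelled_trees_card[OF _ assms(1)] labelled_trees_nonempty assms(2) by (metis surj_pair equals0I)
  then show ?thesis by (simp add: tree_sum_def)
qed

text \<open>
  Only the subsets with \<open>r1\<close> elements contribute, and they contribute equally by
  \<open>tree_sum_card_cong\<close>. If \<open>r1\<close> or \<open>r2\<close> is not positive, one of the two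
  trees would have no vertex.
\<close>
lemma sum_subsets_card:
  fixes V :: "'v::linorder set" and V1 :: "'w::linorder set" and V2 :: "'u::linorder set"
  assumes V: "finite V" "finite V1" "finite V2" and L: "finite L1" "finite L2"
    and r1: "r1 = int (card L1) - 2 - int (\<Sum>i\<in>L1. e1 i)"
    and r2: "r2 = int (card L2) - 2 - int (\<Sum>i\<in>L2. e2 i)"
    and r: "int (card V) = r1 + r2" and c: "card V1 = nat r1" "card V2 = nat r2"
  shows "(\<Sum>A\<in>Pow V. tree_sum A L1 k x1 y1 e1 * tree_sum (V - A) L2 k x2 y2 e2) =
    (if r1 \<le> 0 \<or> r2 \<le> 0 then 0 else fact (card V) / (fact (nat r1) * fact (nat r2)) *
       tree_sum V1 L1 k x1 y1 e1 * tree_sum V2 L2 k x2 y2 e2)"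
proof -
  have sub: "finite A" "card (V - A) = card V - card A" "card A \<le> card V" if "A \<in> Pow V" for A
    using that V(1) by (auto simp: card_Diff_subset finite_subset card_mono)
  show ?thesis
  proof (cases "r1 \<le> 0 \<or> r2 \<le> 0")
    case True
    have "tree_sum A L1 k x1 y1 e1 * tree_sum (V - A) L2 k x2 y2 e2 = 0" if A: "A \<in> Pow V" for A
    proof -
      have "int (card A) \<noteq> r1 \<or> A = {} \<or> int (card (V - A)) \<noteq> r2 \<or> V - A = {}"
        using True sub[OF A] V(1) by (metis card_eq_0_iff finite_Diff of_nat_0_less_iff not_le bot_nat_0.not_eq_extremum)
      then show ?thesis
        using tree_sum_eq_0[OF L(1), of A e1] tree_sum_eq_0[OF L(2), of "V - A" e2] r1 r2 by auto
    qed
    then have "(\<Sum>A\<in>Pow V. tree_sum A L1 k x1 y1 e1 * tree_sum (V - A) L2 k x2 y2 e2) = 0"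
      by (rule sum.neutral[rule_format])
    with True show ?thesis by simp
  next
    case False
    let ?P = "{A. A \<subseteq> V \<and> card A = nat r1}"
    have "(\<Sum>A\<in>Pow V. tree_sum A L1 k x1 y1 e1 * tree_sum (V - A) L2 k x2 y2 e2) =
        (\<Sum>A\<in>?P. tree_sum A L1 k x1 y1 e1 * tree_sum (V - A) L2 k x2 y2 e2)"
    proof (rule sum.mono_neutral_right)
      show "\<forall>A\<in>Pow V - ?P. tree_sum A L1 k x1 y1 e1 * tree_sum (V - A) L2 k x2 y2 e2 = 0"
      proof
        fix A assume "A \<in> Pow V - ?P"
        then have "int (card A) \<noteq> r1" by auto
        then show "tree_sum A L1 k x1 y1 e1 * tree_sum (V - A) L2 k x2 y2 e2 = 0"
          using tree_sum_eq_0[OF L(1), of A e1] r1 by simp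
      qed
    qed (use V in auto)
    also have "\<dots> = (\<Sum>A\<in>?P. tree_sum V1 L1 k x1 y1 e1 * tree_sum V2 L2 k x2 y2 e2)"
    proof (rule sum.cong[OF refl])
      fix A assume A: "A \<in> ?P"
      have "card A = card V1" "card (V - A) = card V2"
        using A sub[of A] c r False by auto
      moreover have "finite A" "finite (V - A)" using A V(1) finite_subset by auto
      ultimately show "tree_sum A L1 k x1 y1 e1 * tree_sum (V - A) L2 k x2 y2 e2 =
          tree_sum V1 L1 k x1 y1 e1 * tree_sum V2 L2 k x2 y2 e2"
        using tree_sum_card_cong V by metis
    qed
    also have "\<dots> = real (card V choose nat r1) * (tree_sum V1 L1 k x1 y1 e1 * tree_sum V2 L2 k x2 y2 e2)"
      using n_subsets[OF V(1), of "nat r1"] by simp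
    also have "real (card V choose nat r1) = fact (card V) / (fact (nat r1) * fact (nat r2))"
    proof -
      have "card V - nat r1 = nat r2" "nat r1 \<le> card V" using r False by auto
      then show ?thesis using binomial_fact[of "nat r1" "card V", where 'a = real] by simp
    qed
    finally show ?thesis using False by simp
  qed
qed

section \<open>Covers as labelled trees\<close>

text \<open>
  Whenever the path returns to a vertex, the loop is dropped.
\<close>
lemma distinct_path:
  assumes "(u, w) \<in> {(a, b). {a, b} \<in> F}\<^sup>*"
  shows "\<exists>c. c \<noteq> [] \<and> hd c = u \<and> last c = w \<and> distinct c \<and>
    (\<forall>i. Suc i < length c \<longrightarrow> {c ! i, c ! Suc i} \<in> F)"
  using assms
proof (induction rule: rtrancl_induct)
  case base
  show ?case by (rule exI[of _ "[u]"]) simp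
next
  case (step w z)
  then obtain c where c: "c \<noteq> []" "hd c = u" "last c = w" "distinct c"
    "\<And>i. Suc i < length c \<Longrightarrow> {c ! i, c ! Suc i} \<in> F" by blast
  show ?case
  proof (cases "z \<in> set c")
    case True
    then obtain j where j: "j < length c" "c ! j = z" by (auto simp: in_set_conv_nth)
    let ?c = "take (Suc j) c"
    have "?c \<noteq> []" "hd ?c = u" "distinct ?c" using c by (auto simp: hd_take)
    moreover have "last ?c = z" using j by (simp add: take_Suc_conv_app_nth)
    moreover have "\<forall>i. Suc i < length ?c \<longrightarrow> {?c ! i, ?c ! Suc i} \<in> F" using c(5) by simp
    ultimately show ?thesis by blast
  next
    case False
    let ?c = "c @ [z]"
    have "{?c ! i, ?c ! Suc i} \<in> F" if "Suc i < length ?c" for i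
    proof (cases "Suc i < length c")
      case True
      then show ?thesis using c(5)[of i] by (simp add: nth_append)
    next
      case False
      then have "Suc i = length c" using that by simp
      then have "?c ! i = w" "?c ! Suc i = z"
        using c(1,3) by (auto simp: nth_append last_conv_nth simp flip: \<open>Suc i = length c\<close>)
      then show ?thesis using step.hyps by simp
    qed
    moreover have "?c \<noteq> []" "hd ?c = u" "last ?c = z" "distinct ?c" using c False by auto
    ultimately show ?thesis by blast
  qed
qed

text \<open>
  A cycle would cross the cut belonging to one of its edges a second time. Conversely, if an edge is not a
  bridge, a path joining its vertices without using it closes up to a cycle.
\<close>
lemma tree_iff_connected_acyclic:
  "tree V E \<longleftrightarrow> finite V \<and> V \<noteq> {} \<and> E \<subseteq> {{u, v} | u v. u \<in> V \<and> v \<in> V \<and> u \<noteq> v} \<and>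
     connected_graph V E \<and> \<not> has_cycle E"
proof (intro iffI conjI)
  assume t: "tree V E"
  show "finite V" "V \<noteq> {}" "E \<subseteq> {{u, v} | u v. u \<in> V \<and> v \<in> V \<and> u \<noteq> v}"
    using t by (auto simp: tree_def)
  show "connected_graph V E"
    unfolding connected_graph_def
  proof (intro ballI)
    fix u v assume u: "u \<in> V" and v: "v \<in> V"
    let ?R = "{(a, b). {a, b} \<in> E}" let ?A = "{w \<in> V. (u, w) \<in> ?R\<^sup>*}"
    have "?A = V"
    proof (rule ccontr)
      assume "?A \<noteq> V"
      then obtain a b where "a \<in> ?A" "b \<in> V - ?A" "{a, b} \<in> E"
        using tree_crossing[OF t, of ?A] u by blast
      moreover then have "(a, b) \<in> ?R" by simp
      ultimately show False by (auto intro: rtrancl_into_rtrancl)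
    qed
    then show "(u, v) \<in> ?R\<^sup>*" using v by blast
  qed
  show "\<not> has_cycle E"
  proof
    assume "has_cycle E"
    then obtain c where c: "length c \<ge> 3" "distinct c"
      and e: "\<And>i. i < length c \<Longrightarrow> {c ! i, c ! (Suc i mod length c)} \<in> E"
      by (auto simp: has_cycle_def)
    let ?n = "length c" let ?u = "c ! 0" let ?v = "c ! (?n - 1)"
    have "Suc (?n - 1) = ?n" using c(1) by simp
    then have "{?v, ?u} \<in> E" using e[of "?n - 1"] c(1) by simp
    then have "{?u, ?v} \<in> E" by (simp add: insert_commute)
    from is_cut_cut[OF t this] have cut: "is_cut V E ?u ?v (cut V E ?u ?v)" (is "is_cut _ _ _ _ ?A") .
    have "c ! i \<in> ?A" if "i < ?n" for i
      using that
    proof (induction i)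
      case 0
      show ?case using is_cutD[OF cut] by simp
    next
      case (Suc i)
      then have ed: "{c ! i, c ! Suc i} \<in> E" using e[of i] by simp
      show ?case
      proof (rule ccontr)
        assume "c ! Suc i \<notin> ?A"
        then have "c ! i = ?u" "c ! Suc i = ?v"
          using is_cut_crossing[OF cut _ _ _ ed] Suc tree_edgeD[OF t ed] by auto
        moreover have "c \<noteq> []" using c(1) by auto
        ultimately have "i = 0" "Suc i = ?n - 1"
          using nth_eq_iff_index_eq[OF c(2), of i 0] nth_eq_iff_index_eq[OF c(2), of "Suc i" "?n - 1"]
            Suc.prems c(1) by auto
        then show False using c(1) by simp
      qed
    qed
    then have "?v \<in> ?A" using c(1) by simp
    then show False using is_cutD[OF cut] by simp
  qed
next
  assume "finite V \<and> V \<noteq> {} \<and> E \<subseteq> {{u, v} | u v. u \<in> V \<and> v \<in> V \<and> u \<noteq> v} \<and>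
     connected_graph V E \<and> \<not> has_cycle E"
  then have V: "finite V" "V \<noteq> {}" and E: "E \<subseteq> {{u, v} | u v. u \<in> V \<and> v \<in> V \<and> u \<noteq> v}"
    and conn: "connected_graph V E" and acyc: "\<not> has_cycle E" by auto
  have EV: "u \<in> V \<and> v \<in> V \<and> u \<noteq> v" if "{u, v} \<in> E" for u v
    using E that by (fastforce simp: doubleton_eq_iff)
  show "tree V E" unfolding tree_def
  proof (intro conjI allI impI V E)
    fix A assume A: "A \<subseteq> V \<and> A \<noteq> {} \<and> A \<noteq> V"
    then obtain u v where u: "u \<in> A" and v: "v \<in> V" "v \<notin> A" by blast
    show "\<exists>a\<in>A. \<exists>b\<in>V - A. {a, b} \<in> E"
    proof (rule ccontr)
      assume no: "\<not> ?thesis"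
      have "w \<in> A" if "(u, w) \<in> {(a, b). {a, b} \<in> E}\<^sup>*" for w
        using that
      proof (induction rule: rtrancl_induct)
        case (step y z)
        then have "{y, z} \<in> E" by simp
        then show ?case using no step EV[of y z] by blast
      qed (rule u)
      moreover have "(u, v) \<in> {(a, b). {a, b} \<in> E}\<^sup>*"
        using conn A u v unfolding connected_graph_def by blast
      ultimately show False using v by blast
    qed
  next
    fix u v assume e: "{u, v} \<in> E"
    let ?F = "E - {{u, v}}" let ?A = "{w. (u, w) \<in> {(a, b). {a, b} \<in> ?F}\<^sup>*}"
    have vA: "v \<notin> ?A"
    proof
      assume "v \<in> ?A"
      then obtain c where c: "c \<noteq> []" "hd c = u" "last c = v" "distinct c"
        and p: "\<And>i. Suc i < length c \<Longrightarrow> {c ! i, c ! Suc i} \<in> ?F"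
        using distinct_path[of u v ?F] by blast
      have c0: "c ! 0 = u" and cn: "c ! (length c - 1) = v"
        using c by (auto simp: hd_conv_nth last_conv_nth)
      have l0: "length c \<noteq> 0" using c by simp
      have l1: "length c \<noteq> 1" using c0 cn EV[OF e] by auto
      have l2: "length c \<noteq> 2"
      proof
        assume "length c = 2"
        then show False using p[of 0] c0 cn by simp
      qed
      have len: "length c \<ge> 3" using l0 l1 l2 by linarith
      have "{c ! i, c ! (Suc i mod length c)} \<in> E" if i: "i < length c" for i
      proof (cases "Suc i < length c")
        case True
        then show ?thesis using p[of i] by simp
      next
        case False
        then have "Suc i = length c" using i by simp
        then have "c ! i = v" "Suc i mod length c = 0"
          using cn by (auto simp flip: \<open>Suc i = length c\<close>)
        then show ?thesis using e c0 by (simp add: insert_commute)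
      qed
      then have "has_cycle E" using len c(4) unfolding has_cycle_def by blast
      with acyc show False ..
    qed
    have AV: "?A \<subseteq> V"
    proof
      fix w assume "w \<in> ?A"
      then have "(u, w) \<in> {(a, b). {a, b} \<in> ?F}\<^sup>*" by simp
      then show "w \<in> V"
        by (induction rule: rtrancl_induct) (use EV e in auto)
    qed
    have "a = u \<and> b = v" if ab: "a \<in> ?A" "b \<in> V - ?A" "{a, b} \<in> E" for a b
    proof (cases "{a, b} = {u, v}")
      case True
      then show ?thesis using ab vA by (auto simp: doubleton_eq_iff)
    next
      case False
      then have "(a, b) \<in> {(a, b). {a, b} \<in> ?F}" using ab by simp
      then have "b \<in> ?A" using ab(1) by (auto intro: rtrancl_into_rtrancl)
      with ab show ?thesis by blast
    qed
    then have "is_cut V E u v ?A" using AV vA unfolding is_cut_def by blast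
    then show "\<exists>A. is_cut V E u v A" by blast
  qed
qed

lemma card_incident:
  assumes t: "tree V E"
  shows "card {d \<in> E. v \<in> d} = card (nbrs V E v)"
proof -
  have "{d \<in> E. v \<in> d} = (\<lambda>w. {v, w}) ` nbrs V E v"
  proof (intro equalityI subsetI)
    fix d assume d: "d \<in> {d \<in> E. v \<in> d}"
    then obtain a b where ab: "a \<in> V" "b \<in> V" "d = {a, b}" using tree_edgeE[OF t] by blast
    then have "v = a \<or> v = b" using d by auto
    then obtain w where "w \<in> V" "d = {v, w}" using ab by (metis insert_commute)
    then show "d \<in> (\<lambda>w. {v, w}) ` nbrs V E v" using d by (auto simp: nbrs_def)
  qed (auto simp: nbrs_def)
  moreover have "inj_on (\<lambda>w. {v, w}) (nbrs V E v)"
    by (rule inj_onI) (auto simp: doubleton_eq_iff)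
  ultimately show ?thesis by (simp add: card_image)
qed

text \<open>
  Ends pointing to the left have positive and ends pointing to the right have negative degree, so the ends
  contribute the sum of their degrees.
\<close>
lemma left_right_sum:
  fixes P :: "'a cover"
  assumes t: "tree (verts P) (edges P)" and L: "finite L"
    and ne: "\<And>w. {v, w} \<in> edges P \<Longrightarrow> pos P w \<noteq> pos P v"
  shows "left_sum L x P v - right_sum L x P v =
    (\<Sum>w\<in>nbrs (verts P) (edges P) v. if pos P w < pos P v then slope P {v, w} else - slope P {v, w}) +
    (\<Sum>i\<in>legs_at L (leg P) v. x i)"
proof -
  let ?N = "nbrs (verts P) (edges P) v" and ?J = "legs_at L (leg P) v"
  have fN: "finite ?N" by (rule nbrs_finite[OF t])
  have fJ: "finite ?J" using L by (simp add: legs_at_def)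
  have l: "{w. w \<in> verts P \<and> {v, w} \<in> edges P \<and> pos P w < pos P v} = {w \<in> ?N. pos P w < pos P v}"
    by (auto simp: nbrs_def)
  have r: "{w. w \<in> verts P \<and> {v, w} \<in> edges P \<and> pos P w > pos P v} = {w \<in> ?N. pos P v < pos P w}"
    by (auto simp: nbrs_def)
  have el: "{i. i \<in> ends_at L P v \<and> x i > 0} = {i \<in> ?J. x i > 0}"
    and er: "{i. i \<in> ends_at L P v \<and> x i < 0} = {i \<in> ?J. x i < 0}"
    by (auto simp: ends_at_def legs_at_def)
  have "(\<Sum>w\<in>?N. if pos P w < pos P v then slope P {v, w} else 0) -
      (\<Sum>w\<in>?N. if pos P v < pos P w then slope P {v, w} else 0) =
      (\<Sum>w\<in>?N. if pos P w < pos P v then slope P {v, w} else - slope P {v, w})"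
    unfolding sum_subtractf[symmetric]
    by (rule sum.cong[OF refl]) (use ne in \<open>force simp: nbrs_def\<close>)
  moreover have "(\<Sum>i\<in>?J. if x i > 0 then \<bar>x i\<bar> else 0) - (\<Sum>i\<in>?J. if x i < 0 then \<bar>x i\<bar> else 0) =
      (\<Sum>i\<in>?J. x i)"
    unfolding sum_subtractf[symmetric] by (rule sum.cong[OF refl]) auto
  ultimately show ?thesis
    unfolding left_sum_def right_sum_def l r el er
    by (simp only: sum.inter_filter[OF fN] sum.inter_filter[OF fJ])
qed

text \<open>
  For a relation that is the kernel of an invariant, the classes correspond to the values of the invariant.
\<close>
lemma sum_quotient_kernel:
  assumes r: "r = {(P, P'). P \<in> C \<and> P' \<in> C \<and> \<Phi> P = \<Phi> P'}" and W: "\<And>P. P \<in> C \<Longrightarrow> W P = w (\<Phi> P)"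
  shows "(\<Sum>K\<in>C // r. W (SOME P. P \<in> K)) = (\<Sum>t\<in>\<Phi> ` C. w t)"
proof -
  let ?F = "\<lambda>t. {P \<in> C. \<Phi> P = t}"
  have "r `` {P} = ?F (\<Phi> P)" if "P \<in> C" for P using that by (auto simp: r)
  then have "C // r = ?F ` \<Phi> ` C" by (auto simp: quotient_def)
  moreover have "inj_on ?F (\<Phi> ` C)" by (rule inj_onI) blast
  moreover have "W (SOME P. P \<in> ?F t) = w t" if "t \<in> \<Phi> ` C" for t
  proof -
    have "(SOME P. P \<in> ?F t) \<in> ?F t" by (rule someI_ex) (use that in blast)
    then show ?thesis using W by auto
  qed
  ultimately show ?thesis by (simp add: sum.reindex)
qed

text \<open>
  The source of a cover with every vertex replaced by its position; a complete invariant of covers by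
  \<open>cover_iso_iff\<close>.
\<close>
definition ordered_type :: "'a set \<Rightarrow> 'a cover \<Rightarrow> real set set \<times> ('a \<Rightarrow> real)" where
  "ordered_type L P = relabel (pos P) L (edges P, restrict (leg P) L)"

lemma legs_at_restrict: "legs_at L (restrict l L) v = legs_at L l v"
  by (auto simp: legs_at_def)

context
  fixes T :: "real set" and k :: int and L :: "'a set" and x :: "'a \<Rightarrow> real" and e :: "'a \<Rightarrow> nat"
  assumes L: "finite L" and T: "finite T"
    and cT: "card T = nat (int (card L) - 2 - int (\<Sum>i\<in>L. e i))"
    and x: "(\<Sum>i\<in>L. x i) = of_int k * (real (card L) - 2)"
begin

context
  fixes P :: "'a cover"
  assumes P: "P \<in> covers T k L x e"
begin

lemma coverD:
  shows "rational_curve L P" "v \<in> verts P \<Longrightarrow> pos P v \<in> T" "d \<in> edges P \<Longrightarrow> slope P d > 0"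
    "{u, v} \<in> edges P \<Longrightarrow> \<bar>pos P u - pos P v\<bar> = slope P {u, v} * len P {u, v}"
    "v \<in> verts P \<Longrightarrow> left_sum L x P v - right_sum L x P v = of_int k * (real (val L P v) - 2)"
    "t \<in> T \<Longrightarrow> \<exists>v\<in>verts P. pos P v = t"
    "v \<in> verts P \<Longrightarrow> val L P v = (\<Sum>i\<in>ends_at L P v. e i) + 3"
  using P by (auto simp: covers_def leaky_cover_def stable_cover_def psi_conditions_def)

lemma cover_tree: "tree (verts P) (edges P)"
  using coverD(1) by (simp add: tree_iff_connected_acyclic rational_curve_def)

lemma cover_val: "val L P v = card (nbrs (verts P) (edges P) v) + card (legs_at L (leg P) v)"
  by (simp add: val_def card_incident[OF cover_tree] ends_at_def legs_at_def)

lemma cover_legs: "i \<in> L \<Longrightarrow> leg P i \<in> verts P"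
  using coverD(1) by (simp add: rational_curve_def)

lemma cover_labelled_tree: "(edges P, restrict (leg P) L) \<in> labelled_trees (verts P) L e"
  using cover_tree cover_legs coverD(7)
  by (simp add: labelled_trees_def legs_at_restrict cover_val[symmetric])
     (simp add: ends_at_def legs_at_def)

text \<open>
  Stability makes the positions surjective, and by \<open>labelled_trees_card\<close> there are as many
  vertices as points of \<open>T\<close>.
\<close>
lemma cover_pos: "inj_on (pos P) (verts P)" "pos P ` verts P = T"
proof -
  show "pos P ` verts P = T" using coverD(2,6) by blast
  moreover have "card (verts P) = card T"
    using labelled_trees_card[OF cover_labelled_tree L] cT by linarith
  ultimately show "inj_on (pos P) (verts P)"
    using tree_finite[OF cover_tree] by (simp add: eq_card_imp_inj_on)
qed

lemma ordered_type_in: "ordered_type L P \<in> labelled_trees T L e"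
  using relabel_labelled_tree[OF cover_labelled_tree cover_pos(1)] by (simp add: ordered_type_def cover_pos(2))

lemma pos_edge: "{u, v} \<in> edges P \<Longrightarrow> pos P u \<noteq> pos P v"
  using cover_pos(1) tree_edgeD[OF cover_tree] by (metis inj_onD)

text \<open>
  The expansion factors, with a sign for the direction, satisfy the leaky conditions, whose solution is
  unique.
\<close>
lemma slope_branch_flow:
  assumes e: "{u, v} \<in> edges P" and less: "pos P u < pos P v"
  shows "slope P {u, v} = branch_flow (verts P) L k x (edges P) (restrict (leg P) L) u v"
proof -
  let ?\<phi> = "\<lambda>u v. if pos P u < pos P v then slope P {u, v} else - slope P {u, v}"
  have "?\<phi> u v = branch_flow (verts P) L k x (edges P) (restrict (leg P) L) u v"
  proof (rule balanced_unique[OF cover_tree _ L _ _ e])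
    show "restrict (leg P) L \<in> L \<rightarrow> verts P" using cover_legs by auto
    show "?\<phi> v u = - ?\<phi> u v" if "{u, v} \<in> edges P" for u v
      using pos_edge[OF that] by (simp add: insert_commute)
    show "(\<Sum>w\<in>nbrs (verts P) (edges P) v. ?\<phi> w v) + (\<Sum>i\<in>legs_at L (restrict (leg P) L) v. x i) =
       of_int k * (real (card (nbrs (verts P) (edges P) v)) +
         real (card (legs_at L (restrict (leg P) L) v)) - 2)" if v: "v \<in> verts P" for v
    proof -
      have "pos P w \<noteq> pos P v" if "{v, w} \<in> edges P" for w using pos_edge[OF that] by simp
      then have "left_sum L x P v - right_sum L x P v =
        (\<Sum>w\<in>nbrs (verts P) (edges P) v. ?\<phi> w v) + (\<Sum>i\<in>legs_at L (leg P) v. x i)"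
        unfolding insert_commute[of _ v "{}"] by (rule left_right_sum[OF cover_tree L])
      then show ?thesis using coverD(5)[OF v] by (simp add: legs_at_restrict cover_val)
    qed
  qed
  with less show ?thesis by simp
qed

lemma edge_flow_ordered_type:
  assumes d: "d \<in> edges P"
  shows "edge_flow T L k x (ordered_type L P) (pos P ` d) = slope P d"
proof -
  obtain a b where ab: "d = {a, b}" using tree_edgeE[OF cover_tree d] by metis
  have "pos P a \<noteq> pos P b" using pos_edge d ab by blast
  then obtain u v where uv: "d = {u, v}" "pos P u < pos P v"
    using ab by (metis insert_commute linorder_neqE)
  have e: "{u, v} \<in> edges P" using d uv by simp
  have "Min (pos P ` d) = pos P u" "Max (pos P ` d) = pos P v" using uv by auto
  then show ?thesis
    using branch_flow_relabel[OF cover_labelled_tree cover_pos(1) e, of k x]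
      slope_branch_flow[OF e uv(2)] uv(1)
    by (simp add: edge_flow_def ordered_type_def relabel_def cover_pos(2))
qed

lemma rightward_ordered_type: "rightward T L k x (ordered_type L P)"
  unfolding rightward_def using edge_flow_ordered_type coverD(3)
  by (auto simp: ordered_type_def relabel_def)

lemma Aut_cover: "Aut L P = {id}"
proof (intro equalityI subsetI)
  fix f assume "f \<in> Aut L P"
  then have f: "f permutes verts P" "\<And>v. v \<in> verts P \<Longrightarrow> pos P (f v) = pos P v"
    by (auto simp: Aut_def cover_iso_def)
  have "f v = v" for v
  proof (cases "v \<in> verts P")
    case True
    then show ?thesis
      using f(2)[OF True] cover_pos(1) permutes_in_image[OF f(1)] by (metis inj_onD)
  next
    case False
    then show ?thesis using f(1) by (simp add: permutes_not_in)
  qed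
  then show "f \<in> {id}" by auto
qed (auto simp: Aut_def cover_iso_def permutes_id)

lemma cover_weight_ordered_type: "cover_weight L e P = tree_weight T L k x e (ordered_type L P)"
proof -
  have "(\<Prod>d\<in>fst (ordered_type L P). edge_flow T L k x (ordered_type L P) d) = (\<Prod>d\<in>edges P. slope P d)"
    using prod_edges_relabel[OF cover_labelled_tree cover_pos(1), of "edge_flow T L k x (ordered_type L P)"]
    by (simp add: edge_flow_ordered_type flip: ordered_type_def)
  moreover have "(\<Prod>v\<in>T. vertex_weight L e (snd (ordered_type L P)) v) =
      (\<Prod>v\<in>verts P. vertex_mult L e P v)"
  proof -
    have "vertex_weight L e (restrict (leg P) L) v = vertex_mult L e P v" if "v \<in> verts P" for v
      using coverD(7)[OF that]
      by (simp add: vertex_weight_def vertex_mult_def legs_at_restrict)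
         (simp add: legs_at_def ends_at_def)
    then show ?thesis
      using prod_vertices_relabel[OF cover_labelled_tree cover_pos(1)]
      by (simp add: cover_pos(2) flip: ordered_type_def)
  qed
  ultimately show ?thesis by (simp add: cover_weight_def tree_weight_def Aut_cover)
qed

end

text \<open>
  If the ordered types agree, vertices with the same position correspond to each other. The expansion factors
  agree as they are flows on the same tree, and the lengths agree because expansion factors and positions do.
\<close>
lemma cover_iso_iff:
  assumes P: "P \<in> covers T k L x e" and P': "P' \<in> covers T k L x e"
  shows "(\<exists>f. cover_iso L P P' f) \<longleftrightarrow> ordered_type L P = ordered_type L P'"
proof
  have sub: "d \<subseteq> verts P" if "d \<in> edges P" for d
    using tree_edgeE[OF cover_tree[OF P] that] by blast
  have sub': "d \<subseteq> verts P'" if "d \<in> edges P'" for d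
    using tree_edgeE[OF cover_tree[OF P'] that] by blast
  {
    assume "\<exists>f. cover_iso L P P' f"
    then obtain f where f: "bij_betw f (verts P) (verts P')" "edges P' = (`) f ` edges P"
      "\<And>i. i \<in> L \<Longrightarrow> leg P' i = f (leg P i)" "\<And>v. v \<in> verts P \<Longrightarrow> pos P' (f v) = pos P v"
      by (auto simp: cover_iso_def)
    have "pos P' ` f ` d = pos P ` d" if "d \<in> edges P" for d
      unfolding image_image using sub[OF that] f(4) by (intro image_cong) auto
    then have "(`) (pos P') ` edges P' = (`) (pos P) ` edges P"
      unfolding f(2) image_image[of "(`) (pos P')"] by (rule image_cong[OF refl])
    moreover have "restrict (pos P' \<circ> restrict (leg P') L) L = restrict (pos P \<circ> restrict (leg P) L) L"
      using f(3,4) cover_legs[OF P] by (intro restrict_ext) simp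
    ultimately show "ordered_type L P = ordered_type L P'" by (simp add: ordered_type_def relabel_def)
  }
  assume eq: "ordered_type L P = ordered_type L P'"
  define g where "g = the_inv_into (verts P') (pos P')"
  define f where "f = g \<circ> pos P"
  note inj = cover_pos(1)[OF P] and inj' = cover_pos(1)[OF P']
  have img: "pos P ` verts P = pos P' ` verts P'" using cover_pos(2) P P' by simp
  have gp: "g (pos P' v) = v" if "v \<in> verts P'" for v
    unfolding g_def by (rule the_inv_into_f_f[OF inj' that])
  have pg: "pos P' (g t) = t" if "t \<in> pos P' ` verts P'" for t
    unfolding g_def by (rule f_the_inv_into_f[OF inj' that])
  have pf: "pos P' (f v) = pos P v" if "v \<in> verts P" for v
    using pg[of "pos P v"] that img by (auto simp: f_def)
  have bij: "bij_betw f (verts P) (verts P')"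
  proof -
    have "bij_betw g (pos P' ` verts P') (verts P')"
      unfolding g_def using bij_betw_the_inv_into[OF inj_on_imp_bij_betw[OF inj']] .
    then show ?thesis unfolding f_def
      using bij_betw_trans[OF inj_on_imp_bij_betw[OF inj]] img by metis
  qed
  have pfd: "pos P' ` f ` d = pos P ` d" if "d \<in> edges P" for d
    unfolding image_image using sub[OF that] pf by (intro image_cong) auto
  have edges: "edges P' = (`) f ` edges P"
  proof -
    have E: "(`) (pos P') ` edges P' = (`) (pos P) ` edges P"
      using eq by (simp add: ordered_type_def relabel_def)
    have "g ` pos P' ` d = d" if "d \<in> edges P'" for d
      unfolding image_image using sub'[OF that] gp by (auto simp: image_iff subset_iff) 
    then have "edges P' = (`) g ` (`) (pos P') ` edges P'"
      unfolding image_image[of "(`) g"] by simp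
    also have "\<dots> = (`) f ` edges P" unfolding E f_def by (simp add: image_image)
    finally show ?thesis .
  qed
  have slope: "slope P' (f ` d) = slope P d" if d: "d \<in> edges P" for d
  proof -
    have "f ` d \<in> edges P'" using d edges by simp
    then have "slope P' (f ` d) = edge_flow T L k x (ordered_type L P') (pos P' ` f ` d)"
      by (simp add: edge_flow_ordered_type[OF P'])
    then show ?thesis by (simp add: pfd[OF d] eq[symmetric] edge_flow_ordered_type[OF P d])
  qed
  have "cover_iso L P P' f"
    unfolding cover_iso_def
  proof (intro conjI ballI bij edges slope pf)
    fix i assume i: "i \<in> L"
    have "snd (ordered_type L P) i = snd (ordered_type L P') i" by (simp add: eq)
    then have "pos P (leg P i) = pos P' (leg P' i)" using i by (simp add: ordered_type_def relabel_def)
    then show "leg P' i = f (leg P i)" using gp[OF cover_legs[OF P' i]] by (simp add: f_def)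
  next
    fix d assume d: "d \<in> edges P"
    obtain u v where uv: "u \<in> verts P" "v \<in> verts P" "d = {u, v}"
      using tree_edgeE[OF cover_tree[OF P] d] by metis
    have "f ` d \<in> edges P'" using d edges by simp
    then have fd: "{f u, f v} \<in> edges P'" using uv by simp
    have "slope P d * len P' (f ` d) = slope P d * len P d"
      using coverD(4)[OF P, of u v] coverD(4)[OF P' fd] slope[OF d] d uv pf by simp
    then show "len P' (f ` d) = len P d" using coverD(3)[OF P d] by simp
  qed
  then show "\<exists>f. cover_iso L P P' f" by blast
qed

text \<open>
  The vertices of \<open>t\<close> are points of \<open>T\<close>, those of a cover are natural numbers, so
  the vertices are enumerated first. Expansion factors are given by the flow and the lengths by the positions.
\<close>
lemma ordered_type_surj:
  assumes t: "t \<in> labelled_trees T L e" and pos: "rightward T L k x t"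
  shows "\<exists>P \<in> covers T k L x e. ordered_type L P = t"
proof -
  obtain g where g: "bij_betw g {..<card T} T" using ex_order_enumeration[OF T] by blast
  define V where "V = {..<card T}"
  have inj: "inj_on g V" and gV: "g ` V = T" using g by (auto simp: bij_betw_def V_def)
  define h where "h = the_inv_into V g"
  have gh: "g (h y) = y" if "y \<in> T" for y
    using f_the_inv_into_f[OF inj] that gV by (auto simp: h_def)
  have hT: "h ` T = V" and injh: "inj_on h T"
    using the_inv_into_onto[OF inj] inj_on_the_inv_into[OF inj] by (auto simp: h_def gV)
  obtain E l where El: "relabel h L t = (E, l)" by (cases "relabel h L t")
  have t': "(E, l) \<in> labelled_trees V L e" using relabel_labelled_tree[OF t injh] by (simp add: El hT)
  note D = labelled_treesD[OF t']
  have gt: "relabel g L (E, l) = t" using relabel_relabel[OF t, of g h] gh El by simp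
  define P where "P = \<lparr>verts = V, edges = E, leg = l,
    len = (\<lambda>d. (Max (g ` d) - Min (g ` d)) / edge_flow T L k x t (g ` d)),
    slope = (\<lambda>d. edge_flow T L k x t (g ` d)), pos = g\<rparr>"
  have sel [simp]: "verts P = V" "edges P = E" "leg P = l" "pos P = g"
    "slope P d = edge_flow T L k x t (g ` d)"
    "len P d = (Max (g ` d) - Min (g ` d)) / edge_flow T L k x t (g ` d)" for d
    by (simp_all add: P_def)
  have rl: "restrict l L = l" using D(2) by (simp add: PiE_def extensional_restrict)
  have ot: "ordered_type L P = t" by (simp add: ordered_type_def rl gt)
  have flow_pos: "edge_flow T L k x t (g ` d) > 0" if "d \<in> E" for d
    using pos that gt by (auto simp: rightward_def relabel_def)
  have ne: "g u \<noteq> g v" if "{u, v} \<in> E" for u v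
    using tree_edgeD[OF D(1) that] inj by (auto dest: inj_onD)
  have flow: "(if g u < g v then edge_flow T L k x t (g ` {u, v}) else - edge_flow T L k x t (g ` {u, v})) =
      branch_flow V L k x E l u v" if e: "{u, v} \<in> E" for u v
  proof -
    have e': "{v, u} \<in> E" using e by (simp add: insert_commute)
    have tr: "fst t = (`) g ` E" "snd t = restrict (g \<circ> l) L"
      using gt by (auto simp: relabel_def)
    have bf: "branch_flow T L k x (fst t) (snd t) (g u) (g v) = branch_flow V L k x E l u v"
      if "{u, v} \<in> E" for u v
      unfolding tr gV[symmetric] by (rule branch_flow_relabel[OF t' inj that])
    show ?thesis
    proof (cases "g u < g v")
      case True
      then have "Min (g ` {u, v}) = g u" "Max (g ` {u, v}) = g v" by auto
      with True show ?thesis by (simp add: edge_flow_def bf[OF e])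
    next
      case False
      then have "g v < g u" using ne[OF e] by simp
      then have "Min (g ` {u, v}) = g v" "Max (g ` {u, v}) = g u" by auto
      with False show ?thesis
        using branch_flow_swap[OF D(1) e D(3) L x] by (simp add: edge_flow_def bf[OF e'])
    qed
  qed
  have val: "val L P v = card (nbrs V E v) + card (legs_at L l v)" for v
    using card_incident[OF D(1)] by (simp add: val_def ends_at_def legs_at_def)
  have psi: "val L P v = (\<Sum>i\<in>ends_at L P v. e i) + 3" if "v \<in> V" for v
    using D(4)[OF that] by (simp add: val) (simp add: ends_at_def legs_at_def)
  have bal: "left_sum L x P v - right_sum L x P v = of_int k * (real (val L P v) - 2)" if v: "v \<in> V" for v
  proof -
    have "left_sum L x P v - right_sum L x P v =
      (\<Sum>w\<in>nbrs V E v. if g w < g v then edge_flow T L k x t (g ` {v, w}) else - edge_flow T L k x t (g ` {v, w})) +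
      (\<Sum>i\<in>legs_at L l v. x i)"
    proof -
      have "pos P w \<noteq> pos P v" if "{v, w} \<in> edges P" for w using ne[of v w] that by simp
      from left_right_sum[of P L v x, OF _ L this] D(1) show ?thesis unfolding sel by blast
    qed
    also have "(\<Sum>w\<in>nbrs V E v. if g w < g v then edge_flow T L k x t (g ` {v, w}) else - edge_flow T L k x t (g ` {v, w})) =
      (\<Sum>w\<in>nbrs V E v. branch_flow V L k x E l w v)"
    proof (rule sum.cong[OF refl])
      fix w assume "w \<in> nbrs V E v"
      then have "{w, v} \<in> E" by (simp add: nbrs_def insert_commute)
      from flow[OF this]
      show "(if g w < g v then edge_flow T L k x t (g ` {v, w}) else - edge_flow T L k x t (g ` {v, w})) =
          branch_flow V L k x E l w v"
        unfolding insert_commute[of w v "{}"] .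
    qed
    finally show ?thesis
      using branch_flow_balanced[OF D(1) D(3) L v x] by (simp add: val)
  qed
  have metric: "\<bar>g u - g v\<bar> = edge_flow T L k x t (g ` {u, v}) *
      ((Max (g ` {u, v}) - Min (g ` {u, v})) / edge_flow T L k x t (g ` {u, v}))" if "{u, v} \<in> E" for u v
    using flow_pos[OF that] by (simp add: max_def min_def)
  have len: "(Max (g ` d) - Min (g ` d)) / edge_flow T L k x t (g ` d) > 0" if d: "d \<in> E" for d
  proof -
    obtain u v where uv: "d = {u, v}" using tree_edgeE[OF D(1) d] by metis
    then have "g u \<noteq> g v" using ne d by simp
    then have "Max (g ` d) - Min (g ` d) > 0" using uv by (auto simp: max_def min_def)
    then show ?thesis using flow_pos[OF d] by simp
  qed
  have "rational_curve L P"
    unfolding rational_curve_def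
    using D(1)[unfolded tree_iff_connected_acyclic] len D(3) psi by auto
  then have "leaky_cover T k L x P"
    using gV flow_pos metric bal by (auto simp: leaky_cover_def)
  moreover have "stable_cover T L P"
  proof -
    have "\<exists>v\<in>V. g v = y \<and> val L P v > 2" if "y \<in> T" for y
    proof -
      obtain v where "v \<in> V" "g v = y" using \<open>y \<in> T\<close> gV by blast
      then show ?thesis using psi[of v] by auto
    qed
    then show ?thesis by (simp add: stable_cover_def)
  qed
  moreover have "psi_conditions L e P" using psi by (simp add: psi_conditions_def)
  ultimately show ?thesis using ot by (auto simp: covers_def)
qed

lemma H0_trop_eq_tree_sum: "H0_trop T k L x e = tree_sum T L k x x e"
proof -
  let ?C = "covers T k L x e"
  have img: "ordered_type L ` ?C = {t \<in> labelled_trees T L e. rightward T L k x t}"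
    using ordered_type_in rightward_ordered_type ordered_type_surj by (auto; force)
  have rel: "iso_rel L ?C = {(P, P'). P \<in> ?C \<and> P' \<in> ?C \<and> ordered_type L P = ordered_type L P'}"
    using cover_iso_iff by (auto simp: iso_rel_def)
  have "H0_trop T k L x e = (\<Sum>t\<in>ordered_type L ` ?C. tree_weight T L k x e t)"
    unfolding H0_trop_def using cover_weight_ordered_type
    by (intro sum_quotient_kernel[OF rel]) blast
  also have "\<dots> = tree_sum T L k x x e"
    unfolding img tree_sum_def
    by (subst sum.inter_filter[OF finite_labelled_trees[OF L T]]) (intro sum.cong refl, simp)
  finally show ?thesis .
qed

end

section \<open>Chambers and polynomial expressions\<close>

lemma wall_form_eq_leaky_flow: "wall_form k J x = leaky_flow k (($) x) J"
  by (simp add: wall_form_def leaky_flow_def)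

lemma leaky_space_sum:
  fixes x :: "real ^ 'n"
  shows "x \<in> leaky_space k \<longleftrightarrow> (\<Sum>i\<in>UNIV. x $ i) = of_int k * (real (card (UNIV :: 'n set)) - 2)"
  by (simp add: leaky_space_def)

definition proper_walls :: "'n::finite set set" where
  "proper_walls = {J. 2 \<le> card J \<and> card J \<le> CARD('n) - 2}"

lemma wall_form_add:
  "wall_form k J (x + t *\<^sub>R h) = wall_form k J x + t * (\<Sum>i\<in>J. h $ i)"
  by (simp add: wall_form_def sum.distrib sum_distrib_left)

lemma continuous_wall_form: "continuous_on S (wall_form k J)"
  unfolding wall_form_def by (intro continuous_intros)

lemma chamber_nonzero:
  assumes "C \<in> chambers k" "J \<in> proper_walls" "x \<in> C"
  shows "wall_form k J x \<noteq> 0"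
  using assms in_components_subset[of C] unfolding chambers_def proper_walls_def wall_def by fastforce

lemma chamber_leaky: "C \<in> chambers k \<Longrightarrow> x \<in> C \<Longrightarrow> x \<in> leaky_space k"
  using in_components_subset[of C] unfolding chambers_def by fastforce

lemma chamber_sgn:
  assumes C: "C \<in> chambers k" and J: "J \<in> proper_walls" and x: "x \<in> C" and y: "y \<in> C"
  shows "sgn (wall_form k J x) = sgn (wall_form k J y)"
proof -
  have "connected (wall_form k J ` C)"
    using C in_components_connected[of C] unfolding chambers_def
    by (intro connected_continuous_image continuous_wall_form) blast
  then have iv: "0 \<in> wall_form k J ` C"
    if "a \<in> C" "b \<in> C" "wall_form k J a \<le> 0" "0 \<le> wall_form k J b" for a b
    using that connectedD_interval[of "wall_form k J ` C"] by blast
  have "0 \<notin> wall_form k J ` C" using chamber_nonzero[OF C J] by fastforce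
  then show ?thesis using iv[OF x y] iv[OF y x] by (auto simp: sgn_if)
qed

text \<open>
  The sign at \<open>q\<close> persists in a neighbourhood of \<open>q\<close>, which meets the chamber.
\<close>
lemma closure_chamber_sgn:
  assumes C: "C \<in> chambers k" and J: "J \<in> proper_walls" and x: "x \<in> C"
    and q: "q \<in> closure C" "wall_form k J q \<noteq> 0"
  shows "sgn (wall_form k J x) = sgn (wall_form k J q)"
proof -
  let ?U = "{z. wall_form k J z * wall_form k J q > 0}"
  have "open ?U"
    by (intro open_Collect_less continuous_intros continuous_wall_form)
  moreover have "q \<in> ?U" using q(2) by (auto simp: zero_less_mult_iff linorder_neq_iff)
  ultimately have "?U \<inter> C \<noteq> {}" using q(1) open_Int_closure_eq_empty by blast
  then obtain z where z: "z \<in> C" "wall_form k J z * wall_form k J q > 0" by blast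
  then have "sgn (wall_form k J z) = sgn (wall_form k J q)"
    by (auto simp: zero_less_mult_iff)
  then show ?thesis using chamber_sgn[OF C J x z(1)] by simp
qed

text \<open>
  The closures of the two chambers share a point of the wall of \<open>I\<close> that does not lie on the wall
  of \<open>J\<close>. To find it, move along the wall of \<open>I\<close> from some \<open>i\<close> in
  \<open>J\<close> to some \<open>j\<close> outside of \<open>J\<close> that lies on the same side of the
  partition into \<open>I\<close> and \<open>- I\<close>. Such a pair exists unless \<open>J\<close> is one of
  \<open>I\<close> and \<open>- I\<close>.
\<close>
lemma adjacent_sgn:
  fixes C1 C2 :: "(real ^ 'n) set"
  assumes C1: "C1 \<in> chambers k" and C2: "C2 \<in> chambers k" and J: "J \<in> proper_walls"
    and JI: "J \<noteq> I" "J \<noteq> - I" and adj: "adjacent_along (wall k I) C1 C2"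
    and x: "x \<in> C1" and y: "y \<in> C2"
  shows "sgn (wall_form k J x) = sgn (wall_form k J y)"
proof -
  obtain p \<epsilon> where p: "p \<in> wall k I" and \<epsilon>: "\<epsilon> > 0"
    and sub: "wall k I \<inter> ball p \<epsilon> \<subseteq> closure C1 \<inter> closure C2"
    using adj unfolding adjacent_along_def by blast
  have "\<exists>q \<in> wall k I \<inter> ball p \<epsilon>. wall_form k J q \<noteq> 0"
  proof (cases "wall_form k J p = 0")
    case False
    then show ?thesis using p \<epsilon> by auto
  next
    case True
    have "J \<noteq> {}" "J \<noteq> UNIV" using J by (auto simp: proper_walls_def)
    then obtain i j where ij: "i \<in> J" "j \<notin> J" "i \<in> I \<longleftrightarrow> j \<in> I" using JI by blast
    define h :: "real ^ 'n" where "h = axis i 1 - axis j 1"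
    have hs: "(\<Sum>l\<in>K. h $ l) = of_bool (i \<in> K) - of_bool (j \<in> K)" for K
      by (simp add: h_def axis_def sum_subtractf sum.delta)
    have "norm h \<le> 2"
      unfolding h_def using norm_triangle_ineq4[of "axis i 1 :: real ^ 'n" "axis j 1"]
      by simp
    define q where "q = p + (\<epsilon> / 4) *\<^sub>R h"
    have "norm ((\<epsilon> / 4) *\<^sub>R h) < \<epsilon>" using \<open>norm h \<le> 2\<close> \<epsilon> by simp
    then have "q \<in> ball p \<epsilon>" by (simp add: q_def dist_norm)
    moreover have "wall_form k I q = 0" using p ij by (simp add: q_def wall_form_add hs wall_def)
    moreover have "(\<Sum>l\<in>UNIV. q $ l) = (\<Sum>l\<in>UNIV. p $ l) + \<epsilon> / 4 * (\<Sum>l\<in>UNIV. h $ l)"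
      by (simp add: q_def sum.distrib sum_distrib_left)
    then have "q \<in> leaky_space k"
      using p hs[of UNIV] by (simp add: leaky_space_def wall_def)
    moreover have "wall_form k J q \<noteq> 0" using True ij \<epsilon> by (simp add: q_def wall_form_add hs)
    ultimately show ?thesis by (auto simp: wall_def)
  qed
  then obtain q where q: "q \<in> closure C1" "q \<in> closure C2" "wall_form k J q \<noteq> 0" using sub by blast
  show ?thesis
    using closure_chamber_sgn[OF C1 J x q(1,3)] closure_chamber_sgn[OF C2 J y q(2,3)] by simp
qed

text \<open>
  A short segment inside \<open>leaky_space k\<close> avoids the finitely many walls, and it is connected.
\<close>
lemma chamber_segment:
  fixes C :: "(real ^ 'n) set"
  assumes C: "C \<in> chambers k" and x: "x \<in> C" and y: "y \<in> leaky_space k"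
  obtains \<tau> where "\<tau> > 0" "\<And>t. 0 \<le> t \<Longrightarrow> t \<le> \<tau> \<Longrightarrow> x + t *\<^sub>R (y - x) \<in> C"
proof -
  let ?W = "proper_walls :: 'n set set"
  let ?U = "\<Inter>J\<in>?W. {z. wall_form k J z \<noteq> 0}"
  have "open ?U"
    by (intro open_INT ballI open_Collect_neq continuous_wall_form continuous_on_const) simp
  moreover have "x \<in> ?U" using chamber_nonzero[OF C _ x] by blast
  ultimately obtain \<epsilon> where \<epsilon>: "\<epsilon> > 0" "ball x \<epsilon> \<subseteq> ?U" using open_contains_ball by blast
  \<comment> \<open>The summand 1 covers the case \<open>y = x\<close>.\<close>
  define \<tau> where "\<tau> = \<epsilon> / (norm (y - x) + 1)"
  have n: "norm (y - x) + 1 > 0" by (simp add: add_nonneg_pos)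
  have \<tau>: "\<tau> > 0" unfolding \<tau>_def using \<epsilon>(1) n by simp
  let ?f = "\<lambda>t. x + t *\<^sub>R (y - x)"
  have xl: "x \<in> leaky_space k" by (rule chamber_leaky[OF C x])
  have "?f t \<in> leaky_space k - (\<Union>J \<in> {J. 2 \<le> card J \<and> card J \<le> CARD('n) - 2}. wall k J)"
    if t: "0 \<le> t" "t \<le> \<tau>" for t
  proof -
    have "t * norm (y - x) \<le> \<tau> * norm (y - x)" using t by (intro mult_right_mono) auto
    also have "\<dots> < \<tau> * (norm (y - x) + 1)" using \<tau> by simp
    also have "\<dots> = \<epsilon>" using n by (simp add: \<tau>_def)
    finally have "?f t \<in> ball x \<epsilon>" using t by (simp add: dist_norm)
    then have "?f t \<in> ?U" using \<epsilon>(2) by blast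
    moreover have "?f t \<in> leaky_space k"
      using xl y by (simp add: leaky_space_def sum.distrib sum_subtractf flip: sum_distrib_left)
    ultimately show ?thesis by (auto simp: wall_def proper_walls_def)
  qed
  then have "?f ` {0..\<tau>} \<subseteq> leaky_space k - (\<Union>J \<in> {J. 2 \<le> card J \<and> card J \<le> CARD('n) - 2}. wall k J)"
    by auto
  moreover have "connected (?f ` {0..\<tau>})"
    by (intro connected_continuous_image continuous_intros connected_Icc)
  moreover have "C \<inter> ?f ` {0..\<tau>} \<noteq> {}"
  proof -
    have "?f 0 \<in> C" "?f 0 \<in> ?f ` {0..\<tau>}" using x \<tau> by auto
    then show ?thesis by blast
  qed
  ultimately have "?f ` {0..\<tau>} \<subseteq> C"
    using C unfolding chambers_def by (meson components_maximal)
  then show ?thesis by (intro that[OF \<tau>]) (simp add: image_subset_iff)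
qed

text \<open>
  On the line from a point of the chamber to \<open>y\<close> the two polynomials agree on an interval, hence
  everywhere.
\<close>
lemma polynomial_eq_on_leaky_space:
  fixes C :: "(real ^ 'n) set"
  assumes C: "C \<in> chambers k"
    and p: "real_polynomial_function p" and q: "real_polynomial_function q"
    and eq: "\<And>x. x \<in> C \<Longrightarrow> p x = q x" and y: "y \<in> leaky_space k"
  shows "p y = q y"
proof -
  obtain x where x: "x \<in> C" using C in_components_nonempty unfolding chambers_def by blast
  obtain \<tau> where \<tau>: "\<tau> > 0" "\<And>t. 0 \<le> t \<Longrightarrow> t \<le> \<tau> \<Longrightarrow> x + t *\<^sub>R (y - x) \<in> C"
    using chamber_segment[OF C x y] by blast
  let ?f = "\<lambda>t::real. x + t *\<^sub>R (y - x)"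
  let ?h = "\<lambda>t. p (?f t) - q (?f t)"
  have "polynomial_function ?f"
    by (intro polynomial_function_add polynomial_function_const polynomial_function_mult polynomial_function_id)
  then have "real_polynomial_function (p \<circ> ?f)" "real_polynomial_function (q \<circ> ?f)"
    using real_polynomial_function_compose p q by blast+
  then have "real_polynomial_function ?h"
    unfolding o_def by (rule real_polynomial_function_diff)
  then obtain a n where h: "?h = (\<lambda>t. \<Sum>i\<le>n. a i * t ^ i)"
    unfolding real_polynomial_function_iff_sum by blast
  have "{0..\<tau>} \<subseteq> {t. (\<Sum>i\<le>n. a i * t ^ i) = 0}"
  proof
    fix t assume "t \<in> {0..\<tau>}"
    then have "?h t = 0" using \<tau>(2)[of t] eq by simp
    then show "t \<in> {t. (\<Sum>i\<le>n. a i * t ^ i) = 0}" using fun_cong[OF h, of t] by simp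
  qed
  then have "infinite {t. (\<Sum>i\<le>n. a i * t ^ i) = 0}"
    using infinite_Icc[OF \<tau>(1)] finite_subset by blast
  then have "\<And>i. i \<le> n \<Longrightarrow> a i = 0" using polyfun_rootbound[where c = a and n = n] by blast
  then have "?h 1 = 0" using fun_cong[OF h, of 1] by simp
  then show ?thesis by simp
qed

lemma polynomial_leaky_flow:
  assumes "\<And>i. i \<in> J \<Longrightarrow> real_polynomial_function (\<lambda>y. g y i)" "finite J"
  shows "real_polynomial_function (\<lambda>y. leaky_flow k (g y) J)"
  unfolding leaky_flow_def using assms
  by (intro real_polynomial_function_diff real_polynomial_function_sum real_polynomial_function.intros(2)) auto

lemma polynomial_tree_sum:
  assumes "\<And>i. i \<in> L \<Longrightarrow> real_polynomial_function (\<lambda>y. g y i)" and L: "finite L" and T: "finite T"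
  shows "real_polynomial_function (\<lambda>y. tree_sum T L k x0 (g y) e)"
proof -
  have "real_polynomial_function (\<lambda>y. edge_flow T L k (g y) t d)" for t d
    unfolding edge_flow_def branch_flow_def
    by (rule polynomial_leaky_flow) (use assms in \<open>auto simp: legs_in_def\<close>)
  then show ?thesis
    unfolding tree_sum_def tree_weight_def
    by (intro real_polynomial_function_sum finite_labelled_trees L T
        real_polynomial_function.intros(4) real_polynomial_function_prod real_polynomial_function.intros(2))
      (auto intro: tree_finite_edges simp: labelled_trees_def)
qed

lemma tree_sum_same_side:
  assumes "finite L" "same_side L k x0 y0 {}"
  shows "tree_sum T L k x0 x e = tree_sum T L k y0 x e"
  unfolding tree_sum_def using rightward_same_side[OF _ assms] by (intro sum.cong refl) auto

text \<open>
  The tropical counts on the right-hand side of the formula, as sums over half trees with the signs tested at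
  one fixed point \<open>x1\<close>. The degree \<open>leaky_flow k x (- I)\<close> of the new end equals
  \<open>- leaky_flow k x I\<close>, which is the \<open>- \<delta>\<close> of the theorem.
\<close>
lemma H0_trop_half:
  fixes x x1 :: "'n::finite \<Rightarrow> real"
  assumes T: "finite T" "card T = nat (int (card I) - 1 - int (\<Sum>i\<in>I. e i))" and ne: "- I \<noteq> {}"
    and x: "(\<Sum>i\<in>UNIV. x i) = of_int k * (real CARD('n) - 2)"
    and x1: "(\<Sum>i\<in>UNIV. x1 i) = of_int k * (real CARD('n) - 2)"
    and side: "same_side UNIV k x1 x {I, - I}"
  shows "H0_trop T k (insert None (Some ` I)) (case_option (leaky_flow k x (- I)) x) (case_option 0 e) =
    tree_sum T (half_labels I) k (case_option (leaky_flow k x1 (- I)) x1)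
      (case_option (leaky_flow k x (- I)) x) (case_option 0 e)"
proof -
  note C = Compl_eq_Diff_UNIV
  have fin: "finite I" by simp
  have "H0_trop T k (half_labels I) (case_option (leaky_flow k x (- I)) x) (case_option 0 e) =
    tree_sum T (half_labels I) k (case_option (leaky_flow k x (- I)) x)
      (case_option (leaky_flow k x (- I)) x) (case_option 0 e)"
    using T half_total[of UNIV I x k] x
    by (intro H0_trop_eq_tree_sum finite_half_labels)
      (simp_all add: card_half_labels sum_half_labels C)
  also have "\<dots> = tree_sum T (half_labels I) k (case_option (leaky_flow k x1 (- I)) x1)
      (case_option (leaky_flow k x (- I)) x) (case_option 0 e)"
    using same_side_half[of UNIV I k x1 x] side x x1 ne
    by (intro tree_sum_same_side[symmetric] finite_half_labels) (simp_all add: C)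
  finally show ?thesis by (simp add: half_labels_def)
qed

section \<open>The wall-crossing formula\<close>

theorem theorem1p4:
  fixes k :: int
    and e :: "'n::finite \<Rightarrow> nat"
    and I :: "'n set"
    and C\<^sub>1 C\<^sub>2 :: "(real ^ 'n) set"
    and T T\<^sub>1 T\<^sub>2 :: "real set"
    and r r\<^sub>1 r\<^sub>2 :: int
    and \<delta> H H\<^sub>1 H\<^sub>2 :: "real ^ 'n \<Rightarrow> real"
  assumes "CARD('n) \<ge> 4"
    and "(\<Sum>i\<in>UNIV. e i) \<le> CARD('n) - 3"
    and "2 \<le> card I" and "card I \<le> CARD('n) - 2"
    and "\<delta> = wall_form k I"
    and "r = int CARD('n) - 2 - int (\<Sum>i\<in>UNIV. e i)"
    and "r\<^sub>1 = int (card I) - 1 - int (\<Sum>i\<in>I. e i)"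
    and "r\<^sub>2 = int (card (- I)) - 1 - int (\<Sum>i\<in>- I. e i)"
    and "finite T" and "card T = nat r"
    and "finite T\<^sub>1" and "card T\<^sub>1 = nat r\<^sub>1"
    and "finite T\<^sub>2" and "card T\<^sub>2 = nat r\<^sub>2"
    and "H = (\<lambda>x. H0_trop T k UNIV (($) x) e)"
    and "H\<^sub>1 = (\<lambda>x. H0_trop T\<^sub>1 k (insert None (Some ` I))
                     (case_option (- \<delta> x) (($) x)) (case_option 0 e))"
    and "H\<^sub>2 = (\<lambda>x. H0_trop T\<^sub>2 k (insert None (Some ` (- I)))
                     (case_option (\<delta> x) (($) x)) (case_option 0 e))"
    and "C\<^sub>1 \<in> chambers k" and "\<forall>x\<in>C\<^sub>1. \<delta> x > 0"
    and "C\<^sub>2 \<in> chambers k" and "\<forall>x\<in>C\<^sub>2. \<delta> x < 0"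
    and "adjacent_along (wall k I) C\<^sub>1 C\<^sub>2"
  shows "(\<exists>P\<^sub>1. polynomial_expression C\<^sub>1 H P\<^sub>1) \<and>
         (\<exists>P\<^sub>2. polynomial_expression C\<^sub>2 H P\<^sub>2) \<and>
         (\<exists>Q\<^sub>1. polynomial_expression (C\<^sub>1 \<union> C\<^sub>2) H\<^sub>1 Q\<^sub>1) \<and>
         (\<exists>Q\<^sub>2. polynomial_expression (C\<^sub>1 \<union> C\<^sub>2) H\<^sub>2 Q\<^sub>2) \<and>
         (\<forall>P\<^sub>1 P\<^sub>2 Q\<^sub>1 Q\<^sub>2.
            polynomial_expression C\<^sub>1 H P\<^sub>1 \<longrightarrow>
            polynomial_expression C\<^sub>2 H P\<^sub>2 \<longrightarrow>
            polynomial_expression (C\<^sub>1 \<union> C\<^sub>2) H\<^sub>1 Q\<^sub>1 \<longrightarrow>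
            polynomial_expression (C\<^sub>1 \<union> C\<^sub>2) H\<^sub>2 Q\<^sub>2 \<longrightarrow>
            (\<forall>x\<in>leaky_space k.
               P\<^sub>1 x - P\<^sub>2 x =
                 (if r\<^sub>1 \<le> 0 \<or> r\<^sub>2 \<le> 0 then 0
                  else fact (nat r) / (fact (nat r\<^sub>1) * fact (nat r\<^sub>2)) * \<delta> x * Q\<^sub>1 x * Q\<^sub>2 x)))"
proof -
  note delta = assms(5) and r1_eq = assms(7) and r2_eq = assms(8)
    and finT = assms(9) and cardT = assms(10) and finT1 = assms(11) and cardT1 = assms(12)
    and finT2 = assms(13) and cardT2 = assms(14)
    and H_eq = assms(15) and H1_eq = assms(16) and H2_eq = assms(17)
    and C1 = assms(18) and C2 = assms(20) and adjacent = assms(22)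
  note Compl = Compl_eq_Diff_UNIV[of I]
  obtain x1 where x1: "x1 \<in> C\<^sub>1"
    using C1 in_components_nonempty unfolding chambers_def by blast
  obtain x2 where x2: "x2 \<in> C\<^sub>2"
    using C2 in_components_nonempty unfolding chambers_def by blast
  have leaky: "(\<Sum>i\<in>UNIV. x $ i) = of_int k * (real (card (UNIV :: 'n set)) - 2)"
    if "x \<in> leaky_space k" for x :: "real ^ 'n"
    using that by (simp add: leaky_space_sum)
  note leaky1 = chamber_leaky[OF C1] and leaky2 = chamber_leaky[OF C2]
  have cI: "card (- I) = CARD('n) - card I" by (simp add: Compl card_Diff_subset)
  have ne: "I \<noteq> {}" "- I \<noteq> {}" using assms(1, 3, 4) cI by auto
  have proper: "J \<in> proper_walls" if "2 \<le> card J" "2 \<le> card (UNIV - J)" for J :: "'n set"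
    using that by (auto simp: proper_walls_def card_Diff_subset)
  have same: "same_side UNIV k (($) x) (($) y) {}"
    if "C \<in> chambers k" "x \<in> C" "y \<in> C" for C and x y :: "real ^ 'n"
    unfolding same_side_def
    using chamber_sgn[OF that(1) proper that(2,3)] by (simp add: wall_form_eq_leaky_flow)
  have adj: "same_side UNIV k (($) x) (($) y) {I, - I}" if "x \<in> C\<^sub>1" "y \<in> C\<^sub>2" for x y
    unfolding same_side_def
    using adjacent_sgn[OF C1 C2 proper _ _ adjacent that] by (simp add: wall_form_eq_leaky_flow)
  have side: "same_side UNIV k (($) x1) (($) x) {I, - I}" if "x \<in> C\<^sub>1 \<union> C\<^sub>2" for x
    using that adj[OF x1] same[OF C1 x1] by (auto simp: same_side_def)
  have wc: "leaky_flow k (($) x) (- I) = - \<delta> x" if "x \<in> leaky_space k" for x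
    using leaky_flow_complement[of UNIV I "($) x" k] leaky[OF that]
    by (simp add: Compl delta wall_form_eq_leaky_flow)

  \<comment> \<open>The signs are tested at one point of each chamber. For the two factors the point \<open>x1\<close> serves both
    chambers, as these are not separated by any wall for a half tree.\<close>
  define P1 where "P1 x = tree_sum T UNIV k (($) x1) (($) x) e" for x :: "real ^ 'n"
  define P2 where "P2 x = tree_sum T UNIV k (($) x2) (($) x) e" for x :: "real ^ 'n"
  define Q1 where "Q1 x = tree_sum T\<^sub>1 (half_labels I) k (case_option (leaky_flow k (($) x1) (- I)) (($) x1))
      (case_option (leaky_flow k (($) x) (- I)) (($) x)) (case_option 0 e)" for x :: "real ^ 'n"
  define Q2 where "Q2 x = tree_sum T\<^sub>2 (half_labels (- I)) k (case_option (leaky_flow k (($) x1) I) (($) x1))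
      (case_option (leaky_flow k (($) x) I) (($) x)) (case_option 0 e)" for x :: "real ^ 'n"

  have coord: "real_polynomial_function (\<lambda>x :: real ^ 'n. x $ i)" for i
    by (intro real_polynomial_function.intros(1) bounded_linear_vec_nth)
  have poly: "real_polynomial_function P1" "real_polynomial_function P2"
    unfolding P1_def P2_def using finT coord by (intro polynomial_tree_sum; simp)+
  have "real_polynomial_function (\<lambda>x :: real ^ 'n. case_option (leaky_flow k (($) x) J) (($) x) j)" for J j
    using coord polynomial_leaky_flow[of J "($)" k] by (cases j) simp_all
  then have polyQ: "real_polynomial_function Q1" "real_polynomial_function Q2"
    unfolding Q1_def Q2_def using finT1 finT2
    by (intro polynomial_tree_sum finite_half_labels; simp)+

  have H: "H x = tree_sum T UNIV k (($) x) (($) x) e" if "x \<in> leaky_space k" for x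
    unfolding H_eq using assms(6) finT cardT leaky[OF that] by (intro H0_trop_eq_tree_sum) simp_all
  have P1: "polynomial_expression C\<^sub>1 H P1"
    unfolding polynomial_expression_def P1_def
    using poly(1) H[OF leaky1] tree_sum_same_side[OF _ same[OF C1 x1]] by (auto simp: P1_def[abs_def])
  have P2: "polynomial_expression C\<^sub>2 H P2"
    unfolding polynomial_expression_def P2_def
    using poly(2) H[OF leaky2] tree_sum_same_side[OF _ same[OF C2 x2]] by (auto simp: P2_def[abs_def])
  have both: "x \<in> leaky_space k" if "x \<in> C\<^sub>1 \<union> C\<^sub>2" for x using that leaky1 leaky2 by blast
  have Q1: "polynomial_expression (C\<^sub>1 \<union> C\<^sub>2) H\<^sub>1 Q1"
    unfolding polynomial_expression_def
  proof (intro conjI polyQ ballI)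
    fix x assume x: "x \<in> C\<^sub>1 \<union> C\<^sub>2"
    show "Q1 x = H\<^sub>1 x"
      using H0_trop_half[OF finT1 cardT1[unfolded r1_eq] ne(2) leaky[OF both[OF x]] leaky[OF leaky1[OF x1]] side[OF x]]
      by (simp add: H1_eq Q1_def wc[OF both[OF x]])
  qed
  have Q2: "polynomial_expression (C\<^sub>1 \<union> C\<^sub>2) H\<^sub>2 Q2"
    unfolding polynomial_expression_def
  proof (intro conjI polyQ ballI)
    fix x assume x: "x \<in> C\<^sub>1 \<union> C\<^sub>2"
    have s: "same_side UNIV k (($) x1) (($) x) {- I, - (- I)}" using side[OF x] by (simp add: insert_commute)
    have n: "- (- I) \<noteq> {}" using ne by simp
    show "Q2 x = H\<^sub>2 x"
      using H0_trop_half[OF finT2 cardT2[unfolded r2_eq] n leaky[OF both[OF x]] leaky[OF leaky1[OF x1]] s]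
      by (simp add: H2_eq Q2_def delta wall_form_eq_leaky_flow)
  qed

  have formula: "P1 x - P2 x = (if r\<^sub>1 \<le> 0 \<or> r\<^sub>2 \<le> 0 then 0
      else fact (nat r) / (fact (nat r\<^sub>1) * fact (nat r\<^sub>2)) * \<delta> x * Q1 x * Q2 x)"
    if x: "x \<in> leaky_space k" for x
  proof -
    have pos: "leaky_flow k (($) x1) I > 0" "leaky_flow k (($) x2) I < 0"
      using assms(19, 21) delta x1 x2 by (auto simp: wall_form_eq_leaky_flow)
    have "P1 x - P2 x = \<delta> x * (\<Sum>A\<in>Pow T.
      tree_sum A (half_labels I) k (case_option (leaky_flow k (($) x1) (- I)) (($) x1))
        (case_option (leaky_flow k (($) x) (- I)) (($) x)) (case_option 0 e) *
      tree_sum (T - A) (half_labels (- I)) k (case_option (leaky_flow k (($) x1) I) (($) x1))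
        (case_option (leaky_flow k (($) x) I) (($) x)) (case_option 0 e))"
      using wall_crossing_sum[OF finT finite[of UNIV] subset_UNIV ne(1) ne(2)[unfolded Compl] leaky[OF x]
          leaky[OF leaky1[OF x1]] leaky[OF leaky2[OF x2]] adj[OF x1 x2, unfolded Compl] pos, of e]
      by (simp add: P1_def P2_def delta wall_form_eq_leaky_flow Compl)
    also have "(\<Sum>A\<in>Pow T.
      tree_sum A (half_labels I) k (case_option (leaky_flow k (($) x1) (- I)) (($) x1))
        (case_option (leaky_flow k (($) x) (- I)) (($) x)) (case_option 0 e) *
      tree_sum (T - A) (half_labels (- I)) k (case_option (leaky_flow k (($) x1) I) (($) x1))
        (case_option (leaky_flow k (($) x) I) (($) x)) (case_option 0 e)) =
      (if r\<^sub>1 \<le> 0 \<or> r\<^sub>2 \<le> 0 then 0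
       else fact (card T) / (fact (nat r\<^sub>1) * fact (nat r\<^sub>2)) * Q1 x * Q2 x)"
      unfolding Q1_def Q2_def
    proof (rule sum_subsets_card[OF finT finT1 finT2 _ _ _ _ _ cardT1 cardT2])
      have "(\<Sum>i\<in>UNIV. e i) = (\<Sum>i\<in>I. e i) + (\<Sum>i\<in>- I. e i)"
        using sum.subset_diff[of I UNIV e] by (simp add: Compl)
      then show "int (card T) = r\<^sub>1 + r\<^sub>2"
        using assms(1, 2, 3, 4, 6) r1_eq r2_eq cardT cI by linarith
    qed (simp_all add: finite_half_labels card_half_labels sum_half_labels r1_eq r2_eq)
    finally show ?thesis by (simp add: cardT)
  qed
  have unique: "p x = q x"
    if "C \<in> chambers k" "C \<subseteq> U" "polynomial_expression U f p" "polynomial_expression U f q"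
      "x \<in> leaky_space k" for C U f p q and x :: "real ^ 'n"
    using polynomial_eq_on_leaky_space[OF that(1) _ _ _ that(5), of p q] that(2,3,4)
    by (simp add: polynomial_expression_def subset_iff)
  show ?thesis
  proof (intro conjI allI impI ballI)
    fix P\<^sub>1 P\<^sub>2 Q\<^sub>1 Q\<^sub>2 and x :: "real ^ 'n"
    assume e: "polynomial_expression C\<^sub>1 H P\<^sub>1" "polynomial_expression C\<^sub>2 H P\<^sub>2"
      "polynomial_expression (C\<^sub>1 \<union> C\<^sub>2) H\<^sub>1 Q\<^sub>1" "polynomial_expression (C\<^sub>1 \<union> C\<^sub>2) H\<^sub>2 Q\<^sub>2"
      and x: "x \<in> leaky_space k"
    have "P\<^sub>1 x = P1 x" by (rule unique[OF C1 subset_refl e(1) P1 x])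
    moreover have "P\<^sub>2 x = P2 x" by (rule unique[OF C2 subset_refl e(2) P2 x])
    moreover have "Q\<^sub>1 x = Q1 x" by (rule unique[OF C1 Un_upper1 e(3) Q1 x])
    moreover have "Q\<^sub>2 x = Q2 x" by (rule unique[OF C1 Un_upper1 e(4) Q2 x])
    ultimately show "P\<^sub>1 x - P\<^sub>2 x = (if r\<^sub>1 \<le> 0 \<or> r\<^sub>2 \<le> 0 then 0
        else fact (nat r) / (fact (nat r\<^sub>1) * fact (nat r\<^sub>2)) * \<delta> x * Q\<^sub>1 x * Q\<^sub>2 x)"
      using formula[OF x] by simp
  qed (use P1 P2 Q1 Q2 in blast)+
qed

end
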